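(* Let $q$ be a prime, let $C_q$ be the cyclic group of order $q$, and let $A$ be an abelian group for which there is a set $\pi$ of primes such that, for every positive integer $n$, the $n$-torsion subgroup $\{a\in A: a^n=1\}$ is cyclic of order $n_\pi$, the $\pi$-part of $n$. Let $\ell:\mathbb{N}^+\to\mathbb{K}^\times$ be a monoid homomorphism. Then the algebra $\mathbb{K}_\ell\Lambda^A_{C_q}$ is semisimple if and only if $\ell(q)\neq |(C_q)^*|$. When semisimplicity holds, there is an isomorphism of $\mathbb{K}$-algebras $$\mathbb{K}_\ell\Lambda^A_{C_q}\cong \mathrm{Mat}_{|(C_q)^*|+1}(\mathbb{K})\oplus \mathrm{Mat}_{|(C_q)^*|-1}(\mathbb{K})\oplus\mathbb{K}^{q-1},$$ where the middle summand is absent if $|(C_q)^*|=1$.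
   Context: $\mathbb{K}$ is a field of characteristic zero with sufficiently many roots of unity (one may take: primitive roots of unity of every order). $A$ is written multiplicatively. For a finite group $F$, $F^*=\mathrm{Hom}(F,A)$. For a monoid homomorphism $\ell:\mathbb{N}^+\to\mathbb{K}^\times$ (from the multiplicative monoid of positive integers) and a finite group $X$, $\ell(X)=\ell(|X|)$. Let $G$ be a finite group. For $U\le G\times G$: $p_1(U),p_2(U)$ are the images of $U$ under the two coordinate projections, $k_1(U)=\{u\in G:(u,1)\in U\}$, $k_2(U)=\{u\in G:(1,u)\in U\}$. For $U,V\le G\times G$, $U\ast V=\{(u,v): \exists g\in G,\ (u,g)\in U,\ (g,v)\in V\}$. A subcharacter of $G\times G$ is a pair $(U,\varphi)$ with $U\le G\times G$ and $\varphi\in U^*$. Write $(U,\varphi)\sim(V,\psi)$ if $\varphi(1,g)\psi(g,1)=1$ for all $g\in k_2(U)\cap k_1(V)$; in that case $\varphi\ast\psi\in(U\ast V)^*$ is defined by $(\varphi\ast\psi)(u,v)=\varphi(u,g)\psi(g,v)$ for any $g$ with $(u,g)\in U,(g,v)\in V$. The $\ell$-deformed subcharacter algebra $\mathbb{K}_\ell\Lambda^A_G$ is the associative unital $\mathbb{K}$-algebra with $\mathbb{K}$-basis the symbols $s^{G,G}_{U,\varphi}$, indexed by all subcharacters of $G\times G$, and multiplication $s^{G,G}_{U,\varphi}s^{G,G}_{V,\psi}=\ell(k_2(U)\cap k_1(V))\,s^{G,G}_{U\ast V,\varphi\ast\psi}$ if $(U,\varphi)\sim(V,\psi)$, and $0$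 otherwise. *)

theory Defs
  imports
    "HOL-Algebra.Elementary_Groups"
    "HOL-Algebra.Chinese_Remainder"
    "HOL-Computational_Algebra.Primes"
    "HOL-Library.Poly_Mapping"
    "Jordan_Normal_Form.Matrix"
begin

section \<open>Arithmetic hypotheses\<close>

definition primitive_root_of_unity :: "nat \<Rightarrow> 'k::field \<Rightarrow> bool" where
  "primitive_root_of_unity n z \<longleftrightarrow> n > 0 \<and> z ^ n = 1 \<and> (\<forall>m. 0 < m \<and> m < n \<longrightarrow> z ^ m \<noteq> 1)"

definition pi_part :: "nat set \<Rightarrow> nat \<Rightarrow> nat" where
  "pi_part \<pi> n = (\<Prod>p \<in> prime_factors n \<inter> \<pi>. p ^ multiplicity p n)"

definition torsion :: "('a, 'm) monoid_scheme \<Rightarrow> nat \<Rightarrow> 'a set" where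
  "torsion A n = {a \<in> carrier A. a [^]\<^bsub>A\<^esub> n = \<one>\<^bsub>A\<^esub>}"

definition cyclic_pi_torsion :: "('a, 'm) monoid_scheme \<Rightarrow> nat set \<Rightarrow> bool" where
  "cyclic_pi_torsion A \<pi> \<longleftrightarrow>
     (\<forall>n > 0. cyclic_group (A\<lparr>carrier := torsion A n\<rparr>) \<and>
              finite (torsion A n) \<and> card (torsion A n) = pi_part \<pi> n)"

text \<open>Monoid homomorphisms from the positive integers to the units of a field; the value at
  \<open>0\<close> is irrelevant.\<close>

definition pos_monoid_hom :: "(nat \<Rightarrow> 'k::field) \<Rightarrow> bool" where
  "pos_monoid_hom ell \<longleftrightarrow>
     (\<forall>n > 0. ell n \<noteq> 0) \<and> ell 1 = 1 \<and> (\<forall>m > 0. \<forall>n > 0. ell (m * n) = ell m * ell n)"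


section \<open>Subcharacters\<close>

text \<open>\<open>F\<^sup>* = Hom(F, A)\<close>. Homomorphisms are normalised to be \<^const>\<open>undefined\<close> off the carrier,
  so that equality of functions is equality of homomorphisms.\<close>

definition dual :: "('a, 'm) monoid_scheme \<Rightarrow> ('f, 'n) monoid_scheme \<Rightarrow> ('f \<Rightarrow> 'a) set" where
  "dual A F = hom F A \<inter> extensional (carrier F)"

type_synonym ('g, 'a) subchar = "('g \<times> 'g) set \<times> ('g \<times> 'g \<Rightarrow> 'a)"

definition subchars ::
  "('a, 'm) monoid_scheme \<Rightarrow> ('g, 'n) monoid_scheme \<Rightarrow> ('g, 'a) subchar set" where
  "subchars A G =
     {(U, \<phi>). subgroup U (G \<times>\<times> G) \<and> \<phi> \<in> dual A ((G \<times>\<times> G)\<lparr>carrier := U\<rparr>)}"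

definition k1 :: "('g, 'n) monoid_scheme \<Rightarrow> ('g \<times> 'g) set \<Rightarrow> 'g set" where
  "k1 G U = {u \<in> carrier G. (u, \<one>\<^bsub>G\<^esub>) \<in> U}"

definition k2 :: "('g, 'n) monoid_scheme \<Rightarrow> ('g \<times> 'g) set \<Rightarrow> 'g set" where
  "k2 G U = {u \<in> carrier G. (\<one>\<^bsub>G\<^esub>, u) \<in> U}"

definition star ::
  "('g, 'n) monoid_scheme \<Rightarrow> ('g \<times> 'g) set \<Rightarrow> ('g \<times> 'g) set \<Rightarrow> ('g \<times> 'g) set" where
  "star G U V = {(u, v). \<exists>g \<in> carrier G. (u, g) \<in> U \<and> (g, v) \<in> V}"

definition compatible ::
  "('a, 'm) monoid_scheme \<Rightarrow> ('g, 'n) monoid_scheme \<Rightarrow>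
     ('g, 'a) subchar \<Rightarrow> ('g, 'a) subchar \<Rightarrow> bool" where
  "compatible A G = (\<lambda>(U, \<phi>) (V, \<psi>).
     \<forall>g \<in> k2 G U \<inter> k1 G V. \<phi> (\<one>\<^bsub>G\<^esub>, g) \<otimes>\<^bsub>A\<^esub> \<psi> (g, \<one>\<^bsub>G\<^esub>) = \<one>\<^bsub>A\<^esub>)"

text \<open>The value at \<open>(u, v)\<close> does not depend on the chosen \<open>g\<close> when the two subcharacters are
  compatible; it is used in that case only.\<close>

definition star_char ::
  "('a, 'm) monoid_scheme \<Rightarrow> ('g, 'n) monoid_scheme \<Rightarrow>
     ('g, 'a) subchar \<Rightarrow> ('g, 'a) subchar \<Rightarrow> 'g \<times> 'g \<Rightarrow> 'a" where
  "star_char A G = (\<lambda>(U, \<phi>) (V, \<psi>). \<lambda>(u, v) \<in> star G U V.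
     (let g = (SOME g. g \<in> carrier G \<and> (u, g) \<in> U \<and> (g, v) \<in> V)
      in \<phi> (u, g) \<otimes>\<^bsub>A\<^esub> \<psi> (g, v)))"

lemma star_char_eq:
  assumes G: "group G" and A: "comm_group A"
    and U: "(U, \<phi>) \<in> subchars A G" and V: "(V, \<psi>) \<in> subchars A G"
    and comp: "compatible A G (U, \<phi>) (V, \<psi>)"
    and ug: "(u, g) \<in> U" and gv: "(g, v) \<in> V"
  shows "star_char A G (U, \<phi>) (V, \<psi>) (u, v) = \<phi> (u, g) \<otimes>\<^bsub>A\<^esub> \<psi> (g, v)"
proof -
  interpret G: group G by fact
  interpret A: comm_group A by fact
  interpret GG: group "G \<times>\<times> G" by (intro DirProd_group G)
  have sU: "subgroup U (G \<times>\<times> G)" and hU: "\<phi> \<in> hom ((G \<times>\<times> G)\<lparr>carrier := U\<rparr>) A"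
    and sV: "subgroup V (G \<times>\<times> G)" and hV: "\<psi> \<in> hom ((G \<times>\<times> G)\<lparr>carrier := V\<rparr>) A"
    using U V by (auto simp: subchars_def dual_def)
  have carU: "a \<in> carrier G \<and> b \<in> carrier G" if "(a, b) \<in> U" for a b
    using subgroup.subset[OF sU] that by auto
  have carV: "a \<in> carrier G \<and> b \<in> carrier G" if "(a, b) \<in> V" for a b
    using subgroup.subset[OF sV] that by auto
  define h where "h = (SOME g. g \<in> carrier G \<and> (u, g) \<in> U \<and> (g, v) \<in> V)"
  have h: "h \<in> carrier G \<and> (u, h) \<in> U \<and> (h, v) \<in> V"
    unfolding h_def by (rule someI[of _ g]) (use ug gv carU in auto)
  note car = carU[OF ug] carV[OF gv] carU[of u h] carV[of h v]
  define d where "d = inv\<^bsub>G\<^esub> h \<otimes>\<^bsub>G\<^esub> g"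
  define e where "e = g \<otimes>\<^bsub>G\<^esub> inv\<^bsub>G\<^esub> h"
  have d: "d \<in> carrier G" and e: "e \<in> carrier G" using car h by (auto simp: d_def e_def)
  have heq: "e \<otimes>\<^bsub>G\<^esub> h = g" using car h by (simp add: e_def G.m_assoc)
  have eU: "(\<one>\<^bsub>G\<^esub>, inv\<^bsub>G\<^esub> e) \<in> U"
  proof -
    have "(u, h) \<otimes>\<^bsub>G \<times>\<times> G\<^esub> inv\<^bsub>G \<times>\<times> G\<^esub> (u, g) \<in> U"
      using h ug by (intro subgroup.m_closed[OF sU] subgroup.m_inv_closed[OF sU]) auto
    thus ?thesis using car h G by (simp add: inv_DirProd e_def G.inv_mult_group)
  qed
  have eV: "(inv\<^bsub>G\<^esub> e, \<one>\<^bsub>G\<^esub>) \<in> V"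
  proof -
    have "(h, v) \<otimes>\<^bsub>G \<times>\<times> G\<^esub> inv\<^bsub>G \<times>\<times> G\<^esub> (g, v) \<in> V"
      using h gv by (intro subgroup.m_closed[OF sV] subgroup.m_inv_closed[OF sV]) auto
    thus ?thesis using car h G by (simp add: inv_DirProd e_def G.inv_mult_group)
  qed
  have ie: "inv\<^bsub>G\<^esub> e \<otimes>\<^bsub>G\<^esub> g = h"
    using car h by (simp add: e_def G.inv_mult_group G.m_assoc)
  have c: "\<phi> (\<one>\<^bsub>G\<^esub>, inv\<^bsub>G\<^esub> e) \<otimes>\<^bsub>A\<^esub> \<psi> (inv\<^bsub>G\<^esub> e, \<one>\<^bsub>G\<^esub>) = \<one>\<^bsub>A\<^esub>"
    using comp eU eV e by (auto simp: compatible_def k1_def k2_def)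
  have 1: "\<phi> (u, h) = \<phi> (\<one>\<^bsub>G\<^esub>, inv\<^bsub>G\<^esub> e) \<otimes>\<^bsub>A\<^esub> \<phi> (u, g)"
    using hom_mult[OF hU, of "(\<one>\<^bsub>G\<^esub>, inv\<^bsub>G\<^esub> e)" "(u, g)"] eU ug car ie by simp
  have 2: "\<psi> (h, v) = \<psi> (inv\<^bsub>G\<^esub> e, \<one>\<^bsub>G\<^esub>) \<otimes>\<^bsub>A\<^esub> \<psi> (g, v)"
    using hom_mult[OF hV, of "(inv\<^bsub>G\<^esub> e, \<one>\<^bsub>G\<^esub>)" "(g, v)"] eV gv car ie by simp
  have cl: "\<phi> (\<one>\<^bsub>G\<^esub>, inv\<^bsub>G\<^esub> e) \<in> carrier A" "\<phi> (u, g) \<in> carrier A"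
      "\<psi> (inv\<^bsub>G\<^esub> e, \<one>\<^bsub>G\<^esub>) \<in> carrier A" "\<psi> (g, v) \<in> carrier A"
    using hom_in_carrier[OF hU] hom_in_carrier[OF hV] eU eV ug gv by auto
  have "\<phi> (u, h) \<otimes>\<^bsub>A\<^esub> \<psi> (h, v)
      = (\<phi> (\<one>\<^bsub>G\<^esub>, inv\<^bsub>G\<^esub> e) \<otimes>\<^bsub>A\<^esub> \<psi> (inv\<^bsub>G\<^esub> e, \<one>\<^bsub>G\<^esub>)) \<otimes>\<^bsub>A\<^esub> (\<phi> (u, g) \<otimes>\<^bsub>A\<^esub> \<psi> (g, v))"
    unfolding 1 2 using cl by (simp add: A.m_ac)
  hence "\<phi> (u, h) \<otimes>\<^bsub>A\<^esub> \<psi> (h, v) = \<phi> (u, g) \<otimes>\<^bsub>A\<^esub> \<psi> (g, v)"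
    using c cl by simp
  moreover have "(u, v) \<in> star G U V" using ug gv car by (auto simp: star_def)
  ultimately show ?thesis by (simp add: star_char_def h_def)
qed


section \<open>The deformed subcharacter algebra\<close>

text \<open>Elements are the finitely supported functions on the set of subcharacters, so the basis
  element indexed by \<open>x\<close> is \<open>Poly_Mapping.single x 1\<close>. The record type of the HOL-Algebra modules
  serves for (not necessarily commutative) algebras: a ring together with a scalar multiplication.\<close>

abbreviation pm_scale :: "'k::field \<Rightarrow> ('x \<Rightarrow>\<^sub>0 'k) \<Rightarrow> ('x \<Rightarrow>\<^sub>0 'k)" where
  "pm_scale c \<equiv> Poly_Mapping.map ((*) c)"

definition basis_mult ::
  "(nat \<Rightarrow> 'k::field) \<Rightarrow> ('a, 'm) monoid_scheme \<Rightarrow> ('g, 'n) monoid_scheme \<Rightarrow>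
     ('g, 'a) subchar \<Rightarrow> ('g, 'a) subchar \<Rightarrow> ('g, 'a) subchar \<Rightarrow>\<^sub>0 'k" where
  "basis_mult ell A G x y =
     (if compatible A G x y
      then Poly_Mapping.single (star G (fst x) (fst y), star_char A G x y)
             (ell (card (k2 G (fst x) \<inter> k1 G (fst y))))
      else 0)"

text \<open>The unit is the basis element of the diagonal subgroup with its trivial character.\<close>

definition subchar_algebra ::
  "(nat \<Rightarrow> 'k::field) \<Rightarrow> ('a, 'm) monoid_scheme \<Rightarrow> ('g, 'n) monoid_scheme \<Rightarrow>
     ('k, ('g, 'a) subchar \<Rightarrow>\<^sub>0 'k) module" where
  "subchar_algebra ell A G =
     \<lparr>carrier = {f. Poly_Mapping.keys f \<subseteq> subchars A G},
      monoid.mult = (\<lambda>f g. \<Sum>x \<in> Poly_Mapping.keys f. \<Sum>y \<in> Poly_Mapping.keys g.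
                pm_scale (Poly_Mapping.lookup f x * Poly_Mapping.lookup g y) (basis_mult ell A G x y)),
      one = (let D = (\<lambda>g. (g, g)) ` carrier G
             in Poly_Mapping.single (D, \<lambda>x \<in> D. \<one>\<^bsub>A\<^esub>) 1),
      zero = 0,
      add = (+),
      smult = pm_scale\<rparr>"


section \<open>Semisimplicity\<close>

definition left_ideal :: "'r set \<Rightarrow> ('r, 'm) ring_scheme \<Rightarrow> bool" where
  "left_ideal I R \<longleftrightarrow>
     additive_subgroup I R \<and> (\<forall>r \<in> carrier R. \<forall>x \<in> I. r \<otimes>\<^bsub>R\<^esub> x \<in> I)"

definition simple_left_ideal :: "'r set \<Rightarrow> ('r, 'm) ring_scheme \<Rightarrow> bool" where
  "simple_left_ideal I R \<longleftrightarrow>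
     left_ideal I R \<and> I \<noteq> {\<zero>\<^bsub>R\<^esub>} \<and>
     (\<forall>J. left_ideal J R \<and> J \<subseteq> I \<longrightarrow> J = {\<zero>\<^bsub>R\<^esub>} \<or> J = I)"

text \<open>The left regular module is an internal direct sum of simple submodules. Such a
  decomposition is necessarily finite, because \<open>1\<close> lies in the sum of finitely many summands.
  For a unital algebra, left ideals are automatically closed under scalar multiplication.\<close>

definition semisimple_ring :: "('r, 'm) ring_scheme \<Rightarrow> bool" where
  "semisimple_ring R \<longleftrightarrow>
     ring R \<and>
     (\<exists>(n::nat) I. (\<forall>i < n. simple_left_ideal (I i) R) \<and>
        (\<forall>x \<in> carrier R. \<exists>!f. f \<in> (\<Pi>\<^sub>E i \<in> {..<n}. I i) \<and> x = (\<Oplus>\<^bsub>R\<^esub>i \<in> {..<n}. f i)))"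


section \<open>Products and isomorphisms of algebras\<close>

definition alg_prod ::
  "('k, 'x) module \<Rightarrow> ('k, 'y) module \<Rightarrow> ('k, 'x \<times> 'y) module" (infixr \<open>\<oplus>\<^sub>a\<close> 65) where
  "X \<oplus>\<^sub>a Y = ring.extend (RDirProd X Y)
     \<lparr>smult = (\<lambda>c (x, y). (c \<odot>\<^bsub>X\<^esub> x, c \<odot>\<^bsub>Y\<^esub> y))\<rparr>"

abbreviation mat_alg :: "'k::field itself \<Rightarrow> nat \<Rightarrow> ('k, 'k mat) module" where
  "mat_alg ty n \<equiv> module_mat ty n n"

definition power_alg :: "'k::field itself \<Rightarrow> nat \<Rightarrow> ('k, nat \<Rightarrow> 'k) module" where
  "power_alg ty n =
     \<lparr>carrier = {..<n} \<rightarrow>\<^sub>E UNIV,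
      monoid.mult = (\<lambda>f g. \<lambda>i \<in> {..<n}. f i * g i),
      one = (\<lambda>i \<in> {..<n}. 1),
      zero = (\<lambda>i \<in> {..<n}. 0),
      add = (\<lambda>f g. \<lambda>i \<in> {..<n}. f i + g i),
      smult = (\<lambda>c f. \<lambda>i \<in> {..<n}. c * f i)\<rparr>"

definition alg_isomorphic :: "('k, 'x) module \<Rightarrow> ('k, 'y) module \<Rightarrow> bool" (infix \<open>\<cong>\<^sub>a\<close> 50) where
  "X \<cong>\<^sub>a Y \<longleftrightarrow>
     (\<exists>h \<in> ring_iso X Y. \<forall>c. \<forall>x \<in> carrier X. h (c \<odot>\<^bsub>X\<^esub> x) = c \<odot>\<^bsub>Y\<^esub> h x)"

end

theory Submission
  imports
    Defs
    "HOL-Number_Theory.Residue_Primitive_Roots"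
    "Jordan_Normal_Form.Determinant"
begin

text \<open>Write \<open>n = |G\<^sup>*|\<close>, which is \<open>1\<close> or \<open>q\<close>. The subcharacters whose subgroup is a direct product
  \<open>H \<times> K\<close> span a two-sided ideal. It is a Munn algebra of \<open>(n + 1) \<times> (n + 1)\<close> matrices, whose
  sandwich matrix is singular exactly when \<open>ell q = n\<close>. The remaining subgroups are the graphs of
  the automorphisms of \<open>G\<close>, and modulo the ideal their subcharacters form the group
  \<open>G\<^sup>* \<rtimes> Aut(G)\<close>. If the sandwich matrix is nonsingular, the action on the ideal, the \<open>q - 1\<close> linear
  characters of \<open>Aut(G)\<close> and, for \<open>n = q\<close>, the \<open>(q - 1)\<close>-dimensional induced representation are
  jointly faithful, and comparing dimensions shows that they give an isomorphism onto the product
  of matrix algebras. If \<open>ell q = n\<close>, a vector in the left kernel of the sandwich matrix yields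
  \<open>f \<noteq> 0\<close> with \<open>f r f = 0\<close> for all \<open>r\<close>, which no semisimple ring contains.\<close>

(* Otherwise the imported polynomial theories capture the name order. *)
hide_const (open) Polynomial.order


section \<open>Semisimplicity from orthogonal idempotents\<close>

text \<open>Elements of \<open>G\<close> and of the \<open>q\<close>-torsion of \<open>A\<close> are
  replaced by integer exponents, so that membership in a subgroup and equality of character values
  become divisibility statements about linear expressions. The ideal carries a representation of the
  whole algebra because left multiplication by a graph permutes the \<open>n + 1\<close> pairs of a
  subgroup of \<open>G\<close> and a character on it, fixing the trivial subgroup. On the
  \<open>n\<close> characters of \<open>G\<close> the sandwich matrix is \<open>ell q\<close> times
  a permutation matrix, and the row and column of the trivial subgroup consist of ones; the Schur
  complement is \<open>1 - n / ell q\<close>, whence the exceptional value. Joint faithfulness is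
  triangular: the linear and the induced representations vanish on the ideal and determine the graph
  coefficients by Fourier inversion, after which the sandwich matrix determines the rest.\<close>

text \<open>The condition \<open>x e = 0\<close> for all \<open>e \<in> E\<close> only for \<open>x = 0\<close> replaces the equation
  \<open>1 = \<Sum> E\<close>, which it implies by orthogonality; it passes to products and along isomorphisms
  without finite sums.\<close>

definition primitive_idempotent_system :: "'r set \<Rightarrow> ('r, 'm) ring_scheme \<Rightarrow> bool" where
  "primitive_idempotent_system E R \<longleftrightarrow>
     finite E \<and> E \<subseteq> carrier R - {\<zero>\<^bsub>R\<^esub>} \<and>
     (\<forall>e \<in> E. \<forall>e' \<in> E. e \<otimes>\<^bsub>R\<^esub> e' = (if e = e' then e else \<zero>\<^bsub>R\<^esub>)) \<and>
     (\<forall>x \<in> carrier R. (\<forall>e \<in> E. x \<otimes>\<^bsub>R\<^esub> e = \<zero>\<^bsub>R\<^esub>) \<longrightarrow> x = \<zero>\<^bsub>R\<^esub>) \<and>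
     (\<forall>e \<in> E. \<forall>x \<in> carrier R. x \<otimes>\<^bsub>R\<^esub> e \<noteq> \<zero>\<^bsub>R\<^esub> \<longrightarrow>
        (\<exists>r \<in> carrier R. r \<otimes>\<^bsub>R\<^esub> (x \<otimes>\<^bsub>R\<^esub> e) = e))"

lemma primitive_idempotent_systemD:
  assumes "primitive_idempotent_system E R"
  shows "finite E" "\<And>e. e \<in> E \<Longrightarrow> e \<in> carrier R" "\<And>e. e \<in> E \<Longrightarrow> e \<noteq> \<zero>\<^bsub>R\<^esub>"
    "\<And>e e'. e \<in> E \<Longrightarrow> e' \<in> E \<Longrightarrow> e \<otimes>\<^bsub>R\<^esub> e' = (if e = e' then e else \<zero>\<^bsub>R\<^esub>)"
    "\<And>x. x \<in> carrier R \<Longrightarrow> (\<And>e. e \<in> E \<Longrightarrow> x \<otimes>\<^bsub>R\<^esub> e = \<zero>\<^bsub>R\<^esub>) \<Longrightarrow> x = \<zero>\<^bsub>R\<^esub>"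
    "\<And>e x. e \<in> E \<Longrightarrow> x \<in> carrier R \<Longrightarrow> x \<otimes>\<^bsub>R\<^esub> e \<noteq> \<zero>\<^bsub>R\<^esub> \<Longrightarrow>
       \<exists>r \<in> carrier R. r \<otimes>\<^bsub>R\<^esub> (x \<otimes>\<^bsub>R\<^esub> e) = e"
  using assms unfolding primitive_idempotent_system_def by (simp, blast, blast, blast, simp, simp)

text \<open>The simple summands are the left ideals \<open>R e\<close>: a nonzero element
  \<open>x e\<close> can be multiplied back to \<open>e\<close>, so it generates all of
  \<open>R e\<close>. Multiplying a decomposition of \<open>x\<close> by \<open>e\<close> on the
  right kills the other summands, which forces the component of \<open>x\<close> in
  \<open>R e\<close> to be \<open>x e\<close>.\<close>

lemma semisimple_ring_if_primitive_idempotent_system: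
  assumes R: "ring R" and E: "primitive_idempotent_system E R"
  shows "semisimple_ring R"
proof -
  interpret ring R by (rule R)
  have sub: "E \<subseteq> carrier R" using primitive_idempotent_systemD(2)[OF E] by auto
  note fin = primitive_idempotent_systemD(1)[OF E] and nz = primitive_idempotent_systemD(3)[OF E]
    and orth = primitive_idempotent_systemD(4)[OF E]
    and faithful = primitive_idempotent_systemD(5)[OF E]
    and minimal = primitive_idempotent_systemD(6)[OF E]
  obtain b where b: "bij_betw b {..<card E} E"
    using ex_bij_betw_nat_finite[OF fin] by (auto simp: lessThan_atLeast0)
  define n where "n = card E"
  define I where "I i = (\<lambda>x. x \<otimes>\<^bsub>R\<^esub> b i) ` carrier R" for i
  have bE: "b i \<in> E" if "i < n" for i
    using b that by (auto simp: bij_betw_def n_def)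
  have bR: "b i \<in> carrier R" if "i < n" for i using bE[OF that] sub by auto
  have bb: "b i \<otimes>\<^bsub>R\<^esub> b j = (if i = j then b i else \<zero>\<^bsub>R\<^esub>)" if "i < n" "j < n" for i j
  proof (cases "i = j")
    case False
    hence "b i \<noteq> b j" using b that by (auto simp: bij_betw_def inj_on_def n_def)
    thus ?thesis using False orth[OF bE[OF that(1)] bE[OF that(2)]] by simp
  qed (use orth bE that in auto)
  have IR: "I i \<subseteq> carrier R" if "i < n" for i using bR[OF that] by (auto simp: I_def)
  have absorb: "y \<otimes>\<^bsub>R\<^esub> b j = (if i = j then y else \<zero>\<^bsub>R\<^esub>)" if ij: "i < n" "j < n" and y: "y \<in> I i" for i j y
  proof -
    obtain x where x: "x \<in> carrier R" "y = x \<otimes>\<^bsub>R\<^esub> b i" using y by (auto simp: I_def)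
    have "y \<otimes>\<^bsub>R\<^esub> b j = x \<otimes>\<^bsub>R\<^esub> (b i \<otimes>\<^bsub>R\<^esub> b j)" using x bR ij by (simp add: m_assoc)
    thus ?thesis using bb[OF ij] x by auto
  qed
  have sum_absorb: "(\<Oplus>\<^bsub>R\<^esub>i\<in>{..<n}. f i) \<otimes>\<^bsub>R\<^esub> b j = f j"
    if "j < n" "\<And>i. i < n \<Longrightarrow> f i \<in> I i" for f j
  proof -
    have fR: "f \<in> {..<n} \<rightarrow> carrier R" using that(2) IR by auto
    have "(\<Oplus>\<^bsub>R\<^esub>i\<in>{..<n}. f i) \<otimes>\<^bsub>R\<^esub> b j = (\<Oplus>\<^bsub>R\<^esub>i\<in>{..<n}. f i \<otimes>\<^bsub>R\<^esub> b j)"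
      by (rule finsum_ldistr) (use fR bR that in auto)
    also have "\<dots> = (\<Oplus>\<^bsub>R\<^esub>i\<in>{..<n}. if j = i then f i else \<zero>\<^bsub>R\<^esub>)"
      by (rule finsum_cong') (use fR absorb that in \<open>auto simp: Pi_def\<close>)
    also have "\<dots> = f j"
      by (rule add.finprod_singleton) (use fR that in auto)
    finally show ?thesis .
  qed
  have simple: "simple_left_ideal (I i) R" if i: "i < n" for i
  proof -
    have "subgroup (I i) (add_monoid R)"
    proof (rule add.subgroupI)
      show "I i \<subseteq> carrier R" by (rule IR[OF i])
      show "I i \<noteq> {}" by (auto simp: I_def)
    next
      fix a assume "a \<in> I i"
      then obtain x where x: "x \<in> carrier R" "a = x \<otimes>\<^bsub>R\<^esub> b i" by (auto simp: I_def)
      hence "\<ominus>\<^bsub>R\<^esub> a = (\<ominus>\<^bsub>R\<^esub> x) \<otimes>\<^bsub>R\<^esub> b i" using bR i by (simp add: l_minus)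
      thus "\<ominus>\<^bsub>R\<^esub> a \<in> I i" using x by (auto simp: I_def)
    next
      fix a a' assume "a \<in> I i" "a' \<in> I i"
      then obtain x x' where x: "x \<in> carrier R" "a = x \<otimes>\<^bsub>R\<^esub> b i" "x' \<in> carrier R" "a' = x' \<otimes>\<^bsub>R\<^esub> b i"
        by (auto simp: I_def)
      hence "a \<oplus>\<^bsub>R\<^esub> a' = (x \<oplus>\<^bsub>R\<^esub> x') \<otimes>\<^bsub>R\<^esub> b i" using bR i by (simp add: l_distr)
      thus "a \<oplus>\<^bsub>R\<^esub> a' \<in> I i" using x by (auto simp: I_def)
    qed
    moreover have "r \<otimes>\<^bsub>R\<^esub> x \<in> I i" if "r \<in> carrier R" "x \<in> I i" for r x
      using that bR[OF i] by (auto simp: I_def m_assoc[symmetric])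
    ultimately have li: "left_ideal (I i) R"
      by (auto simp: left_ideal_def additive_subgroup_def)
    have bI: "b i \<in> I i" using bR[OF i] by (auto simp: I_def intro!: image_eqI[of _ _ "\<one>\<^bsub>R\<^esub>"])
    have "J = {\<zero>\<^bsub>R\<^esub>} \<or> J = I i" if J: "left_ideal J R" "J \<subseteq> I i" for J
    proof (rule disjCI)
      assume "J \<noteq> I i"
      show "J = {\<zero>\<^bsub>R\<^esub>}"
      proof (rule ccontr)
        assume "J \<noteq> {\<zero>\<^bsub>R\<^esub>}"
        moreover have "\<zero>\<^bsub>R\<^esub> \<in> J"
          using J(1) additive_subgroup.zero_closed by (auto simp: left_ideal_def)
        ultimately obtain y where y: "y \<in> J" "y \<noteq> \<zero>\<^bsub>R\<^esub>" by auto
        then obtain x where x: "x \<in> carrier R" "y = x \<otimes>\<^bsub>R\<^esub> b i" using J by (auto simp: I_def)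
        then obtain r where r: "r \<in> carrier R" "r \<otimes>\<^bsub>R\<^esub> y = b i" using minimal[OF bE[OF i]] y by blast
        have "r \<otimes>\<^bsub>R\<^esub> y \<in> J" using J(1) r(1) y(1) by (simp add: left_ideal_def)
        hence "b i \<in> J" using r(2) by simp
        hence "I i \<subseteq> J" using J(1) by (auto simp: I_def left_ideal_def)
        with J \<open>J \<noteq> I i\<close> show False by auto
      qed
    qed
    with li bI nz[OF bE[OF i]] show ?thesis by (auto simp: simple_left_ideal_def)
  qed
  have "\<exists>!f. f \<in> (\<Pi>\<^sub>E i \<in> {..<n}. I i) \<and> x = (\<Oplus>\<^bsub>R\<^esub>i \<in> {..<n}. f i)" if x: "x \<in> carrier R" for x
  proof (rule ex1I)
    define f where "f = (\<lambda>i\<in>{..<n}. x \<otimes>\<^bsub>R\<^esub> b i)"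
    have f: "f i \<in> I i" if "i < n" for i using that x by (auto simp: f_def I_def)
    define s where "s = (\<Oplus>\<^bsub>R\<^esub>i \<in> {..<n}. f i)"
    have s: "s \<in> carrier R" unfolding s_def by (rule finsum_closed) (use f IR in auto)
    \<comment> \<open>The difference is annihilated by every idempotent; this is where the
      faithfulness clause replaces the equation between 1 and the sum of \<open>E\<close>.\<close>
    have "x \<ominus>\<^bsub>R\<^esub> s = \<zero>\<^bsub>R\<^esub>"
    proof (rule faithful)
      show "x \<ominus>\<^bsub>R\<^esub> s \<in> carrier R" using x s by simp
      fix e assume "e \<in> E"
      then obtain j where j: "j < n" "e = b j" using b by (auto simp: bij_betw_def n_def)
      have "s \<otimes>\<^bsub>R\<^esub> b j = x \<otimes>\<^bsub>R\<^esub> b j"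
        unfolding s_def by (subst sum_absorb) (use f j in \<open>auto simp: f_def\<close>)
      thus "(x \<ominus>\<^bsub>R\<^esub> s) \<otimes>\<^bsub>R\<^esub> e = \<zero>\<^bsub>R\<^esub>"
        using x s bR[OF j(1)] by (simp add: j minus_eq l_distr l_minus r_neg)
    qed
    hence "x = s" using x s by simp
    thus "f \<in> (\<Pi>\<^sub>E i \<in> {..<n}. I i) \<and> x = (\<Oplus>\<^bsub>R\<^esub>i \<in> {..<n}. f i)"
      using f by (auto simp: s_def f_def)
    fix g assume g: "g \<in> (\<Pi>\<^sub>E i \<in> {..<n}. I i) \<and> x = (\<Oplus>\<^bsub>R\<^esub>i \<in> {..<n}. g i)"
    show "g = f"
    proof
      fix i show "g i = f i"
      proof (cases "i < n")
        case True
        have "(\<Oplus>\<^bsub>R\<^esub>i\<in>{..<n}. g i) \<otimes>\<^bsub>R\<^esub> b i = g i"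
          by (rule sum_absorb[OF True]) (use g in auto)
        thus ?thesis using True conjunct2[OF g] unfolding f_def by simp
      qed (use g in \<open>auto simp: f_def PiE_def extensional_def\<close>)
    qed
  qed
  with R simple show ?thesis
    unfolding semisimple_ring_def by (intro conjI exI[of _ n] exI[of _ I] allI impI ballI)
qed

lemma primitive_idempotent_system_iso:
  assumes R: "ring R" and S: "ring S" and h: "h \<in> ring_iso R S"
    and E: "primitive_idempotent_system E R"
  shows "primitive_idempotent_system (h ` E) S"
proof -
  interpret R: ring R by (rule R)
  interpret S: ring S by (rule S)
  have hom: "h \<in> Ring.ring_hom R S" and bij: "bij_betw h (carrier R) (carrier S)"
    using h by (auto simp: ring_iso_def)
  interpret h: ring_hom_ring R S h by (rule ring_hom_ringI2[OF R S hom])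
  have inj: "h x = h y \<longleftrightarrow> x = y" if "x \<in> carrier R" "y \<in> carrier R" for x y
    using bij that by (auto simp: bij_betw_def inj_on_def)
  have inj0: "h x = \<zero>\<^bsub>S\<^esub> \<longleftrightarrow> x = \<zero>\<^bsub>R\<^esub>" if "x \<in> carrier R" for x
    using inj[OF that R.zero_closed] by simp
  have carS: "carrier S = h ` carrier R" using bij by (auto simp: bij_betw_def)
  note D = primitive_idempotent_systemD[OF E]
  have he: "h x \<otimes>\<^bsub>S\<^esub> h e = h (x \<otimes>\<^bsub>R\<^esub> e)" if "x \<in> carrier R" "e \<in> E" for x e
    using that D(2) by simp
  show ?thesis
    unfolding primitive_idempotent_system_def carS ball_simps bex_simps
  proof (intro conjI ballI impI)
    show "finite (h ` E)" using D(1) by simp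
    show "h ` E \<subseteq> h ` carrier R - {\<zero>\<^bsub>S\<^esub>}" using D(2,3) inj0 by auto
  next
    fix e e' assume e: "e \<in> E" "e' \<in> E"
    show "h e \<otimes>\<^bsub>S\<^esub> h e' = (if h e = h e' then h e else \<zero>\<^bsub>S\<^esub>)"
      using he[OF D(2)[OF e(1)] e(2)] D(4)[OF e] inj[OF D(2)[OF e(1)] D(2)[OF e(2)]] by simp
  next
    fix x assume x: "x \<in> carrier R" and 0: "\<forall>e\<in>E. h x \<otimes>\<^bsub>S\<^esub> h e = \<zero>\<^bsub>S\<^esub>"
    have "x \<otimes>\<^bsub>R\<^esub> e = \<zero>\<^bsub>R\<^esub>" if "e \<in> E" for e
      using 0 that x D(2)[OF that] he[OF x that] inj0[of "x \<otimes>\<^bsub>R\<^esub> e"] by simp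
    thus "h x = \<zero>\<^bsub>S\<^esub>" using D(5)[OF x] by simp
  next
    fix e x assume e: "e \<in> E" and x: "x \<in> carrier R" and n0: "h x \<otimes>\<^bsub>S\<^esub> h e \<noteq> \<zero>\<^bsub>S\<^esub>"
    have "x \<otimes>\<^bsub>R\<^esub> e \<noteq> \<zero>\<^bsub>R\<^esub>" using n0 he[OF x e] by auto
    from D(6)[OF e x this] obtain r where r: "r \<in> carrier R" "r \<otimes>\<^bsub>R\<^esub> (x \<otimes>\<^bsub>R\<^esub> e) = e" by blast
    have "h (r \<otimes>\<^bsub>R\<^esub> (x \<otimes>\<^bsub>R\<^esub> e)) = h r \<otimes>\<^bsub>S\<^esub> (h x \<otimes>\<^bsub>S\<^esub> h e)"
      using r(1) x D(2)[OF e] by simp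
    with r show "\<exists>r\<in>carrier R. h r \<otimes>\<^bsub>S\<^esub> (h x \<otimes>\<^bsub>S\<^esub> h e) = h e"
      by (intro bexI[of _ r]) simp_all
  qed
qed

section \<open>Products of algebras\<close>

lemma alg_prod_simps [simp]:
  "carrier (X \<oplus>\<^sub>a Y) = carrier X \<times> carrier Y"
  "(x, y) \<otimes>\<^bsub>X \<oplus>\<^sub>a Y\<^esub> (x', y') = (x \<otimes>\<^bsub>X\<^esub> x', y \<otimes>\<^bsub>Y\<^esub> y')"
  "(x, y) \<oplus>\<^bsub>X \<oplus>\<^sub>a Y\<^esub> (x', y') = (x \<oplus>\<^bsub>X\<^esub> x', y \<oplus>\<^bsub>Y\<^esub> y')"
  "\<one>\<^bsub>X \<oplus>\<^sub>a Y\<^esub> = (\<one>\<^bsub>X\<^esub>, \<one>\<^bsub>Y\<^esub>)"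
  "\<zero>\<^bsub>X \<oplus>\<^sub>a Y\<^esub> = (\<zero>\<^bsub>X\<^esub>, \<zero>\<^bsub>Y\<^esub>)"
  "c \<odot>\<^bsub>X \<oplus>\<^sub>a Y\<^esub> (x, y) = (c \<odot>\<^bsub>X\<^esub> x, c \<odot>\<^bsub>Y\<^esub> y)"
  by (simp_all add: alg_prod_def RDirProd_def DirProd_def ring.defs monoid.defs)

lemma ring_alg_prod:
  assumes "ring X" "ring Y"
  shows "ring (X \<oplus>\<^sub>a Y)"
proof -
  interpret X: ring X by fact
  interpret Y: ring Y by fact
  show ?thesis
  proof (rule ringI)
    show "abelian_group (X \<oplus>\<^sub>a Y)"
    proof (rule abelian_groupI)
      fix x assume "x \<in> carrier (X \<oplus>\<^sub>a Y)"
      then obtain a b where "x = (a, b)" "a \<in> carrier X" "b \<in> carrier Y" by auto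
      thus "\<exists>y\<in>carrier (X \<oplus>\<^sub>a Y). y \<oplus>\<^bsub>X \<oplus>\<^sub>a Y\<^esub> x = \<zero>\<^bsub>X \<oplus>\<^sub>a Y\<^esub>"
        by (intro bexI[of _ "(\<ominus>\<^bsub>X\<^esub> a, \<ominus>\<^bsub>Y\<^esub> b)"]) (auto simp: X.l_neg Y.l_neg)
    qed (auto simp: X.a_ac Y.a_ac)
    show "Group.monoid (X \<oplus>\<^sub>a Y)"
      by (rule monoidI) (auto simp: X.m_assoc Y.m_assoc)
  qed (auto simp: X.l_distr Y.l_distr X.r_distr Y.r_distr)
qed

lemma primitive_idempotent_system_alg_prod:
  assumes X: "ring X" and Y: "ring Y"
    and E: "primitive_idempotent_system E X" and F: "primitive_idempotent_system F Y"
  shows "primitive_idempotent_system ((\<lambda>e. (e, \<zero>\<^bsub>Y\<^esub>)) ` E \<union> (\<lambda>f. (\<zero>\<^bsub>X\<^esub>, f)) ` F) (X \<oplus>\<^sub>a Y)"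
proof -
  interpret X: ring X by (rule X)
  interpret Y: ring Y by (rule Y)
  note D = primitive_idempotent_systemD[OF E] and D' = primitive_idempotent_systemD[OF F]
  note [simp] = D(1,2) D'(1,2)
  show ?thesis
    unfolding primitive_idempotent_system_def ball_Un ball_simps
  proof (intro conjI ballI impI)
    show "(\<lambda>e. (e, \<zero>\<^bsub>Y\<^esub>)) ` E \<union> (\<lambda>f. (\<zero>\<^bsub>X\<^esub>, f)) ` F \<subseteq> carrier (X \<oplus>\<^sub>a Y) - {\<zero>\<^bsub>X \<oplus>\<^sub>a Y\<^esub>}"
      using D(3) D'(3) by auto
  next
    fix z assume z: "z \<in> carrier (X \<oplus>\<^sub>a Y)"
      and 0: "(\<forall>e\<in>E. z \<otimes>\<^bsub>X \<oplus>\<^sub>a Y\<^esub> (e, \<zero>\<^bsub>Y\<^esub>) = \<zero>\<^bsub>X \<oplus>\<^sub>a Y\<^esub>) \<and>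
              (\<forall>f\<in>F. z \<otimes>\<^bsub>X \<oplus>\<^sub>a Y\<^esub> (\<zero>\<^bsub>X\<^esub>, f) = \<zero>\<^bsub>X \<oplus>\<^sub>a Y\<^esub>)"
    obtain x y where xy: "z = (x, y)" "x \<in> carrier X" "y \<in> carrier Y" using z by auto
    with 0 have "x = \<zero>\<^bsub>X\<^esub>" "y = \<zero>\<^bsub>Y\<^esub>" using D(5)[of x] D'(5)[of y] by auto
    thus "z = \<zero>\<^bsub>X \<oplus>\<^sub>a Y\<^esub>" using xy by simp
  next
    fix e z assume e: "e \<in> E" and z: "z \<in> carrier (X \<oplus>\<^sub>a Y)"
      and n0: "z \<otimes>\<^bsub>X \<oplus>\<^sub>a Y\<^esub> (e, \<zero>\<^bsub>Y\<^esub>) \<noteq> \<zero>\<^bsub>X \<oplus>\<^sub>a Y\<^esub>"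
    obtain x y where xy: "z = (x, y)" "x \<in> carrier X" "y \<in> carrier Y" using z by auto
    with n0 obtain r where "r \<in> carrier X" "r \<otimes>\<^bsub>X\<^esub> (x \<otimes>\<^bsub>X\<^esub> e) = e"
      using D(6)[OF e, of x] by auto
    thus "\<exists>r\<in>carrier (X \<oplus>\<^sub>a Y). r \<otimes>\<^bsub>X \<oplus>\<^sub>a Y\<^esub> (z \<otimes>\<^bsub>X \<oplus>\<^sub>a Y\<^esub> (e, \<zero>\<^bsub>Y\<^esub>)) = (e, \<zero>\<^bsub>Y\<^esub>)"
      using xy by (intro bexI[of _ "(r, \<zero>\<^bsub>Y\<^esub>)"]) auto
  next
    fix f z assume f: "f \<in> F" and z: "z \<in> carrier (X \<oplus>\<^sub>a Y)"
      and n0: "z \<otimes>\<^bsub>X \<oplus>\<^sub>a Y\<^esub> (\<zero>\<^bsub>X\<^esub>, f) \<noteq> \<zero>\<^bsub>X \<oplus>\<^sub>a Y\<^esub>"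
    obtain x y where xy: "z = (x, y)" "x \<in> carrier X" "y \<in> carrier Y" using z by auto
    with n0 obtain r where "r \<in> carrier Y" "r \<otimes>\<^bsub>Y\<^esub> (y \<otimes>\<^bsub>Y\<^esub> f) = f"
      using D'(6)[OF f, of y] by auto
    thus "\<exists>r\<in>carrier (X \<oplus>\<^sub>a Y). r \<otimes>\<^bsub>X \<oplus>\<^sub>a Y\<^esub> (z \<otimes>\<^bsub>X \<oplus>\<^sub>a Y\<^esub> (\<zero>\<^bsub>X\<^esub>, f)) = (\<zero>\<^bsub>X\<^esub>, f)"
      using xy by (intro bexI[of _ "(\<zero>\<^bsub>X\<^esub>, r)"]) auto
  qed (use D(3,4) D'(3,4) in auto)
qed

section \<open>Matrix algebras\<close>

lemma ring_mat_alg: "ring (mat_alg TYPE('k::field) n)"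
  by unfold_locales
    (use add_inv_exists_mat in \<open>auto simp: module_mat_simps algebra_simps Units_def module_mat_def\<close>)

definition elementary_mat :: "nat \<Rightarrow> nat \<Rightarrow> nat \<Rightarrow> 'k::field mat" where
  "elementary_mat n a b = mat n n (\<lambda>(i, j). if i = a \<and> j = b then 1 else 0)"

lemma index_mult_elementary_mat:
  assumes "x \<in> carrier_mat n n" "a < n" "b < n" "i < n" "j < n"
  shows "(x * elementary_mat n a b) $$ (i, j) = (if j = b then x $$ (i, a) else 0)"
    and "(elementary_mat n a b * x) $$ (i, j) = (if i = a then x $$ (b, j) else 0)"
  using assms
  by (auto simp: elementary_mat_def scalar_prod_def if_distrib[of "\<lambda>z. _ * z"]
      if_distrib[of "\<lambda>z. z * _"] if_distribR cong: if_cong)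

text \<open>Right multiplication by a diagonal matrix unit cuts out one column, and one nonzero
  entry of that column suffices to recover the unit. Size 0 is included: the empty system is
  faithful there because only one matrix exists. This covers the middle factor when
  \<open>n = 1\<close>.\<close>

lemma primitive_idempotent_system_mat_alg:
  "primitive_idempotent_system ((\<lambda>a. elementary_mat n a a) ` {..<n}) (mat_alg TYPE('k::field) n)"
proof -
  have car: "elementary_mat n a b \<in> carrier_mat n n" for a b
    by (simp add: elementary_mat_def)
  have inj: "elementary_mat n a a = (elementary_mat n b b :: 'k mat) \<longleftrightarrow> a = b"
    if "a < n" "b < n" for a b
  proof
    assume eq: "elementary_mat n a a = (elementary_mat n b b :: 'k mat)"
    have "(elementary_mat n a a :: 'k mat) $$ (a, a) = elementary_mat n b b $$ (a, a)"
      by (simp only: eq)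
    thus "a = b" using that by (auto simp: elementary_mat_def split: if_splits)
  qed simp
  have nz: "elementary_mat n a a \<noteq> (0\<^sub>m n n :: 'k mat)" if a: "a < n" for a
  proof
    assume eq: "elementary_mat n a a = (0\<^sub>m n n :: 'k mat)"
    have "(elementary_mat n a a :: 'k mat) $$ (a, a) = 0\<^sub>m n n $$ (a, a)" by (simp only: eq)
    thus False using a by (auto simp: elementary_mat_def)
  qed
  have idem: "elementary_mat n a a * elementary_mat n b b
      = (if a = b then elementary_mat n a a else (0\<^sub>m n n :: 'k mat))" if ab: "a < n" "b < n" for a b
  proof (rule eq_matI)
    fix i j
    assume "i < dim_row (if a = b then elementary_mat n a a else (0\<^sub>m n n :: 'k mat))"
      and "j < dim_col (if a = b then elementary_mat n a a else (0\<^sub>m n n :: 'k mat))"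
    hence ij: "i < n" "j < n" by (auto simp: elementary_mat_def split: if_splits)
    have "(elementary_mat n a a * elementary_mat n b b :: 'k mat) $$ (i, j)
        = (if j = b then elementary_mat n a a $$ (i, b) else 0)"
      by (rule index_mult_elementary_mat(1)[OF car ab(2) ab(2) ij])
    thus "(elementary_mat n a a * elementary_mat n b b) $$ (i, j)
        = (if a = b then elementary_mat n a a else (0\<^sub>m n n :: 'k mat)) $$ (i, j)"
      using ab ij by (auto simp: elementary_mat_def)
  qed (auto simp: elementary_mat_def)
  have faithful: "x = 0\<^sub>m n n" if x: "x \<in> carrier_mat n n"
    and 0: "\<And>a. a < n \<Longrightarrow> x * elementary_mat n a a = (0\<^sub>m n n :: 'k mat)" for x
  proof (rule eq_matI)
    fix i j assume "i < dim_row (0\<^sub>m n n :: 'k mat)" "j < dim_col (0\<^sub>m n n :: 'k mat)"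
    hence ij: "i < n" "j < n" by auto
    have "x $$ (i, j) = (x * elementary_mat n j j) $$ (i, j)"
      using index_mult_elementary_mat(1)[OF x ij(2) ij(2) ij] by simp
    thus "x $$ (i, j) = 0\<^sub>m n n $$ (i, j)" using 0[OF ij(2)] ij by simp
  qed (use x in auto)
  have minimal: "\<exists>r\<in>carrier_mat n n. r * (x * elementary_mat n a a) = elementary_mat n a a"
    if x: "x \<in> carrier_mat n n" and a: "a < n"
      and n0: "x * elementary_mat n a a \<noteq> (0\<^sub>m n n :: 'k mat)" for x a
  proof -
    define y where "y = x * elementary_mat n a a"
    have y: "y \<in> carrier_mat n n" unfolding y_def by (rule mult_carrier_mat[OF x car])
    obtain i where i: "i < n" "x $$ (i, a) \<noteq> 0"
    proof (rule ccontr)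
      assume "\<not> thesis"
      hence no: "x $$ (i, a) = 0" if "i < n" for i using that \<open>\<And>i. i < n \<Longrightarrow> x $$ (i, a) \<noteq> 0 \<Longrightarrow> thesis\<close> by blast
      have "y = 0\<^sub>m n n"
      proof (rule eq_matI)
        fix i j assume "i < dim_row (0\<^sub>m n n :: 'k mat)" "j < dim_col (0\<^sub>m n n :: 'k mat)"
        hence ij: "i < n" "j < n" by auto
        show "y $$ (i, j) = 0\<^sub>m n n $$ (i, j)"
          unfolding y_def index_mult_elementary_mat(1)[OF x a a ij] using ij no by simp
      qed (use y in auto)
      thus False using n0 by (simp add: y_def)
    qed
    \<comment> \<open>In row \<open>i\<close>, the matrix \<open>y\<close> has a single nonzero
      entry, in column \<open>a\<close>. The matrix unit at \<open>(a, i)\<close> moves this row to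
      row \<open>a\<close>, and the scalar normalises the entry.\<close>
    define r where "r = inverse (x $$ (i, a)) \<cdot>\<^sub>m elementary_mat n a i"
    have "r * y = inverse (x $$ (i, a)) \<cdot>\<^sub>m (elementary_mat n a i * y)"
      unfolding r_def by (rule mult_smult_assoc_mat[OF car y])
    also have "\<dots> = elementary_mat n a a"
    proof (rule eq_matI)
      fix k j assume "k < dim_row (elementary_mat n a a :: 'k mat)"
        "j < dim_col (elementary_mat n a a :: 'k mat)"
      hence kj: "k < n" "j < n" by (auto simp: elementary_mat_def)
      have c: "elementary_mat n a i * y \<in> carrier_mat n n" by (rule mult_carrier_mat[OF car y])
      have "(elementary_mat n a i * y) $$ (k, j) = (if k = a then y $$ (i, j) else 0)"
        by (rule index_mult_elementary_mat(2)[OF y a i(1) kj])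
      moreover have "y $$ (i, j) = (if j = a then x $$ (i, a) else 0)"
        unfolding y_def by (rule index_mult_elementary_mat(1)[OF x a a i(1) kj(2)])
      ultimately show "(inverse (x $$ (i, a)) \<cdot>\<^sub>m (elementary_mat n a i * y)) $$ (k, j)
          = elementary_mat n a a $$ (k, j)"
        using kj i c by (auto simp: elementary_mat_def)
    qed (use y in \<open>auto simp: elementary_mat_def\<close>)
    finally show ?thesis
      unfolding y_def by (rule bexI) (simp only: r_def smult_carrier_mat car)
  qed
  show ?thesis
    unfolding primitive_idempotent_system_def module_mat_simps
    using nz idem faithful minimal car by (auto simp: inj)
qed

section \<open>Powers of the field\<close>

lemma power_alg_simps:
  "carrier (power_alg ty n) = {..<n} \<rightarrow>\<^sub>E UNIV"
  "f \<otimes>\<^bsub>power_alg ty n\<^esub> g = (\<lambda>i \<in> {..<n}. f i * g i)"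
  "\<one>\<^bsub>power_alg ty n\<^esub> = (\<lambda>i \<in> {..<n}. 1)"
  "\<zero>\<^bsub>power_alg ty n\<^esub> = (\<lambda>i \<in> {..<n}. 0)"
  "f \<oplus>\<^bsub>power_alg ty n\<^esub> g = (\<lambda>i \<in> {..<n}. f i + g i)"
  "c \<odot>\<^bsub>power_alg ty n\<^esub> f = (\<lambda>i \<in> {..<n}. c * f i)"
  by (simp_all add: power_alg_def)

lemma ring_power_alg: "ring (power_alg TYPE('k::field) n)"
proof (rule ringI)
  show "abelian_group (power_alg TYPE('k) n)"
  proof (rule abelian_groupI)
    fix x assume x: "x \<in> carrier (power_alg TYPE('k) n)"
    show "\<exists>y\<in>carrier (power_alg TYPE('k) n). y \<oplus>\<^bsub>power_alg TYPE('k) n\<^esub> x = \<zero>\<^bsub>power_alg TYPE('k) n\<^esub>"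
      by (intro bexI[of _ "\<lambda>i\<in>{..<n}. - x i"]) (simp_all add: power_alg_simps cong: restrict_cong)
  next
    fix x assume "x \<in> carrier (power_alg TYPE('k) n)"
    thus "\<zero>\<^bsub>power_alg TYPE('k) n\<^esub> \<oplus>\<^bsub>power_alg TYPE('k) n\<^esub> x = x"
      by (simp add: power_alg_simps PiE_def extensional_restrict cong: restrict_cong)
  qed (simp_all add: power_alg_simps algebra_simps cong: restrict_cong)
  show "Group.monoid (power_alg TYPE('k) n)"
    by (rule monoidI)
      (simp_all add: power_alg_simps algebra_simps PiE_def extensional_restrict cong: restrict_cong)
qed (simp_all add: power_alg_simps algebra_simps cong: restrict_cong)

lemma primitive_idempotent_system_power_alg:
  "primitive_idempotent_system ((\<lambda>a. \<lambda>i\<in>{..<n}. if i = a then 1 else 0) ` {..<n})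
     (power_alg TYPE('k::field) n)"
proof -
  define d :: "nat \<Rightarrow> nat \<Rightarrow> 'k" where "d a = (\<lambda>i\<in>{..<n}. if i = a then 1 else 0)" for a
  have inj: "d a = d b \<longleftrightarrow> a = b" if "a < n" "b < n" for a b
    using that by (auto simp: d_def fun_eq_iff split: if_splits)
  have "primitive_idempotent_system (d ` {..<n}) (power_alg TYPE('k) n)"
    unfolding primitive_idempotent_system_def ball_simps
  proof (intro conjI ballI impI)
    show "d ` {..<n} \<subseteq> carrier (power_alg TYPE('k) n) - {\<zero>\<^bsub>power_alg TYPE('k) n\<^esub>}"
      by (auto simp: power_alg_def d_def fun_eq_iff split: if_splits)
  next
    fix a b assume "a \<in> {..<n}" "b \<in> {..<n}"
    thus "d a \<otimes>\<^bsub>power_alg TYPE('k) n\<^esub> d b = (if d a = d b then d a else \<zero>\<^bsub>power_alg TYPE('k) n\<^esub>)"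
      using inj[of a b] by (auto simp: power_alg_def d_def fun_eq_iff)
  next
    fix x assume x: "x \<in> carrier (power_alg TYPE('k) n)"
      and 0: "\<forall>a\<in>{..<n}. x \<otimes>\<^bsub>power_alg TYPE('k) n\<^esub> d a = \<zero>\<^bsub>power_alg TYPE('k) n\<^esub>"
    have "x a = 0" if "a < n" for a
    proof -
      have "(x \<otimes>\<^bsub>power_alg TYPE('k) n\<^esub> d a) a = 0"
        using 0 that by (auto simp: power_alg_def)
      thus ?thesis using that by (auto simp: power_alg_def d_def)
    qed
    thus "x = \<zero>\<^bsub>power_alg TYPE('k) n\<^esub>"
      using x by (auto simp: power_alg_def fun_eq_iff PiE_def extensional_def)
  next
    fix a x assume a: "a \<in> {..<n}" and x: "x \<in> carrier (power_alg TYPE('k) n)"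
      and n0: "x \<otimes>\<^bsub>power_alg TYPE('k) n\<^esub> d a \<noteq> \<zero>\<^bsub>power_alg TYPE('k) n\<^esub>"
    have "x a \<noteq> 0" using n0 a by (auto simp: power_alg_def d_def fun_eq_iff split: if_splits)
    thus "\<exists>r\<in>carrier (power_alg TYPE('k) n).
        r \<otimes>\<^bsub>power_alg TYPE('k) n\<^esub> (x \<otimes>\<^bsub>power_alg TYPE('k) n\<^esub> d a) = d a"
      using a by (intro bexI[of _ "\<lambda>i\<in>{..<n}. inverse (x a)"])
        (auto simp: power_alg_def d_def fun_eq_iff)
  qed auto
  thus ?thesis by (simp add: d_def[abs_def])
qed

text \<open>A nonzero \<open>f\<close> with \<open>f R f = 0\<close> would generate a nilpotent left ideal.\<close>

lemma semisimple_ring_no_nilpotent: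
  assumes R: "semisimple_ring R" and f: "f \<in> carrier R"
    and nil: "\<And>r. r \<in> carrier R \<Longrightarrow> f \<otimes>\<^bsub>R\<^esub> r \<otimes>\<^bsub>R\<^esub> f = \<zero>\<^bsub>R\<^esub>"
  shows "f = \<zero>\<^bsub>R\<^esub>"
proof -
  have ring: "ring R" using R unfolding semisimple_ring_def by (elim conjE)
  interpret ring R by (rule ring)
  from R obtain n :: nat and I where simple: "\<forall>i<n. simple_left_ideal (I i) R"
    and dec: "\<forall>x\<in>carrier R.
        \<exists>!f. f \<in> (\<Pi>\<^sub>E i \<in> {..<n}. I i) \<and> x = (\<Oplus>\<^bsub>R\<^esub>i \<in> {..<n}. f i)"
    unfolding semisimple_ring_def by (elim conjE exE)
  note simple = simple[rule_format]
  from bspec[OF dec one_closed] obtain e where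
    e: "e \<in> (\<Pi>\<^sub>E i \<in> {..<n}. I i)" "\<one>\<^bsub>R\<^esub> = (\<Oplus>\<^bsub>R\<^esub>i \<in> {..<n}. e i)"
    by (elim ex1E conjE)
  have li: "left_ideal (I i) R" if "i < n" for i
    using simple[OF that] by (simp add: simple_left_ideal_def)
  have IR: "I i \<subseteq> carrier R" if "i < n" for i
    using li[OF that] additive_subgroup.a_subset by (auto simp: left_ideal_def)
  have eI: "e i \<in> I i" "e i \<in> carrier R" if "i < n" for i using e(1) IR that by auto
  \<comment> \<open>Otherwise \<open>f e\<close> generates the simple ideal containing it, so the
    component \<open>e\<close> of 1 equals \<open>r f e\<close> for some \<open>r\<close>, and then
    \<open>f e = f r f e = 0\<close>. Since the components sum to 1, all \<open>f e = 0\<close>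
    gives \<open>f = 0\<close>.\<close>
  have "f \<otimes>\<^bsub>R\<^esub> e i = \<zero>\<^bsub>R\<^esub>" if i: "i < n" for i
  proof (rule ccontr)
    assume n0: "f \<otimes>\<^bsub>R\<^esub> e i \<noteq> \<zero>\<^bsub>R\<^esub>"
    define J where "J = (\<lambda>r. r \<otimes>\<^bsub>R\<^esub> (f \<otimes>\<^bsub>R\<^esub> e i)) ` carrier R"
    have fe: "f \<otimes>\<^bsub>R\<^esub> e i \<in> carrier R" "f \<otimes>\<^bsub>R\<^esub> e i \<in> I i"
      using f eI[OF i] li[OF i] by (auto simp: left_ideal_def)
    have "subgroup J (add_monoid R)"
    proof (rule add.subgroupI)
      fix a assume "a \<in> J"
      then obtain x where x: "x \<in> carrier R" "a = x \<otimes>\<^bsub>R\<^esub> (f \<otimes>\<^bsub>R\<^esub> e i)" by (auto simp: J_def)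
      hence "\<ominus>\<^bsub>R\<^esub> a = (\<ominus>\<^bsub>R\<^esub> x) \<otimes>\<^bsub>R\<^esub> (f \<otimes>\<^bsub>R\<^esub> e i)" using fe by (simp only: l_minus)
      thus "\<ominus>\<^bsub>R\<^esub> a \<in> J" unfolding J_def using x by (intro image_eqI[of _ _ "\<ominus>\<^bsub>R\<^esub> x"]) auto
    next
      fix a a' assume "a \<in> J" "a' \<in> J"
      then obtain x x' where x: "x \<in> carrier R" "a = x \<otimes>\<^bsub>R\<^esub> (f \<otimes>\<^bsub>R\<^esub> e i)"
        "x' \<in> carrier R" "a' = x' \<otimes>\<^bsub>R\<^esub> (f \<otimes>\<^bsub>R\<^esub> e i)"
        by (auto simp: J_def)
      hence "a \<oplus>\<^bsub>R\<^esub> a' = (x \<oplus>\<^bsub>R\<^esub> x') \<otimes>\<^bsub>R\<^esub> (f \<otimes>\<^bsub>R\<^esub> e i)" using fe by (simp only: l_distr)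
      thus "a \<oplus>\<^bsub>R\<^esub> a' \<in> J" unfolding J_def using x by (intro image_eqI[of _ _ "x \<oplus>\<^bsub>R\<^esub> x'"]) auto
    qed (use fe in \<open>auto simp: J_def\<close>)
    moreover have "r \<otimes>\<^bsub>R\<^esub> x \<in> J" if r: "r \<in> carrier R" and x: "x \<in> J" for r x
    proof -
      obtain y where y: "y \<in> carrier R" "x = y \<otimes>\<^bsub>R\<^esub> (f \<otimes>\<^bsub>R\<^esub> e i)" using x by (auto simp: J_def)
      hence "r \<otimes>\<^bsub>R\<^esub> x = (r \<otimes>\<^bsub>R\<^esub> y) \<otimes>\<^bsub>R\<^esub> (f \<otimes>\<^bsub>R\<^esub> e i)" using r fe by (simp only: m_assoc)
      thus ?thesis unfolding J_def using r y by (intro image_eqI[of _ _ "r \<otimes>\<^bsub>R\<^esub> y"]) auto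
    qed
    ultimately have "left_ideal J R" by (auto simp: left_ideal_def additive_subgroup_def)
    moreover have "J \<subseteq> I i" using li[OF i] fe by (auto simp: J_def left_ideal_def)
    moreover have "f \<otimes>\<^bsub>R\<^esub> e i \<in> J"
      unfolding J_def using fe by (intro image_eqI[of _ _ "\<one>\<^bsub>R\<^esub>"]) auto
    ultimately have "J = I i" using simple[OF i] n0 by (auto simp: simple_left_ideal_def)
    hence "e i \<in> J" using eI[OF i] by simp
    then obtain r where r: "r \<in> carrier R" "e i = r \<otimes>\<^bsub>R\<^esub> (f \<otimes>\<^bsub>R\<^esub> e i)" by (auto simp: J_def)
    have "f \<otimes>\<^bsub>R\<^esub> e i = f \<otimes>\<^bsub>R\<^esub> (r \<otimes>\<^bsub>R\<^esub> (f \<otimes>\<^bsub>R\<^esub> e i))" using r(2) by simp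
    also have "\<dots> = f \<otimes>\<^bsub>R\<^esub> r \<otimes>\<^bsub>R\<^esub> f \<otimes>\<^bsub>R\<^esub> e i" using f r(1) eI[OF i] by (simp add: m_assoc)
    also have "\<dots> = \<zero>\<^bsub>R\<^esub>" using nil[OF r(1)] eI[OF i] by simp
    finally show False using n0 by simp
  qed
  hence "(\<Oplus>\<^bsub>R\<^esub>i \<in> {..<n}. f \<otimes>\<^bsub>R\<^esub> e i) = \<zero>\<^bsub>R\<^esub>" by (intro add.finprod_one_eqI) auto
  moreover have "f = f \<otimes>\<^bsub>R\<^esub> (\<Oplus>\<^bsub>R\<^esub>i \<in> {..<n}. e i)" using f by (simp flip: e(2))
  moreover have "\<dots> = (\<Oplus>\<^bsub>R\<^esub>i \<in> {..<n}. f \<otimes>\<^bsub>R\<^esub> e i)"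
    by (rule finsum_rdistr) (use f eI in auto)
  ultimately show ?thesis by simp
qed

text \<open>This is how the associativity of the deformed product is obtained below: it is inherited from
  the matrix algebras.\<close>

lemma ring_iso_pullback:
  assumes S: "ring S" and h: "h \<in> ring_iso R S"
    and mult: "\<And>x y. x \<in> carrier R \<Longrightarrow> y \<in> carrier R \<Longrightarrow> x \<otimes>\<^bsub>R\<^esub> y \<in> carrier R"
    and add: "\<And>x y. x \<in> carrier R \<Longrightarrow> y \<in> carrier R \<Longrightarrow> x \<oplus>\<^bsub>R\<^esub> y \<in> carrier R"
    and one: "\<one>\<^bsub>R\<^esub> \<in> carrier R" and zero: "\<zero>\<^bsub>R\<^esub> \<in> carrier R" "h \<zero>\<^bsub>R\<^esub> = \<zero>\<^bsub>S\<^esub>"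
  shows "ring R" and "inv_into (carrier R) h \<in> ring_iso S R"
proof -
  interpret S: ring S by (rule S)
  have hm: "\<And>x y. x \<in> carrier R \<Longrightarrow> y \<in> carrier R \<Longrightarrow> h (x \<otimes>\<^bsub>R\<^esub> y) = h x \<otimes>\<^bsub>S\<^esub> h y"
    and ha: "\<And>x y. x \<in> carrier R \<Longrightarrow> y \<in> carrier R \<Longrightarrow> h (x \<oplus>\<^bsub>R\<^esub> y) = h x \<oplus>\<^bsub>S\<^esub> h y"
    and h1: "h \<one>\<^bsub>R\<^esub> = \<one>\<^bsub>S\<^esub>" and hc: "\<And>x. x \<in> carrier R \<Longrightarrow> h x \<in> carrier S"
    and bij: "bij_betw h (carrier R) (carrier S)"
    using h by (auto simp: ring_iso_def Ring.ring_hom_def)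
  have inj: "x = y" if "x \<in> carrier R" "y \<in> carrier R" "h x = h y" for x y
    using bij that by (auto simp: bij_betw_def inj_on_def)
  show R: "ring R"
  proof (rule ringI)
    show "abelian_group R"
    proof (rule abelian_groupI)
      fix x assume x: "x \<in> carrier R"
      obtain y where y: "y \<in> carrier R" "h y = \<ominus>\<^bsub>S\<^esub> h x"
        using bij S.a_inv_closed[OF hc[OF x]] by (force simp: bij_betw_def)
      show "\<exists>y\<in>carrier R. y \<oplus>\<^bsub>R\<^esub> x = \<zero>\<^bsub>R\<^esub>"
        using x y zero by (intro bexI[of _ y] inj) (auto simp: ha hc add S.l_neg)
    qed (auto simp: add zero ha hc S.a_ac intro!: inj)
    show "Group.monoid R"
      by (rule monoidI) (auto simp: mult one h1 hm hc S.m_assoc intro!: inj)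
  qed (auto simp: mult add hm ha hc S.l_distr S.r_distr intro!: inj)
  interpret R: ring R by (rule R)
  let ?g = "inv_into (carrier R) h"
  have g: "?g y \<in> carrier R" "h (?g y) = y" if "y \<in> carrier S" for y
    using bij that inv_into_into[of y h "carrier R"] f_inv_into_f[of y h "carrier R"]
    by (auto simp: bij_betw_def)
  show "?g \<in> ring_iso S R"
    using bij_betw_inv_into[OF bij]
    by (auto simp: ring_iso_def Ring.ring_hom_def g mult add one hm ha h1 intro!: inj)
qed


section \<open>Linear systems and roots of unity\<close>

text \<open>A square matrix with trivial kernel is invertible. Enumerations of \<open>S\<close> and
  \<open>T\<close> only serve to reach matrices and determinants; in the application the unknowns
  are basis elements and the equations are matrix entries.\<close>

lemma square_system_surjective:
  fixes M :: "'s \<Rightarrow> 't \<Rightarrow> 'k::field"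
  assumes fin: "finite S" "finite T" and card: "card S = card T"
    and inj: "\<And>c. (\<And>t. t \<in> T \<Longrightarrow> (\<Sum>s\<in>S. c s * M s t) = 0) \<Longrightarrow> \<forall>s\<in>S. c s = 0"
  shows "\<exists>c. \<forall>t\<in>T. (\<Sum>s\<in>S. c s * M s t) = d t"
proof -
  define N where "N = card S"
  obtain u where u: "bij_betw u {0..<N} S"
    using ex_bij_betw_nat_finite[OF fin(1)] by (auto simp: N_def)
  obtain v where v: "bij_betw v {0..<N} T"
    using ex_bij_betw_nat_finite[OF fin(2)] by (auto simp: N_def card)
  define u' where "u' = inv_into {0..<N} u"
  have u': "u' (u i) = i" if "i < N" for i
    using u that by (auto simp: u'_def bij_betw_def)
  \<comment> \<open>Rows are the equations and columns the unknowns, the transpose of the order of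
    arguments in \<open>M\<close>.\<close>
  define X where "X = mat N N (\<lambda>(t, s). M (u s) (v t))"
  have X: "X \<in> carrier_mat N N" by (simp add: X_def)
  have Xw: "(X *\<^sub>v w) $ t = (\<Sum>s\<in>S. w $ u' s * M s (v t))" if "w \<in> carrier_vec N" "t < N" for w t
  proof -
    have "(X *\<^sub>v w) $ t = (\<Sum>s\<in>{0..<N}. M (u s) (v t) * w $ s)"
      using that by (simp add: X_def scalar_prod_def)
    also have "\<dots> = (\<Sum>s\<in>{0..<N}. w $ u' (u s) * M (u s) (v t))"
      by (intro sum.cong) (auto simp: u')
    also have "\<dots> = (\<Sum>s\<in>S. w $ u' s * M s (v t))"
      by (rule sum.reindex_bij_betw[OF u])
    finally show ?thesis .
  qed
  have "det X \<noteq> 0"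
  proof
    assume "det X = 0"
    then obtain w where w: "w \<in> carrier_vec N" "w \<noteq> 0\<^sub>v N" "X *\<^sub>v w = 0\<^sub>v N"
      using Determinant.det_0_iff_vec_prod_zero_field[OF X] by blast
    have "\<forall>s\<in>S. w $ u' s = 0"
    proof (rule inj)
      fix t assume "t \<in> T"
      then obtain i where i: "i < N" "t = v i" using v by (auto simp: bij_betw_def)
      show "(\<Sum>s\<in>S. w $ u' s * M s t) = 0" using Xw[OF w(1) i(1)] w(3) i by simp
    qed
    hence "w $ i = 0" if "i < N" for i using that u u'[of i] by (force simp: bij_betw_def)
    hence "w = 0\<^sub>v N" using w(1) by (intro eq_vecI) auto
    with w(2) show False by simp
  qed
  then obtain Y where Y: "Y \<in> carrier_mat N N" "X * Y = 1\<^sub>m N"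
    using det_non_zero_imp_unit[OF X, of "()"] by (auto simp: Units_def ring_mat_simps)
  define e where "e = vec N (\<lambda>i. d (v i))"
  define w where "w = Y *\<^sub>v e"
  have e: "e \<in> carrier_vec N" by (simp add: e_def)
  have w: "w \<in> carrier_vec N" using Y by (simp add: w_def e_def)
  have "X *\<^sub>v w = e"
    using Y e X by (simp add: w_def assoc_mult_mat_vec[symmetric, of X N N Y N])
  hence "\<forall>t\<in>T. (\<Sum>s\<in>S. w $ u' s * M s t) = d t"
    using Xw[OF w] v by (auto simp: e_def bij_betw_def)
  thus ?thesis by (rule exI[of _ "\<lambda>s. w $ u' s"])
qed

text \<open>The relations are combined with the coefficients of the Lagrange polynomial that
  vanishes at every node except \<open>v i\<close>. Its degree is \<open>card I - 1\<close>, so the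
  given powers are enough.\<close>

lemma vandermonde_independent:
  fixes v :: "'i \<Rightarrow> 'k::field"
  assumes fin: "finite I" and inj: "inj_on v I"
    and 0: "\<And>t. t < card I \<Longrightarrow> (\<Sum>i\<in>I. c i * v i ^ t) = 0"
    and i: "i \<in> I"
  shows "c i = 0"
proof -
  define p where "p = (\<Prod>j\<in>I - {i}. [:- v j, 1:])"
  have pv: "poly p (v j) = (\<Prod>k\<in>I - {i}. v j - v k)" for j
    by (simp add: p_def poly_prod)
  have "degree p = (\<Sum>j\<in>I - {i}. degree [:- v j, 1:])"
    unfolding p_def by (rule degree_prod_eq_sum_degree) auto
  hence "degree p = card I - 1" using fin i by simp
  moreover have "card I > 0" using fin i by (auto simp: card_gt_0_iff)
  ultimately have deg: "degree p < card I" by simp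
  have "(\<Sum>j\<in>I. c j * poly p (v j)) = (\<Sum>t\<le>degree p. coeff p t * (\<Sum>j\<in>I. c j * v j ^ t))"
    by (simp add: poly_altdef sum_distrib_left mult_ac sum.swap[of _ "{..degree p}"])
  also have "\<dots> = 0" using 0 deg by simp
  also have "(\<Sum>j\<in>I. c j * poly p (v j)) = (\<Sum>j\<in>I. if j = i then c i * poly p (v i) else 0)"
    using fin by (intro sum.cong) (auto simp: pv)
  finally have "c i * poly p (v i) = 0" using fin i by simp
  moreover have "poly p (v i) \<noteq> 0" using fin inj i by (auto simp: pv inj_on_def)
  ultimately show ?thesis by simp
qed

lemma primitive_root_of_unity_inj:
  assumes "primitive_root_of_unity n z"
  shows "inj_on (\<lambda>i. z ^ i) {..<n}"
proof -
  have z: "z ^ n = 1" "z \<noteq> 0" "\<And>m. 0 < m \<Longrightarrow> m < n \<Longrightarrow> z ^ m \<noteq> 1"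
    using assms by (auto simp: primitive_root_of_unity_def power_0_left)
  have "z ^ i \<noteq> z ^ j" if "i < j" "j < n" for i j
  proof
    assume "z ^ i = z ^ j"
    also have "\<dots> = z ^ i * z ^ (j - i)" using that by (simp flip: power_add)
    finally have "z ^ (j - i) = 1" using z(2) by simp
    with z(3)[of "j - i"] that show False by (metis diff_le_self le_less_trans zero_less_diff)
  qed
  thus ?thesis by (intro linorder_inj_onI) auto
qed

lemma primitive_root_of_unity_cong:
  assumes "primitive_root_of_unity n z" "[i = j] (mod n)"
  shows "z ^ i = z ^ j"
proof -
  have "z ^ i = z ^ (i mod n)" for i
  proof -
    have "z ^ i = (z ^ n) ^ (i div n) * z ^ (i mod n)" by (simp flip: power_mult power_add)
    thus ?thesis using assms(1) by (simp add: primitive_root_of_unity_def)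
  qed
  from this[of i] this[of j] show ?thesis using assms(2) by (simp add: cong_def)
qed

text \<open>The character is \<open>w\<close> raised to the discrete logarithm to a primitive root
  modulo \<open>q\<close>. Injectivity is required so that the values can serve as Vandermonde
  nodes: the powers of this one character are all linear characters of the unit group modulo
  \<open>q\<close>.\<close>

lemma faithful_multiplicative_character:
  fixes w :: "'k::field"
  assumes q: "prime q" and w: "primitive_root_of_unity (q - 1) w"
  obtains \<chi> :: "nat \<Rightarrow> 'k" where "inj_on \<chi> {1..<q}"
    and "\<And>a b. a \<in> {1..<q} \<Longrightarrow> b \<in> {1..<q} \<Longrightarrow> \<chi> (a * b mod q) = \<chi> a * \<chi> b"
    and "\<chi> 1 = 1"
proof -
  have q1: "q > 1" by (rule prime_gt_1_nat[OF q])
  obtain g where g: "residue_primroot q g"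
    using prime_primitive_root_exists[of q] q q1 by auto
  have bij: "bij_betw (\<lambda>i. g ^ i mod q) {..<q - 1} {1..<q}"
    using residue_primroot_is_generator[OF q1 g] q
    by (simp add: totient_prime totatives_prime atLeastLessThan_def greaterThanLessThan_def
        lessThan_def atLeast_def greaterThan_def Suc_le_eq)
  define ind where "ind = inv_into {..<q - 1} (\<lambda>i. g ^ i mod q)"
  have l: "ind a < q - 1" "g ^ ind a mod q = a" if "a \<in> {1..<q}" for a
    using bij that inv_into_into[of a "\<lambda>i. g ^ i mod q" "{..<q-1}"]
      f_inv_into_f[of a "\<lambda>i. g ^ i mod q" "{..<q-1}"]
    by (auto simp: bij_betw_def ind_def)
  \<comment> \<open>Any exponent of the primitive root may replace the chosen logarithm, because
    \<open>g\<close> has order \<open>q - 1\<close> modulo \<open>q\<close> and \<open>w\<close> has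
    the same order.\<close>
  have l': "w ^ ind (g ^ i mod q) = w ^ i" for i
  proof (rule primitive_root_of_unity_cong[OF w])
    have cop: "coprime q g" using g by (simp add: residue_primroot_def)
    hence "\<not> q dvd g ^ i" using q q1
      by (metis coprime_absorb_left not_is_unit_0 coprime_power_right_iff not_prime_unit)
    hence mem: "g ^ i mod q \<in> {1..<q}" using q1 by (auto simp: Suc_le_eq mod_greater_zero_iff_not_dvd)
    have "[g ^ ind (g ^ i mod q) = g ^ i] (mod q)"
      using l(2)[OF mem] by (simp add: cong_def)
    hence "[ind (g ^ i mod q) = i] (mod ord q g)"
      using order_divides_expdiff[OF cop] by simp
    thus "[ind (g ^ i mod q) = i] (mod q - 1)"
      using g q by (simp add: residue_primroot_def totient_prime)
  qed
  show thesis
  proof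
    show "inj_on (\<lambda>a. w ^ ind a) {1..<q}"
    proof (rule inj_onI)
      fix a b assume ab: "a \<in> {1..<q}" "b \<in> {1..<q}" "w ^ ind a = w ^ ind b"
      hence "ind a = ind b"
        using primitive_root_of_unity_inj[OF w] l(1) by (auto simp: inj_on_def)
      thus "a = b" by (metis l(2)[OF ab(1)] l(2)[OF ab(2)])
    qed
    fix a b assume ab: "a \<in> {1..<q}" "b \<in> {1..<q}"
    have eq: "a * b mod q = g ^ (ind a + ind b) mod q"
      by (metis l(2)[OF ab(1)] l(2)[OF ab(2)] mod_mult_eq power_add)
    show "w ^ ind (a * b mod q) = w ^ ind a * w ^ ind b"
      unfolding eq l' by (rule power_add)
  next
    show "w ^ ind 1 = 1" using l'[of 0] q1 by simp
  qed
qed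


section \<open>Subcharacters of a group of prime order by exponents\<close>

datatype idx = Rect nat nat | Graph nat nat

text \<open>With \<open>g\<close> a generator of the group of order \<open>q\<close> and \<open>z\<close> a generator of the \<open>q\<close>-torsion
  of \<open>A\<close>, of order \<open>n\<close>, the index \<open>Rect x y\<close> stands for a direct product of two subgroups, where
  \<open>x < n\<close> encodes the whole group with the character \<open>g \<mapsto> z\<^sup>x\<close> and \<open>x = n\<close> the trivial subgroup;
  \<open>Graph a i\<close> stands for the graph generated by \<open>(g\<^sup>a, g)\<close> with the character \<open>(g\<^sup>a, g) \<mapsto> z\<^sup>i\<close>.
  The predicate \<open>mem\<close> describes the subgroup and \<open>expo\<close> the character. The value of \<open>expo\<close>
  need not be treated separately at \<open>x = n\<close>, because \<open>n\<close> divides \<open>n * k\<close>.\<close>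

locale prime_exponents =
  fixes q n :: nat
  assumes q: "prime q" and n_cases: "n = 1 \<or> n = q"
begin

primrec mem :: "idx \<Rightarrow> int \<Rightarrow> int \<Rightarrow> bool" where
  "mem (Rect x y) k l \<longleftrightarrow> (x < n \<or> int q dvd k) \<and> (y < n \<or> int q dvd l)"
| "mem (Graph a i) k l \<longleftrightarrow> int q dvd k - int a * l"

primrec expo :: "idx \<Rightarrow> int \<Rightarrow> int \<Rightarrow> int" where
  "expo (Rect x y) k l = int x * k + int y * l"
| "expo (Graph a i) k l = int i * l"

definition Idx :: "idx set" where
  "Idx = (\<lambda>(x, y). Rect x y) ` ({..n} \<times> {..n}) \<union> (\<lambda>(a, i). Graph a i) ` ({1..<q} \<times> {..<n})"

text \<open>\<open>a ^ (q - 2)\<close> is the inverse of \<open>a\<close> modulo \<open>q\<close>, by Fermat.\<close>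

definition act :: "nat \<Rightarrow> nat \<Rightarrow> nat \<Rightarrow> nat" where
  "act a i y = (if y = n then n else ((i + y) * a ^ (q - 2)) mod n)"

text \<open>The composite of subcharacters, found by eliminating the middle coordinate
  \<open>l\<close>. A graph on the right has \<open>l = a * m\<close>, so the exponent
  \<open>y\<close> turns into \<open>y * a + i\<close>; a graph on the left has
  \<open>k = a * l\<close>, so \<open>i + y\<close> is divided by \<open>a\<close>. Between two
  rectangles the inner indices disappear and enter the product only through \<open>matching\<close>
  and \<open>overlap\<close>.\<close>

definition mul :: "idx \<Rightarrow> idx \<Rightarrow> idx" where
  "mul s t = (case s of
     Rect x y \<Rightarrow> (case t of
         Rect z w \<Rightarrow> Rect x w
       | Graph a i \<Rightarrow> Rect x (if y = n then n else (y * a + i) mod n))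
   | Graph a i \<Rightarrow> (case t of
         Rect y w \<Rightarrow> Rect (act a i y) w
       | Graph b j \<Rightarrow> Graph (a * b mod q) ((i * b + j) mod n)))"

text \<open>The relation \<open>compatible\<close> in exponents. The group on which the two
  characters must cancel is nontrivial only if both inner factors are the whole group.\<close>

definition matching :: "idx \<Rightarrow> idx \<Rightarrow> bool" where
  "matching s t = (case s of Rect x y \<Rightarrow> (case t of Rect z w \<Rightarrow> y = n \<or> z = n \<or> n dvd y + z | Graph a i \<Rightarrow> True)
     | Graph a i \<Rightarrow> True)"

text \<open>The order of the intersection of \<open>k2\<close> and \<open>k1\<close>, that is, the
  argument of \<open>ell\<close> in the deformed product.\<close>

definition overlap :: "idx \<Rightarrow> idx \<Rightarrow> nat" where
  "overlap s t = (case s of Rect x y \<Rightarrow> (case t of Rect z w \<Rightarrow> if y < n \<and> z < n then q else 1 | Graph a i \<Rightarrow> 1)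
     | Graph a i \<Rightarrow> 1)"

lemma mul_simps [simp]:
  "mul (Rect x y) (Rect z w) = Rect x w"
  "mul (Graph a i) (Rect y w) = Rect (act a i y) w"
  "mul (Rect x y) (Graph a i) = Rect x (if y = n then n else (y * a + i) mod n)"
  "mul (Graph a i) (Graph b j) = Graph (a * b mod q) ((i * b + j) mod n)"
  by (simp_all add: mul_def)

lemma matching_simps [simp]:
  "matching (Rect x y) (Rect z w) \<longleftrightarrow> y = n \<or> z = n \<or> n dvd y + z"
  "matching (Graph a i) t" "matching s (Graph a i)"
  by (simp_all add: matching_def split: idx.split)

lemma overlap_simps [simp]:
  "overlap (Rect x y) (Rect z w) = (if y < n \<and> z < n then q else 1)"
  "overlap (Graph a i) t = 1" "overlap s (Graph a i) = 1"
  by (simp_all add: overlap_def split: idx.split)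

lemma q_gt_1: "q > 1"
  by (rule prime_gt_1_nat[OF q])

lemma n_pos: "n > 0"
  using n_cases q_gt_1 by auto

lemma n_dvd_q: "n dvd q"
  using n_cases by auto

lemma n_dvd: "int q dvd k \<Longrightarrow> int n dvd k"
  using n_dvd_q by (meson dvd_trans of_nat_dvd_iff)

text \<open>The common form of the divisibility arguments below: instantiating \<open>u\<close> and
  \<open>v\<close> names the linear combination and leaves a ring identity to the
  simplifier.\<close>

lemma dvd_lincomb:
  fixes d u v X Y Z :: int
  assumes "d dvd X" "d dvd Y" "Z = u * X + v * Y"
  shows "d dvd Z"
  using assms by simp

lemma IdxE:
  assumes "x \<in> Idx"
  obtains u v where "x = Rect u v" "u \<le> n" "v \<le> n"
  | a i where "x = Graph a i" "a \<in> {1..<q}" "i < n"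
  using assms by (auto simp: Idx_def)

lemma Rect_in_Idx [simp]: "Rect x y \<in> Idx \<longleftrightarrow> x \<le> n \<and> y \<le> n"
  by (auto simp: Idx_def)

lemma Graph_in_Idx [simp]: "Graph a i \<in> Idx \<longleftrightarrow> a \<in> {1..<q} \<and> i < n"
  by (auto simp: Idx_def)

lemma finite_Idx: "finite Idx"
  by (simp add: Idx_def)

lemma sum_Idx:
  "(\<Sum>z\<in>Idx. f z) = (\<Sum>x\<le>n. \<Sum>y\<le>n. f (Rect x y)) + (\<Sum>a\<in>{1..<q}. \<Sum>i<n. f (Graph a i))"
proof -
  have "(\<Sum>z\<in>Idx. f z) = (\<Sum>z\<in>(\<lambda>(x, y). Rect x y) ` ({..n} \<times> {..n}). f z)
      + (\<Sum>z\<in>(\<lambda>(a, i). Graph a i) ` ({1..<q} \<times> {..<n}). f z)"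
    unfolding Idx_def by (rule sum.union_disjoint) auto
  also have "(\<Sum>z\<in>(\<lambda>(x, y). Rect x y) ` ({..n} \<times> {..n}). f z) = (\<Sum>(x, y)\<in>{..n} \<times> {..n}. f (Rect x y))"
    by (subst sum.reindex) (auto simp: inj_on_def case_prod_unfold)
  also have "(\<Sum>z\<in>(\<lambda>(a, i). Graph a i) ` ({1..<q} \<times> {..<n}). f z)
      = (\<Sum>(a, i)\<in>{1..<q} \<times> {..<n}. f (Graph a i))"
    by (subst sum.reindex) (auto simp: inj_on_def case_prod_unfold)
  finally show ?thesis by (simp add: sum.cartesian_product)
qed

lemma card_Idx: "card Idx = (n + 1)\<^sup>2 + (q - 1) * n"
proof -
  have "card Idx = (\<Sum>z\<in>Idx. 1)" by simp
  also have "\<dots> = (n + 1)\<^sup>2 + (q - 1) * n" unfolding sum_Idx by (simp add: power2_eq_square)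
  finally show ?thesis .
qed

section \<open>Divisibility modulo \<open>q\<close> and modulo \<open>n\<close>\<close>

lemma dvd_mod_diff: "int n dvd int (x mod n) - int x"
  by (metis dvd_minus_mod minus_diff_eq dvd_minus_iff zmod_int)

lemma not_dvd_unit: "a \<in> {1..<q} \<Longrightarrow> \<not> int q dvd int a"
  by (metis atLeastLessThan_iff int_dvd_int_iff nat_dvd_not_less not_one_le_zero gr0I)

lemma coprime_unit: "a \<in> {1..<q} \<Longrightarrow> coprime (int q) (int a)"
  using not_dvd_unit q by (simp add: prime_imp_coprime)

lemma coprime_n_unit: "a \<in> {1..<q} \<Longrightarrow> coprime (int n) (int a)"
  using coprime_unit n_cases by auto

lemma unit_cancel:
  assumes "a \<in> {1..<q}" "int q dvd int a * k"
  shows "int q dvd k"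
  using assms coprime_unit by (simp add: coprime_dvd_mult_right_iff)

lemma unit_cancel_n:
  assumes "a \<in> {1..<q}" "int n dvd k * int a"
  shows "int n dvd k"
  using assms coprime_n_unit by (simp add: coprime_dvd_mult_left_iff)

lemma eq_if_dvd_diff:
  assumes "r < n" "s < n" "int n dvd int r - int s"
  shows "r = s"
  using assms by (metis int_int_eq mod_eq_dvd_iff of_nat_mod mod_less)

lemma unit_inverse:
  assumes a: "a \<in> {1..<q}"
  shows "int q dvd int a * int (a ^ (q - 2)) - 1"
proof -
  have "\<not> q dvd a" using not_dvd_unit[OF a] by simp
  hence "[a ^ (q - 1) = 1] (mod q)" by (rule fermat_theorem[OF q])
  moreover have "a ^ (q - 1) = a * a ^ (q - 2)"
    using q_gt_1 by (metis Suc_1 Suc_diff_Suc diff_Suc_1' One_nat_def power_Suc)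
  ultimately have "[int (a * a ^ (q - 2)) = int 1] (mod int q)" by (simp only: cong_int_iff)
  thus ?thesis by (simp add: cong_iff_dvd_diff)
qed

lemma act_le: "act a i y \<le> n"
  using n_pos by (auto simp: act_def less_imp_le)

lemma act_n [simp]: "act a i n = n"
  by (simp add: act_def)

lemma act_less_iff: "y \<le> n \<Longrightarrow> act a i y < n \<longleftrightarrow> y < n"
  using n_pos by (auto simp: act_def)

lemma act_dvd:
  assumes a: "a \<in> {1..<q}" and y: "y < n"
  shows "int n dvd int (act a i y) * int a - (int i + int y)"
proof -
  have "int n dvd int (act a i y) - (int i + int y) * int (a ^ (q - 2))"
    using dvd_mod_diff[of "(i + y) * a ^ (q - 2)"] y by (simp add: act_def)
  moreover have "int n dvd int a * int (a ^ (q - 2)) - 1" using unit_inverse[OF a] by (rule n_dvd)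
  ultimately show ?thesis
    by (rule dvd_lincomb[where u = "int a" and v = "int i + int y"]) (simp add: algebra_simps)
qed

text \<open>As \<open>a\<close> is a unit modulo \<open>n\<close>, the congruence of
  \<open>act_dvd\<close> has only one solution among the residues. Values of \<open>act\<close> can
  thus be identified without computing with the power \<open>a ^ (q - 2)\<close>.\<close>

lemma act_eqI:
  assumes a: "a \<in> {1..<q}" and y: "y < n" and r: "r < n"
    and d: "int n dvd int r * int a - (int i + int y)"
  shows "act a i y = r"
proof (rule eq_if_dvd_diff)
  have "int n dvd (int (act a i y) - int r) * int a"
    by (rule dvd_lincomb[OF act_dvd[OF a y] d, where u = 1 and v = "-1"]) (simp add: algebra_simps)
  thus "int n dvd int (act a i y) - int r" by (rule unit_cancel_n[OF a])
qed (use y r act_less_iff in auto)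

lemma mult_unit_closed:
  assumes "a \<in> {1..<q}" "b \<in> {1..<q}"
  shows "a * b mod q \<in> {1..<q}"
proof -
  have "\<not> q dvd a * b" using assms q not_dvd_unit by (simp add: prime_dvd_mult_iff)
  thus ?thesis using q_gt_1 by (auto simp: Suc_le_eq mod_greater_zero_iff_not_dvd)
qed

lemma mul_closed: "x \<in> Idx \<Longrightarrow> y \<in> Idx \<Longrightarrow> mul x y \<in> Idx"
  by (elim IdxE; simp only: mul_simps Rect_in_Idx Graph_in_Idx)
    (use n_pos act_le mult_unit_closed in \<open>auto simp: less_imp_le\<close>)

section \<open>Subgroups and characters as functions of exponents\<close>

lemma expo_add: "expo x (k + k') (l + l') = expo x k l + expo x k' l'"
  by (cases x) (simp_all add: algebra_simps)

lemma mem_add: "mem x k l \<Longrightarrow> mem x k' l' \<Longrightarrow> mem x (k + k') (l + l')"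
proof (cases x)
  case (Graph a i)
  assume "mem x k l" "mem x k' l'"
  hence "int q dvd (k - int a * l) + (k' - int a * l')" using Graph by (intro dvd_add) auto
  thus ?thesis using Graph by (simp add: algebra_simps)
qed auto

lemma mem_uminus: "mem x k l \<Longrightarrow> mem x (- k) (- l)"
proof (cases x)
  case (Graph a i)
  assume "mem x k l"
  hence "int q dvd - (k - int a * l)" using Graph by (subst dvd_minus_iff) auto
  thus ?thesis using Graph by (simp add: algebra_simps)
qed auto

lemma mem_multiples: "int q dvd k \<Longrightarrow> int q dvd l \<Longrightarrow> mem x k l"
  by (cases x) auto

lemma expo_multiples:
  assumes "x \<in> Idx" "int q dvd k" "int q dvd l"
  shows "int n dvd expo x k l"
  using assms by (cases x) (auto intro!: dvd_add dvd_mult n_dvd)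

lemma mem_cong:
  assumes "mem x k l" "int q dvd k' - k" "int q dvd l' - l"
  shows "mem x k' l'"
  using mem_add[OF assms(1) mem_multiples[OF assms(2,3)]] by simp

text \<open>Together with \<open>mem_cong\<close> this lets indices descend from pairs of integers
  to pairs of group elements. It rests on \<open>n\<close> dividing \<open>q\<close>.\<close>

lemma expo_cong:
  assumes "x \<in> Idx" "int q dvd k' - k" "int q dvd l' - l"
  shows "int n dvd expo x k' l' - expo x k l"
  using expo_multiples[OF assms] expo_add[of x k "k' - k" l "l' - l"] by simp

section \<open>Composition of indices\<close>

text \<open>Between two rectangles the middle coordinate is free, and 0 serves. A graph forces it
  modulo \<open>q\<close>, to \<open>a * m\<close> or to \<open>a ^ (q - 2) * k\<close>; as
  \<open>a\<close> is a unit, multiples of \<open>q\<close> correspond to multiples of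
  \<open>q\<close>, so the conditions on the two sides agree.\<close>

lemma mem_mul:
  assumes "x \<in> Idx" "y \<in> Idx"
  shows "mem (mul x y) k m \<longleftrightarrow> (\<exists>l. mem x k l \<and> mem y l m)"
  using assms(1)
proof (cases rule: IdxE)
  case x: (1 u v)
  from assms(2) show ?thesis
  proof (cases rule: IdxE)
    case (1 z w)
    with x show ?thesis by (auto intro!: exI[of _ 0])
  next
    case y: (2 a i)
    have "mem (mul x y) k m \<longleftrightarrow> (u < n \<or> int q dvd k) \<and> (v < n \<or> int q dvd m)"
      using x y n_pos by auto
    also have "\<dots> \<longleftrightarrow> (\<exists>l. mem x k l \<and> mem y l m)"
    proof
      assume *: "(u < n \<or> int q dvd k) \<and> (v < n \<or> int q dvd m)"
      thus "\<exists>l. mem x k l \<and> mem y l m" using x y by (intro exI[of _ "int a * m"]) auto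
    next
      assume "\<exists>l. mem x k l \<and> mem y l m"
      then obtain l where l: "u < n \<or> int q dvd k" "v < n \<or> int q dvd l" "int q dvd l - int a * m"
        using x y by auto
      have "int q dvd m" if "int q dvd l"
      proof (rule unit_cancel[OF y(2)])
        show "int q dvd int a * m"
          by (rule dvd_lincomb[OF that l(3), where u = 1 and v = "-1"]) simp
      qed
      with l show "(u < n \<or> int q dvd k) \<and> (v < n \<or> int q dvd m)" by blast
    qed
    finally show ?thesis .
  qed
next
  case x: (2 a i)
  from assms(2) show ?thesis
  proof (cases rule: IdxE)
    case y: (1 v w)
    have "mem (mul x y) k m \<longleftrightarrow> (v < n \<or> int q dvd k) \<and> (w < n \<or> int q dvd m)"
      using x y act_less_iff[of v] by auto
    also have "\<dots> \<longleftrightarrow> (\<exists>l. mem x k l \<and> mem y l m)"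
    proof
      assume *: "(v < n \<or> int q dvd k) \<and> (w < n \<or> int q dvd m)"
      have "int q dvd k - int a * (int (a ^ (q - 2)) * k)"
        by (rule dvd_lincomb[OF unit_inverse[OF x(2)] dvd_0_right, where u = "- k" and v = 0])
          (simp add: algebra_simps)
      thus "\<exists>l. mem x k l \<and> mem y l m"
        using * x y by (intro exI[of _ "int (a ^ (q - 2)) * k"]) auto
    next
      assume "\<exists>l. mem x k l \<and> mem y l m"
      then obtain l where l: "int q dvd k - int a * l" "v < n \<or> int q dvd l" "w < n \<or> int q dvd m"
        using x y by auto
      have "int q dvd k" if "int q dvd l"
        by (rule dvd_lincomb[OF l(1) that, where u = 1 and v = "int a"]) simp
      with l show "(v < n \<or> int q dvd k) \<and> (w < n \<or> int q dvd m)" by blast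
    qed
    finally show ?thesis .
  next
    case y: (2 b j)
    have ab: "int q dvd int (a * b mod q) - int a * int b"
      by (metis dvd_minus_mod minus_diff_eq dvd_minus_iff zmod_int of_nat_mult)
    have "mem (mul x y) k m \<longleftrightarrow> int q dvd k - int (a * b mod q) * m" using x y by simp
    also have "\<dots> \<longleftrightarrow> (\<exists>l. mem x k l \<and> mem y l m)"
    proof
      assume k: "int q dvd k - int (a * b mod q) * m"
      have "int q dvd k - int a * (int b * m)"
        by (rule dvd_lincomb[OF k ab, where u = 1 and v = m]) (simp add: algebra_simps)
      thus "\<exists>l. mem x k l \<and> mem y l m" using x y by (intro exI[of _ "int b * m"]) auto
    next
      assume "\<exists>l. mem x k l \<and> mem y l m"
      then obtain l where l: "int q dvd k - int a * l" "int q dvd l - int b * m" using x y by auto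
      have "int q dvd k - int a * int b * m"
        by (rule dvd_lincomb[OF l, where u = 1 and v = "int a"]) (simp add: algebra_simps)
      from this ab show "int q dvd k - int (a * b mod q) * m"
        by (rule dvd_lincomb[where u = 1 and v = "- m"]) (simp add: algebra_simps)
    qed
    finally show ?thesis .
  qed
qed

text \<open>The middle coordinate has to drop out modulo \<open>n\<close>. For two rectangles it
  contributes \<open>(v + z) * l\<close>, where either \<open>matching\<close> makes the factor
  \<open>v + z\<close> vanish or a trivial inner factor makes \<open>l\<close> vanish. A graph
  allows it to be eliminated by its defining congruence, which holds modulo \<open>n\<close> as
  well.\<close>

lemma expo_mul:
  assumes "x \<in> Idx" "y \<in> Idx" and matching: "matching x y" and m: "mem x k l" "mem y l m"
  shows "int n dvd expo (mul x y) k m - (expo x k l + expo y l m)"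
  using assms(1)
proof (cases rule: IdxE)
  case x: (1 u v)
  from assms(2) show ?thesis
  proof (cases rule: IdxE)
    case y: (1 z w)
    have "int n dvd (int v + int z) * l"
    proof (cases "v < n \<and> z < n")
      case True
      hence "int n dvd int v + int z"
        using matching x y by (metis matching_simps(1) less_irrefl of_nat_add of_nat_dvd_iff)
      thus ?thesis by simp
    next
      case False
      hence "int q dvd l" using m x y by auto
      thus ?thesis by (simp add: n_dvd)
    qed
    from this dvd_0_right show ?thesis
      by (rule dvd_lincomb[where u = "-1" and v = 0]) (use x y in \<open>simp add: algebra_simps\<close>)
  next
    case y: (2 a i)
    have lm: "int n dvd l - int a * m" using m y n_dvd by auto
    show ?thesis
    proof (cases "v = n")
      case True
      hence "int q dvd l" using m(1) x by auto
      hence "int q dvd int a * m"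
        using m y by (intro dvd_lincomb[of "int q" l "l - int a * m" "int a * m" 1 "-1"]) auto
      hence "int n dvd m" using unit_cancel[OF y(2)] n_dvd by blast
      moreover have "int n dvd l" using \<open>int q dvd l\<close> by (rule n_dvd)
      ultimately show ?thesis
        by (rule dvd_lincomb[where u = "int n - int i" and v = "- int v"])
          (use x y True in \<open>simp add: algebra_simps\<close>)
    next
      case False
      show ?thesis
        by (rule dvd_lincomb[OF dvd_mod_diff[of "v * a + i"] lm, where u = m and v = "- int v"])
          (use x y False in \<open>simp add: algebra_simps\<close>)
    qed
  qed
next
  case x: (2 a i)
  have kl: "int n dvd k - int a * l" using m x n_dvd by auto
  from assms(2) show ?thesis
  proof (cases rule: IdxE)
    case y: (1 v w)
    show ?thesis
    proof (cases "v = n")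
      case True
      hence "int n dvd l" using m(2) y n_dvd by auto
      from this dvd_refl[of "int n"] show ?thesis
        by (rule dvd_lincomb[where u = "- int i" and v = "k - l"])
          (use x y True in \<open>simp add: algebra_simps\<close>)
    next
      case False
      hence v: "v < n" using y by simp
      show ?thesis
        by (rule dvd_lincomb[OF act_dvd[OF x(2) v, of i] kl,
            where u = l and v = "int (act a i v)"])
          (use x y False in \<open>simp add: algebra_simps\<close>)
    qed
  next
    case y: (2 b j)
    have lm: "int n dvd l - int b * m" using m y n_dvd by auto
    show ?thesis
      by (rule dvd_lincomb[OF dvd_mod_diff[of "i * b + j"] lm, where u = m and v = "- int i"])
        (use x y in \<open>simp add: algebra_simps\<close>)
  qed
qed

text \<open>If one side is a graph, only multiples of \<open>q\<close> occur as \<open>l\<close>,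
  and the condition is empty. For two full inner factors every \<open>l\<close> occurs, and
  \<open>l = 1\<close> already tests the sum of the exponents.\<close>

lemma matching_iff:
  assumes "x \<in> Idx" "y \<in> Idx"
  shows "matching x y \<longleftrightarrow> (\<forall>l. mem x 0 l \<longrightarrow> mem y l 0 \<longrightarrow> int n dvd expo x 0 l + expo y l 0)"
  using assms(1)
proof (cases rule: IdxE)
  case x: (1 u v)
  from assms(2) show ?thesis
  proof (cases rule: IdxE)
    case y: (1 z w)
    show ?thesis
    proof (cases "v < n \<and> z < n")
      case True
      have "n dvd v + z \<longleftrightarrow> int n dvd int v + int z" by (metis of_nat_add of_nat_dvd_iff)
      also have "\<dots> \<longleftrightarrow> (\<forall>l. int n dvd int v * l + int z * l)"
        by (metis dvd_mult2 int_distrib(1) mult.right_neutral)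
      finally show ?thesis using True x y by auto
    next
      case False
      hence "v = n \<or> z = n" using x y by auto
      moreover from this have "int n dvd l" if "mem x 0 l" "mem y l 0" for l
        using that x y n_dvd by auto
      ultimately show ?thesis using x y by auto
    qed
  next
    case y: (2 a i)
    have "int n dvd expo x 0 l + expo y l 0" if "mem y l 0" for l
      using n_dvd[of l] that x y by simp
    thus ?thesis using y by simp
  qed
next
  case x: (2 a i)
  have "int n dvd expo x 0 l + expo y l 0" if "mem x 0 l" for l
  proof -
    have "int q dvd int a * l" using that x by simp
    hence "int n dvd l" by (rule n_dvd[OF unit_cancel[OF x(2)]])
    thus ?thesis using x(1) by (cases y) simp_all
  qed
  thus ?thesis using x(1) by simp
qed

lemma card_overlap:
  assumes "x \<in> Idx" "y \<in> Idx"
  shows "card {l \<in> {0..<int q}. mem x 0 l \<and> mem y l 0} = overlap x y"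
proof -
  have all: "card {l \<in> {0..<int q}. Q l} = q" if "\<And>l. Q l" for Q :: "int \<Rightarrow> bool"
  proof -
    have "{l \<in> {0..<int q}. Q l} = {0..<int q}" using that by auto
    thus ?thesis by simp
  qed
  have one: "card {l \<in> {0..<int q}. Q l} = 1" if "\<And>l. Q l \<longleftrightarrow> int q dvd l" for Q :: "int \<Rightarrow> bool"
  proof -
    have "{l \<in> {0..<int q}. Q l} = {0}"
      using that q_gt_1 by (auto dest: zdvd_imp_le)
    thus ?thesis by simp
  qed
  show ?thesis
    using assms(1)
  proof (cases rule: IdxE)
    case x: (1 u v)
    from assms(2) show ?thesis
    proof (cases rule: IdxE)
      case y: (1 z w)
      show ?thesis
      proof (cases "v < n \<and> z < n")
        case True
        thus ?thesis using x y by (subst all) auto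
      next
        case False
        thus ?thesis using x y by (subst one) auto
      qed
    next
      case y: (2 a i)
      thus ?thesis using x by (subst one) auto
    qed
  next
    case x: (2 a i)
    have *: "mem x 0 l \<longleftrightarrow> int q dvd l" for l
    proof
      assume "mem x 0 l"
      hence "int q dvd int a * l" using x by simp
      thus "int q dvd l" by (rule unit_cancel[OF x(2)])
    qed (use x in simp)
    have "overlap x y = 1" using x by simp
    moreover have "mem y l 0" if "int q dvd l" for l by (rule mem_multiples[OF that]) simp
    ultimately show ?thesis by (subst one) (use * in auto)
  qed
qed

section \<open>The indices enumerate subgroups with characters\<close>

text \<open>Three kinds of points separate the indices. The points \<open>(1, 0)\<close> and
  \<open>(0, 1)\<close> tell which factors of a rectangle are full and lie in no graph, while
  \<open>(a, 1)\<close> detects the slope of a graph. The exponents are read off at the same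
  points.\<close>

lemma Idx_eqI:
  assumes "x \<in> Idx" "y \<in> Idx" and mem: "\<And>k l. mem x k l \<longleftrightarrow> mem y k l"
    and expo: "\<And>k l. mem x k l \<Longrightarrow> int n dvd expo x k l - expo y k l"
  shows "x = y"
  using assms(1)
proof (cases rule: IdxE)
  case x: (1 u v)
  from assms(2) show ?thesis
  proof (cases rule: IdxE)
    case y: (1 z w)
    have 1: "u < n \<longleftrightarrow> z < n" "v < n \<longleftrightarrow> w < n"
      using mem[of 1 0] mem[of 0 1] x y q_gt_1 by auto
    have "u = z"
      using expo[of 1 0] x y 1 eq_if_dvd_diff[of u z] by (cases "u < n") auto
    moreover have "v = w"
      using expo[of 0 1] x y 1 eq_if_dvd_diff[of v w] by (cases "v < n") auto
    ultimately show ?thesis using x y by simp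
  next
    case y: (2 a i)
    have "mem x (int a) 1" using mem[of "int a" 1] y by simp
    moreover have "\<not> mem x 1 0" "\<not> mem x 0 1"
      using mem[of 1 0] mem[of 0 1] y q_gt_1 not_dvd_unit[OF y(2)] by auto
    ultimately show ?thesis using x q_gt_1 by auto
  qed
next
  case x: (2 a i)
  from assms(2) show ?thesis
  proof (cases rule: IdxE)
    case y: (1 z w)
    have "mem y (int a) 1" using mem[of "int a" 1] x by simp
    moreover have "\<not> mem y 1 0" "\<not> mem y 0 1"
      using mem[of 1 0] mem[of 0 1] x q_gt_1 not_dvd_unit[OF x(2)] by auto
    ultimately show ?thesis using y q_gt_1 by auto
  next
    case y: (2 b j)
    have "int q dvd int a - int b" using mem[of "int a" 1] x y by simp
    hence "a = b" using x y
      by (metis atLeastLessThan_iff int_int_eq mod_eq_dvd_iff of_nat_mod mod_less)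
    moreover have "i = j"
      using expo[of "int a" 1] x y by (intro eq_if_dvd_diff) auto
    ultimately show ?thesis using x y by simp
  qed
qed

text \<open>Here \<open>W\<close> is the preimage in \<open>\<int> \<times> \<int>\<close> of a subgroup of \<open>G \<times> G\<close>, and \<open>e\<close> chooses
  representatives of a homomorphism from \<open>W\<close> to \<open>\<int>/n\<int>\<close>.\<close>

lemma subgroup_character_classification:
  fixes W :: "int \<Rightarrow> int \<Rightarrow> bool" and e :: "int \<Rightarrow> int \<Rightarrow> int"
  assumes W_mult: "\<And>k l. int q dvd k \<Longrightarrow> int q dvd l \<Longrightarrow> W k l"
    and W_add: "\<And>k l k' l'. W k l \<Longrightarrow> W k' l' \<Longrightarrow> W (k + k') (l + l')"
    and W_minus: "\<And>k l. W k l \<Longrightarrow> W (- k) (- l)"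
    and e_mult: "\<And>k l. int q dvd k \<Longrightarrow> int q dvd l \<Longrightarrow> int n dvd e k l"
    and e_add: "\<And>k l k' l'. W k l \<Longrightarrow> W k' l' \<Longrightarrow>
        int n dvd e (k + k') (l + l') - (e k l + e k' l')"
  shows "\<exists>x\<in>Idx. \<forall>k l. (W k l \<longleftrightarrow> mem x k l) \<and> (W k l \<longrightarrow> int n dvd e k l - expo x k l)"
proof -
  have e_minus: "int n dvd e (- k) (- l) + e k l" if "W k l" for k l
    by (rule dvd_lincomb[OF e_add[OF that W_minus[OF that]] e_mult[of 0 0],
        where u = "-1" and v = 1]) auto
  have scale_nat: "W (int c * k) (int c * l) \<and> int n dvd e (int c * k) (int c * l) - int c * e k l"
    if "W k l" for c :: nat and k l
  proof (induction c)
    case 0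
    show ?case using W_mult[of 0 0] e_mult[of 0 0] by simp
  next
    case (Suc c)
    hence W: "W (int c * k) (int c * l)" and d: "int n dvd e (int c * k) (int c * l) - int c * e k l"
      by auto
    have eq: "int (Suc c) * k = k + int c * k" "int (Suc c) * l = l + int c * l"
      by (simp_all add: algebra_simps)
    show ?case unfolding eq
    proof (intro conjI W_add that W)
      show "int n dvd e (k + int c * k) (l + int c * l) - int (Suc c) * e k l"
        by (rule dvd_lincomb[OF e_add[OF that W] d, where u = 1 and v = 1])
          (simp add: algebra_simps)
    qed
  qed
  have scale: "W (c * k) (c * l)" "int n dvd e (c * k) (c * l) - c * e k l" if W: "W k l" for c k l
  proof -
    have "W (c * k) (c * l) \<and> int n dvd e (c * k) (c * l) - c * e k l"
    proof (cases c rule: int_cases2)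
      case (nonneg m)
      thus ?thesis using scale_nat[OF W] by simp
    next
      case (nonpos m)
      have W': "W (int m * k) (int m * l)" and d: "int n dvd e (int m * k) (int m * l) - int m * e k l"
        using scale_nat[OF W] by auto
      have "int n dvd e (- (int m * k)) (- (int m * l)) - (- int m) * e k l"
        by (rule dvd_lincomb[OF e_minus[OF W'] d, where u = 1 and v = "-1"]) simp
      thus ?thesis using nonpos W_minus[OF W'] by simp
    qed
    thus "W (c * k) (c * l)" "int n dvd e (c * k) (c * l) - c * e k l" by auto
  qed
  have inv: "\<exists>u. int q dvd u * k - 1" if "\<not> int q dvd k" for k
  proof -
    have "coprime k (int q)" using that q prime_imp_coprime[of "int q" k] by (simp add: coprime_commute)
    then obtain u where "[k * u = 1] (mod int q)" using cong_solve_coprime_int by blast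
    thus ?thesis by (auto simp: cong_iff_dvd_diff mult.commute)
  qed
  \<comment> \<open>The residue in the range below \<open>n\<close> by which the indices encode a
    character of the whole group or of a graph.\<close>
  define r where "r z = nat (z mod int n)" for z
  have r_less: "r z < n" for z using n_pos by (simp add: r_def nat_less_iff)
  have r: "int n dvd z - int (r z)" for z using n_pos by (simp add: r_def)
  have W10: "W 1 0" if "W k 0" "\<not> int q dvd k" for k
  proof -
    obtain u where u: "int q dvd u * k - 1" using inv \<open>\<not> int q dvd k\<close> by blast
    have "int q dvd 1 - u * k" using u by (simp add: dvd_diff_commute)
    from W_add[OF scale(1)[OF that(1), of u] W_mult[OF this, of 0]] show ?thesis by simp
  qed
  have W01: "W 0 1" if "W 0 l" "\<not> int q dvd l" for l
  proof -
    obtain u where u: "int q dvd u * l - 1" using inv \<open>\<not> int q dvd l\<close> by blast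
    have "int q dvd 1 - u * l" using u by (simp add: dvd_diff_commute)
    from W_add[OF scale(1)[OF that(1), of u] W_mult[OF _ this, of 0]] show ?thesis by simp
  qed
  have W_k: "W k 0" and e_k: "int n dvd e k 0 - k * e 1 0" if "W 1 0" for k
    using scale[OF that, of k] by auto
  have W_l: "W 0 l" and e_l: "int n dvd e 0 l - l * e 0 1" if "W 0 1" for l
    using scale[OF that, of l] by auto
  have e_split: "int n dvd e k l - (e k 0 + e 0 l)" if "W k 0" "W 0 l" for k l
    using e_add[OF that] by simp
  \<comment> \<open>A subgroup that contains a coordinate axis is a rectangle; one that contains
    neither axis is a graph or trivial. This is the lemma of Goursat for a group of prime
    order.\<close>
  consider "W 1 0" "W 0 1" | "W 1 0" "\<not> W 0 1" | "\<not> W 1 0" "W 0 1" | "\<not> W 1 0" "\<not> W 0 1"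
    by blast
  thus ?thesis
  proof cases
    case 1
    let ?x = "Rect (r (e 1 0)) (r (e 0 1))"
    have "mem ?x k l" for k l using r_less by simp
    moreover have "W k l" for k l using W_add[OF W_k[OF 1(1), of k] W_l[OF 1(2), of l]] by simp
    moreover have "int n dvd e k l - expo ?x k l" for k l
    proof -
      have "int n dvd e k l - (k * e 1 0 + e 0 l)"
        by (rule dvd_lincomb[OF e_split[OF W_k[OF 1(1), of k] W_l[OF 1(2), of l]] e_k[OF 1(1), of k],
            where u = 1 and v = 1]) simp
      hence "int n dvd e k l - (k * e 1 0 + l * e 0 1)"
        by (rule dvd_lincomb[OF _ e_l[OF 1(2), of l], where u = 1 and v = 1]) simp
      hence "int n dvd e k l - (k * int (r (e 1 0)) + l * e 0 1)"
        by (rule dvd_lincomb[OF _ r[of "e 1 0"], where u = 1 and v = k]) (simp add: algebra_simps)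
      thus ?thesis
        by (rule dvd_lincomb[OF _ r[of "e 0 1"], where u = 1 and v = l]) (simp add: algebra_simps)
    qed
    ultimately show ?thesis using r_less by (intro bexI[of _ ?x]) (auto simp: less_imp_le)
  next
    case 2
    let ?x = "Rect (r (e 1 0)) n"
    have W: "W k l \<longleftrightarrow> int q dvd l" for k l
    proof
      assume "W k l"
      hence "W 0 l" using W_add[OF _ W_k[OF 2(1), of "- k"], of k l] by simp
      thus "int q dvd l" using W01 2 by blast
    next
      assume "int q dvd l"
      thus "W k l" using W_add[OF W_k[OF 2(1), of k] W_mult[of 0 l]] by simp
    qed
    moreover have "int n dvd e k l - expo ?x k l" if l: "int q dvd l" for k l
    proof -
      have "int n dvd e k l - (e k 0 + e 0 l)" by (rule e_split) (use W l in auto)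
      hence "int n dvd e k l - e k 0"
        by (rule dvd_lincomb[OF _ e_mult[of 0 l], where u = 1 and v = 1]) (use l in auto)
      hence "int n dvd e k l - k * e 1 0"
        by (rule dvd_lincomb[OF _ e_k[OF 2(1), of k], where u = 1 and v = 1]) simp
      hence "int n dvd e k l - k * int (r (e 1 0))"
        by (rule dvd_lincomb[OF _ r[of "e 1 0"], where u = 1 and v = k]) (simp add: algebra_simps)
      \<comment> \<open>The trivial factor has index \<open>n\<close>, so its contribution
        \<open>n * l\<close> to \<open>expo\<close> vanishes modulo \<open>n\<close>.\<close>
      thus ?thesis
        by (rule dvd_lincomb[OF _ dvd_refl, where u = 1 and v = "- l"]) (simp add: algebra_simps)
    qed
    ultimately show ?thesis using r_less by (intro bexI[of _ ?x]) (auto simp: less_imp_le)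
  next
    case 3
    let ?x = "Rect n (r (e 0 1))"
    have W: "W k l \<longleftrightarrow> int q dvd k" for k l
    proof
      assume "W k l"
      hence "W k 0" using W_add[OF _ W_l[OF 3(2), of "- l"], of k l] by simp
      thus "int q dvd k" using W10 3 by blast
    next
      assume "int q dvd k"
      thus "W k l" using W_add[OF W_mult[of k 0] W_l[OF 3(2), of l]] by simp
    qed
    moreover have "int n dvd e k l - expo ?x k l" if k: "int q dvd k" for k l
    proof -
      have "int n dvd e k l - (e k 0 + e 0 l)" by (rule e_split) (use W k in auto)
      hence "int n dvd e k l - e 0 l"
        by (rule dvd_lincomb[OF _ e_mult[of k 0], where u = 1 and v = 1]) (use k in auto)
      hence "int n dvd e k l - l * e 0 1"
        by (rule dvd_lincomb[OF _ e_l[OF 3(2), of l], where u = 1 and v = 1]) simp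
      hence "int n dvd e k l - l * int (r (e 0 1))"
        by (rule dvd_lincomb[OF _ r[of "e 0 1"], where u = 1 and v = l]) (simp add: algebra_simps)
      thus ?thesis
        by (rule dvd_lincomb[OF _ dvd_refl, where u = 1 and v = "- k"]) (simp add: algebra_simps)
    qed
    ultimately show ?thesis using r_less by (intro bexI[of _ ?x]) (auto simp: less_imp_le)
  next
    case 4
    show ?thesis
    proof (cases "\<exists>k l. W k l \<and> \<not> int q dvd l")
      case True
      then obtain k l where kl: "W k l" "\<not> int q dvd l" by blast
      obtain u where u: "int q dvd u * l - 1" using inv kl(2) by blast
      \<comment> \<open>The slope: scaling \<open>(k, l)\<close> by the inverse \<open>u\<close> of
        \<open>l\<close> makes the second coordinate 1 modulo \<open>q\<close>. It cannot be 0,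
        since otherwise the second axis would lie in \<open>W\<close>.\<close>
      define a where "a = nat ((u * k) mod int q)"
      have a: "int q dvd int a - u * k"
        using q_gt_1 by (simp add: a_def dvd_diff_commute[of _ "_ mod _"])
      have aq: "a < q" using q_gt_1 by (simp add: a_def nat_less_iff)
      have Wa: "W (int a) 1"
      proof -
        have "int q dvd 1 - u * l" using u by (simp add: dvd_diff_commute)
        from W_add[OF scale(1)[OF kl(1), of u] W_mult[OF a this]] show ?thesis by simp
      qed
      have "a \<noteq> 0" using 4 Wa by (cases a) auto
      let ?x = "Graph a (r (e (int a) 1))"
      have W: "W k l \<longleftrightarrow> int q dvd k - int a * l" for k l
      proof
        assume "W k l"
        from W_add[OF this scale(1)[OF Wa, of "- l"]] have "W (k - int a * l) 0"
          by (simp add: mult.commute)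
        thus "int q dvd k - int a * l" using W10 4 by blast
      next
        assume "int q dvd k - int a * l"
        from W_add[OF W_mult[OF this, of 0] scale(1)[OF Wa, of l]] show "W k l"
          by (simp add: mult.commute)
      qed
      moreover have "int n dvd e k l - expo ?x k l" if d: "int q dvd k - int a * l" for k l
      proof -
        have "int n dvd e k l - (e (k - int a * l) 0 + e (l * int a) (l * 1))"
          using e_add[OF W_mult[OF d, of 0] scale(1)[OF Wa, of l]] by (simp add: mult.commute)
        hence "int n dvd e k l - e (l * int a) (l * 1)"
          by (rule dvd_lincomb[OF _ e_mult[OF d, of 0], where u = 1 and v = 1]) auto
        hence "int n dvd e k l - l * e (int a) 1"
          by (rule dvd_lincomb[OF _ scale(2)[OF Wa, of l], where u = 1 and v = 1]) simp
        thus ?thesis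
          by (rule dvd_lincomb[OF _ r[of "e (int a) 1"], where u = 1 and v = l])
            (simp add: algebra_simps)
      qed
      ultimately show ?thesis using r_less aq \<open>a \<noteq> 0\<close> by (intro bexI[of _ ?x]) auto
    next
      case False
      let ?x = "Rect n n"
      have W: "W k l \<longleftrightarrow> int q dvd k \<and> int q dvd l" for k l
      proof
        assume kl: "W k l"
        hence l: "int q dvd l" using False by blast
        have "W k 0" using W_add[OF kl W_mult[of 0 "- l"]] l by simp
        thus "int q dvd k \<and> int q dvd l" using W10 4 l by blast
      qed (use W_mult in blast)
      moreover have "int n dvd e k l - expo ?x k l" if "int q dvd k" "int q dvd l" for k l
        by (rule dvd_lincomb[OF e_mult[OF that] dvd_refl, where u = 1 and v = "- (k + l)"])
          (simp add: algebra_simps)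
      ultimately show ?thesis by (intro bexI[of _ ?x]) auto
    qed
  qed
qed

end

section \<open>Transfer from exponents to the subcharacters of
  \<open>G \<times>\<times> G\<close>\<close>

locale prime_order_subchars = prime_exponents q n + G: group G + A: comm_group A
  for q n :: nat and G :: "('g, 'n) monoid_scheme" and A :: "('a, 'm) monoid_scheme" +
  fixes g :: 'g and z :: 'a
  assumes g: "g \<in> carrier G" and z: "z \<in> carrier A"
    and g_generates: "u \<in> carrier G \<Longrightarrow> \<exists>k::int. u = g [^]\<^bsub>G\<^esub> k"
    and g_order: "g [^]\<^bsub>G\<^esub> (k::int) = g [^]\<^bsub>G\<^esub> (l::int) \<longleftrightarrow> int q dvd k - l"
    and z_generates: "a \<in> carrier A \<Longrightarrow> a [^]\<^bsub>A\<^esub> q = \<one>\<^bsub>A\<^esub> \<Longrightarrow> \<exists>i::int. a = z [^]\<^bsub>A\<^esub> i"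
    and z_order: "z [^]\<^bsub>A\<^esub> (k::int) = z [^]\<^bsub>A\<^esub> (l::int) \<longleftrightarrow> int n dvd k - l"
begin

abbreviation pw :: "int \<Rightarrow> 'g" where "pw k \<equiv> g [^]\<^bsub>G\<^esub> k"

abbreviation zw :: "int \<Rightarrow> 'a" where "zw k \<equiv> z [^]\<^bsub>A\<^esub> k"

text \<open>A discrete logarithm to the base \<open>g\<close>. The choice of representative is
  harmless: \<open>lg_pw\<close> determines it modulo \<open>q\<close>, and \<open>expo_cong\<close>
  shows that characters see no more.\<close>

definition lg :: "'g \<Rightarrow> int" where
  "lg u = (SOME k. u = pw k)"

definition subgrp :: "idx \<Rightarrow> ('g \<times> 'g) set" where
  "subgrp x = {(pw k, pw l) | k l. mem x k l}"

definition chr :: "idx \<Rightarrow> 'g \<times> 'g \<Rightarrow> 'a" where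
  "chr x = (\<lambda>p \<in> subgrp x. zw (expo x (lg (fst p)) (lg (snd p))))"

definition subchar :: "idx \<Rightarrow> ('g, 'a) subchar" where
  "subchar x = (subgrp x, chr x)"

lemma pw_closed [simp]: "pw k \<in> carrier G"
  using g by simp

lemma zw_closed [simp]: "zw k \<in> carrier A"
  using z by simp

lemma pw_add: "pw k \<otimes>\<^bsub>G\<^esub> pw l = pw (k + l)"
  using g by (simp add: G.int_pow_mult)

lemma zw_add: "zw k \<otimes>\<^bsub>A\<^esub> zw l = zw (k + l)"
  using z by (simp add: A.int_pow_mult)

lemma pw_lg: "u \<in> carrier G \<Longrightarrow> pw (lg u) = u"
  unfolding lg_def using g_generates someI_ex[of "\<lambda>k. u = pw k"] by auto

lemma lg_pw: "int q dvd lg (pw k) - k"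
  using pw_lg[of "pw k"] g_order by simp

lemma mem_subgrp: "(pw k, pw l) \<in> subgrp x \<longleftrightarrow> mem x k l"
proof
  assume "(pw k, pw l) \<in> subgrp x"
  then obtain k' l' where "pw k = pw k'" "pw l = pw l'" "mem x k' l'"
    unfolding subgrp_def by blast
  thus "mem x k l" using mem_cong g_order by blast
qed (auto simp: subgrp_def)

lemma mem_subgrpE:
  assumes "p \<in> subgrp x"
  obtains k l where "p = (pw k, pw l)" "mem x k l"
  using assms unfolding subgrp_def by blast

lemma chr_pw:
  assumes "x \<in> Idx" "mem x k l"
  shows "chr x (pw k, pw l) = zw (expo x k l)"
  using assms expo_cong[OF assms(1) lg_pw[of k] lg_pw[of l]]
  by (simp add: chr_def mem_subgrp z_order)

lemma subgroup_subgrp: "subgroup (subgrp x) (G \<times>\<times> G)"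
proof -
  interpret GG: group "G \<times>\<times> G" by (intro DirProd_group G.group_axioms)
  show ?thesis
  proof (rule GG.subgroupI)
    show "subgrp x \<subseteq> carrier (G \<times>\<times> G)" by (auto elim!: mem_subgrpE)
    have "(pw 0, pw 0) \<in> subgrp x" unfolding mem_subgrp by (rule mem_multiples) auto
    thus "subgrp x \<noteq> {}" by blast
  next
    fix p assume "p \<in> subgrp x"
    then obtain k l where kl: "p = (pw k, pw l)" "mem x k l" by (rule mem_subgrpE)
    have "inv\<^bsub>G \<times>\<times> G\<^esub> p = (pw (- k), pw (- l))"
      unfolding kl(1) using g by (subst inv_DirProd) (auto simp: G.int_pow_neg G.group_axioms)
    thus "inv\<^bsub>G \<times>\<times> G\<^esub> p \<in> subgrp x" using mem_uminus[OF kl(2)] by (simp only: mem_subgrp)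
  next
    fix p p' assume "p \<in> subgrp x" "p' \<in> subgrp x"
    then obtain k l k' l' where kl: "p = (pw k, pw l)" "mem x k l" "p' = (pw k', pw l')" "mem x k' l'"
      by (metis mem_subgrpE)
    have "p \<otimes>\<^bsub>G \<times>\<times> G\<^esub> p' = (pw (k + k'), pw (l + l'))"
      unfolding kl(1,3) by (simp add: pw_add)
    thus "p \<otimes>\<^bsub>G \<times>\<times> G\<^esub> p' \<in> subgrp x"
      using mem_add[OF kl(2,4)] by (simp only: mem_subgrp)
  qed
qed

lemma subchar_in_subchars:
  assumes x: "x \<in> Idx"
  shows "subchar x \<in> subchars A G"
proof -
  have "chr x \<in> hom ((G \<times>\<times> G)\<lparr>carrier := subgrp x\<rparr>) A"
  proof (rule homI)
    fix p assume "p \<in> carrier ((G \<times>\<times> G)\<lparr>carrier := subgrp x\<rparr>)"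
    thus "chr x p \<in> carrier A" by (auto simp: chr_pw[OF x] elim!: mem_subgrpE)
  next
    fix p p'
    assume "p \<in> carrier ((G \<times>\<times> G)\<lparr>carrier := subgrp x\<rparr>)"
      and "p' \<in> carrier ((G \<times>\<times> G)\<lparr>carrier := subgrp x\<rparr>)"
    then obtain k l k' l' where kl: "p = (pw k, pw l)" "mem x k l" "p' = (pw k', pw l')" "mem x k' l'"
      by (auto elim!: mem_subgrpE)
    show "chr x (p \<otimes>\<^bsub>(G \<times>\<times> G)\<lparr>carrier := subgrp x\<rparr>\<^esub> p') = chr x p \<otimes>\<^bsub>A\<^esub> chr x p'"
      unfolding kl(1,3)
      by (simp add: pw_add chr_pw[OF x] mem_add[OF kl(2,4)] kl(2,4) zw_add expo_add)
  qed
  moreover have "chr x \<in> extensional (subgrp x)" by (simp add: chr_def)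
  ultimately show ?thesis
    using subgroup_subgrp by (simp add: subchar_def subchars_def dual_def)
qed

lemma inj_subchar: "inj_on subchar Idx"
proof (rule inj_onI)
  fix x y assume x: "x \<in> Idx" and y: "y \<in> Idx" and eq: "subchar x = subchar y"
  have sg: "subgrp x = subgrp y" and ch: "chr x = chr y" using eq by (auto simp: subchar_def)
  have mem: "mem x k l \<longleftrightarrow> mem y k l" for k l using sg by (metis mem_subgrp)
  show "x = y"
  proof (rule Idx_eqI[OF x y mem])
    fix k l assume m: "mem x k l"
    have "zw (expo x k l) = zw (expo y k l)"
      using chr_pw[OF x m] chr_pw[OF y m[unfolded mem]] ch by simp
    thus "int n dvd expo x k l - expo y k l" by (simp add: z_order)
  qed
qed

text \<open>The subgroup and its character are pulled back along the map sending
  \<open>(k, l)\<close> to \<open>(g^k, g^l)\<close>, which brings them into the form of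
  \<open>subgroup_character_classification\<close>. Character values are powers of \<open>z\<close>
  because \<open>G \<times>\<times> G\<close> has exponent \<open>q\<close>.\<close>

lemma subchars_subset: "subchars A G \<subseteq> subchar ` Idx"
proof
  fix v assume v: "v \<in> subchars A G"
  obtain V \<psi> where v_eq: "v = (V, \<psi>)" by fastforce
  have V: "subgroup V (G \<times>\<times> G)" and hom: "\<psi> \<in> hom ((G \<times>\<times> G)\<lparr>carrier := V\<rparr>) A"
    and ext: "\<psi> \<in> extensional V"
    using v unfolding v_eq by (auto simp: subchars_def dual_def)
  have VG: "V \<subseteq> carrier G \<times> carrier G" using subgroup.subset[OF V] by simp
  define W where "W k l \<longleftrightarrow> (pw k, pw l) \<in> V" for k l
  have W_add: "W (k + k') (l + l')" if "W k l" "W k' l'" for k l k' l'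
    using subgroup.m_closed[OF V that[unfolded W_def]] by (simp add: W_def pw_add)
  have W_minus: "W (- k) (- l)" if "W k l" for k l
    using subgroup.m_inv_closed[OF V that[unfolded W_def]] g
    by (simp add: W_def inv_DirProd G.group_axioms G.int_pow_neg)
  have pw_mult: "pw k = \<one>\<^bsub>G\<^esub>" if "int q dvd k" for k
    using g_order[of k 0] that by simp
  have W_mult: "W k l" if "int q dvd k" "int q dvd l" for k l
    using subgroup.one_closed[OF V] by (simp add: W_def pw_mult that)
  have psi_mult: "\<psi> (pw (k + k'), pw (l + l')) = \<psi> (pw k, pw l) \<otimes>\<^bsub>A\<^esub> \<psi> (pw k', pw l')"
    if "W k l" "W k' l'" for k l k' l'
    using hom_mult[OF hom, of "(pw k, pw l)" "(pw k', pw l')"] that by (simp add: W_def pw_add)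
  have psi_closed: "\<psi> (pw k, pw l) \<in> carrier A" if "W k l" for k l
    using hom_in_carrier[OF hom] that by (simp add: W_def)
  have psi_one: "\<psi> (\<one>\<^bsub>G\<^esub>, \<one>\<^bsub>G\<^esub>) = \<one>\<^bsub>A\<^esub>"
  proof -
    have W: "W 0 0" by (rule W_mult) auto
    have "\<psi> (\<one>\<^bsub>G\<^esub>, \<one>\<^bsub>G\<^esub>) = \<psi> (\<one>\<^bsub>G\<^esub>, \<one>\<^bsub>G\<^esub>) \<otimes>\<^bsub>A\<^esub> \<psi> (\<one>\<^bsub>G\<^esub>, \<one>\<^bsub>G\<^esub>)"
      using psi_mult[OF W W] by simp
    thus ?thesis using psi_closed[OF W] by simp
  qed
  have psi_pow: "W (int c * k) (int c * l) \<and> \<psi> (pw (int c * k), pw (int c * l)) = \<psi> (pw k, pw l) [^]\<^bsub>A\<^esub> c"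
    if "W k l" for c :: nat and k l
  proof (induction c)
    case 0
    show ?case using W_mult[of 0 0] psi_one by simp
  next
    case (Suc c)
    have "int (Suc c) * k = int c * k + k" "int (Suc c) * l = int c * l + l"
      by (simp_all add: algebra_simps)
    thus ?case
      using Suc W_add[OF conjunct1[OF Suc] that] psi_mult[OF conjunct1[OF Suc] that] by simp
  qed
  have ex: "\<exists>i. W k l \<longrightarrow> \<psi> (pw k, pw l) = zw i" for k l
  proof (cases "W k l")
    case True
    have "\<psi> (pw k, pw l) [^]\<^bsub>A\<^esub> q = \<one>\<^bsub>A\<^esub>"
      using psi_pow[OF True, of q] pw_mult[of "int q * k"] pw_mult[of "int q * l"] psi_one by simp
    thus ?thesis using z_generates psi_closed[OF True] by blast
  qed blast
  \<comment> \<open>The exponents are chosen point by point, so \<open>e\<close> is additive only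
    modulo \<open>n\<close>, which is what the classification asks for.\<close>
  obtain e where e: "\<And>k l. W k l \<Longrightarrow> \<psi> (pw k, pw l) = zw (e k l)" using ex by metis
  have "\<exists>x\<in>Idx. \<forall>k l. (W k l \<longleftrightarrow> mem x k l) \<and> (W k l \<longrightarrow> int n dvd e k l - expo x k l)"
  proof (rule subgroup_character_classification)
    fix k l assume kl: "int q dvd k" "int q dvd l"
    show "W k l" by (rule W_mult[OF kl])
    have "zw (e k l) = zw 0" using e[OF W_mult[OF kl]] psi_one by (simp add: pw_mult kl)
    thus "int n dvd e k l" by (simp only: z_order) simp
  next
    fix k l k' l' assume W: "W k l" "W k' l'"
    show "W (k + k') (l + l')" by (rule W_add[OF W])
    have "zw (e (k + k') (l + l')) = zw (e k l + e k' l')"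
      using e[OF W_add[OF W]] psi_mult[OF W] e[OF W(1)] e[OF W(2)] by (simp add: zw_add)
    thus "int n dvd e (k + k') (l + l') - (e k l + e k' l')" by (simp only: z_order)
  qed (rule W_minus)
  then obtain x where x: "x \<in> Idx" and Wx: "\<And>k l. W k l \<longleftrightarrow> mem x k l"
    and ex: "\<And>k l. W k l \<Longrightarrow> int n dvd e k l - expo x k l" by blast
  have VeqU: "V = subgrp x"
  proof (intro equalityI subsetI)
    fix p assume p: "p \<in> V"
    obtain a b where ab: "p = (a, b)" by fastforce
    hence car: "a \<in> carrier G" "b \<in> carrier G" using p VG by auto
    hence "W (lg a) (lg b)" using p ab by (simp add: W_def pw_lg)
    hence "(pw (lg a), pw (lg b)) \<in> subgrp x" by (simp only: mem_subgrp Wx)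
    thus "p \<in> subgrp x" using ab car by (simp add: pw_lg)
  next
    fix p assume "p \<in> subgrp x"
    then obtain k l where "p = (pw k, pw l)" "mem x k l" by (rule mem_subgrpE)
    thus "p \<in> V" using Wx by (simp add: W_def)
  qed
  have "\<psi> = chr x"
  proof (rule extensionalityI[OF ext])
    show "chr x \<in> extensional V" unfolding VeqU by (simp add: chr_def)
    fix p assume "p \<in> V"
    then obtain k l where kl: "p = (pw k, pw l)" "mem x k l" unfolding VeqU by (rule mem_subgrpE)
    thus "\<psi> p = chr x p"
      using e[of k l] ex[of k l] Wx chr_pw[OF x kl(2)] z_order by simp
  qed
  thus "v \<in> subchar ` Idx" using x VeqU v_eq by (auto simp: subchar_def)
qed

lemma subchars_eq: "subchars A G = subchar ` Idx"
  using subchars_subset subchar_in_subchars by blast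

lemma star_subgrp:
  assumes "x \<in> Idx" "y \<in> Idx"
  shows "star G (subgrp x) (subgrp y) = subgrp (mul x y)"
proof (intro equalityI subsetI)
  fix p assume p: "p \<in> star G (subgrp x) (subgrp y)"
  obtain a b where ab: "p = (a, b)" by fastforce
  then obtain c where c: "(a, c) \<in> subgrp x" "(c, b) \<in> subgrp y"
    using p by (auto simp: star_def)
  then obtain k l where kl: "a = pw k" "c = pw l" "mem x k l" by (auto elim: mem_subgrpE)
  obtain l' m where lm: "c = pw l'" "b = pw m" using c(2) by (auto elim: mem_subgrpE)
  have "mem y l m" using c(2) unfolding kl(2) lm(2) mem_subgrp .
  hence "mem (mul x y) k m" using mem_mul[OF assms] kl(3) by blast
  thus "p \<in> subgrp (mul x y)" unfolding ab kl lm(2) mem_subgrp .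
next
  fix p assume "p \<in> subgrp (mul x y)"
  then obtain k m where km: "p = (pw k, pw m)" "mem (mul x y) k m" by (rule mem_subgrpE)
  then obtain l where "mem x k l" "mem y l m" using mem_mul[OF assms] by blast
  thus "p \<in> star G (subgrp x) (subgrp y)"
    unfolding star_def km(1) by (auto simp: mem_subgrp intro!: bexI[of _ "pw l"])
qed

lemma k2_k1_subgrp:
  "k2 G (subgrp x) \<inter> k1 G (subgrp y) = pw ` {l. mem x 0 l \<and> mem y l 0}"
proof (intro equalityI subsetI)
  fix u assume "u \<in> k2 G (subgrp x) \<inter> k1 G (subgrp y)"
  hence u: "u \<in> carrier G" "(pw 0, u) \<in> subgrp x" "(u, pw 0) \<in> subgrp y"
    by (auto simp: k1_def k2_def)
  obtain l where l: "u = pw l" using g_generates[OF u(1)] by blast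
  show "u \<in> pw ` {l. mem x 0 l \<and> mem y l 0}" using u(2,3) unfolding l mem_subgrp by blast
next
  fix u assume "u \<in> pw ` {l. mem x 0 l \<and> mem y l 0}"
  then obtain l where l: "u = pw l" "mem x 0 l" "mem y l 0" by blast
  have "(pw 0, u) \<in> subgrp x" "(u, pw 0) \<in> subgrp y" using l by (simp_all only: mem_subgrp)
  thus "u \<in> k2 G (subgrp x) \<inter> k1 G (subgrp y)" using l(1) by (simp add: k1_def k2_def)
qed

lemma card_k2_k1_subgrp:
  assumes "x \<in> Idx" "y \<in> Idx"
  shows "card (k2 G (subgrp x) \<inter> k1 G (subgrp y)) = overlap x y"
proof -
  let ?L = "{l \<in> {0..<int q}. mem x 0 l \<and> mem y l 0}"
  have "pw ` {l. mem x 0 l \<and> mem y l 0} = pw ` ?L"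
  proof (intro equalityI subsetI)
    fix u assume "u \<in> pw ` {l. mem x 0 l \<and> mem y l 0}"
    then obtain l where l: "u = pw l" "mem x 0 l" "mem y l 0" by blast
    have d: "int q dvd l mod int q - l" by (metis dvd_minus_mod dvd_minus_iff minus_diff_eq)
    have "l mod int q \<in> ?L"
      using mem_cong[OF l(2) _ d] mem_cong[OF l(3) d] q_gt_1 by simp
    moreover have "u = pw (l mod int q)" using d l(1) g_order dvd_diff_commute by blast
    ultimately show "u \<in> pw ` ?L" by blast
  qed auto
  moreover have "inj_on pw ?L"
  proof (rule inj_onI)
    fix k l assume kl: "k \<in> ?L" "l \<in> ?L" "pw k = pw l"
    hence "int q dvd k - l" by (simp add: g_order)
    thus "k = l" using kl(1,2) by (auto simp: mod_eq_dvd_iff[symmetric])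
  qed
  ultimately show ?thesis
    using card_overlap[OF assms] by (simp only: k2_k1_subgrp card_image)
qed

lemma compatible_subchar:
  assumes x: "x \<in> Idx" and y: "y \<in> Idx"
  shows "compatible A G (subchar x) (subchar y) \<longleftrightarrow> matching x y"
proof -
  have *: "chr x (\<one>\<^bsub>G\<^esub>, pw l) \<otimes>\<^bsub>A\<^esub> chr y (pw l, \<one>\<^bsub>G\<^esub>) = \<one>\<^bsub>A\<^esub> \<longleftrightarrow> int n dvd expo x 0 l + expo y l 0"
    if "mem x 0 l" "mem y l 0" for l
    using chr_pw[OF x that(1)] chr_pw[OF y that(2)] z_order[of _ 0] by (simp add: zw_add)
  have "compatible A G (subchar x) (subchar y) \<longleftrightarrow>
      (\<forall>l. mem x 0 l \<and> mem y l 0 \<longrightarrow>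
         chr x (\<one>\<^bsub>G\<^esub>, pw l) \<otimes>\<^bsub>A\<^esub> chr y (pw l, \<one>\<^bsub>G\<^esub>) = \<one>\<^bsub>A\<^esub>)"
    unfolding compatible_def subchar_def case_prod_conv k2_k1_subgrp by blast
  thus ?thesis using * matching_iff[OF x y] by blast
qed

lemma star_char_subchar:
  assumes x: "x \<in> Idx" and y: "y \<in> Idx" and m: "matching x y"
  shows "star_char A G (subchar x) (subchar y) = chr (mul x y)"
proof (rule extensionalityI)
  show "star_char A G (subchar x) (subchar y) \<in> extensional (subgrp (mul x y))"
    by (simp add: star_char_def subchar_def star_subgrp[OF x y])
  show "chr (mul x y) \<in> extensional (subgrp (mul x y))" by (simp add: chr_def)
  fix p assume "p \<in> subgrp (mul x y)"
  then obtain k m where km: "p = (pw k, pw m)" "mem (mul x y) k m" by (rule mem_subgrpE)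
  then obtain l where l: "mem x k l" "mem y l m" using mem_mul[OF x y] by blast
  have "star_char A G (subchar x) (subchar y) p = chr x (pw k, pw l) \<otimes>\<^bsub>A\<^esub> chr y (pw l, pw m)"
    unfolding km(1) subchar_def
  proof (rule star_char_eq[OF G.group_axioms A.comm_group_axioms])
    show "(subgrp x, chr x) \<in> subchars A G" "(subgrp y, chr y) \<in> subchars A G"
      using subchar_in_subchars x y by (simp_all flip: subchar_def)
    show "compatible A G (subgrp x, chr x) (subgrp y, chr y)"
      using compatible_subchar[OF x y] m by (simp flip: subchar_def)
    show "(pw k, pw l) \<in> subgrp x" "(pw l, pw m) \<in> subgrp y" using l by (simp_all only: mem_subgrp)
  qed
  also have "\<dots> = zw (expo x k l + expo y l m)"
    by (simp only: chr_pw[OF x l(1)] chr_pw[OF y l(2)] zw_add)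
  also have "\<dots> = zw (expo (mul x y) k m)"
    using expo_mul[OF x y m l] z_order dvd_diff_commute by blast
  also have "\<dots> = chr (mul x y) p"
    unfolding km(1) by (rule chr_pw[OF mul_closed[OF x y] km(2), symmetric])
  finally show "star_char A G (subchar x) (subchar y) p = chr (mul x y) p" .
qed

definition coef :: "(nat \<Rightarrow> 'k::field) \<Rightarrow> idx \<Rightarrow> idx \<Rightarrow> 'k" where
  "coef ell x y = (if matching x y then ell (overlap x y) else 0)"

lemma basis_mult_subchar:
  assumes x: "x \<in> Idx" and y: "y \<in> Idx"
  shows "basis_mult ell A G (subchar x) (subchar y)
       = Poly_Mapping.single (subchar (mul x y)) (coef ell x y)"
  using card_k2_k1_subgrp[OF x y] star_subgrp[OF x y] star_char_subchar[OF x y]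
    compatible_subchar[OF x y]
  by (simp add: basis_mult_def coef_def) (simp add: subchar_def)

lemma subchar_one:
  "subchar (Graph 1 0) = ((\<lambda>u. (u, u)) ` carrier G, \<lambda>p\<in>(\<lambda>u. (u, u)) ` carrier G. \<one>\<^bsub>A\<^esub>)"
proof -
  have "subgrp (Graph 1 0) = (\<lambda>u. (u, u)) ` carrier G"
  proof (intro equalityI subsetI)
    fix p assume "p \<in> subgrp (Graph 1 0)"
    then obtain k l where kl: "p = (pw k, pw l)" "mem (Graph 1 0) k l" by (rule mem_subgrpE)
    hence "pw k = pw l" by (simp add: g_order)
    thus "p \<in> (\<lambda>u. (u, u)) ` carrier G" using kl(1) by auto
  next
    fix p assume "p \<in> (\<lambda>u. (u, u)) ` carrier G"
    then obtain u where u: "p = (u, u)" "u \<in> carrier G" by blast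
    then obtain k where "u = pw k" using g_generates by blast
    thus "p \<in> subgrp (Graph 1 0)" using u(1) by (simp only: mem_subgrp) simp
  qed
  thus ?thesis by (simp add: subchar_def chr_def)
qed

text \<open>A homomorphism is fixed by its value at \<open>g\<close>, and the possible values are
  the powers of \<open>z\<close>. This identifies the order \<open>n\<close> of \<open>z\<close>
  with the size of the dual group in the theorem.\<close>

lemma card_dual: "card (dual A G) = n"
proof -
  define f where "f i = (\<lambda>u\<in>carrier G. zw (int i * lg u))" for i :: nat
  have f_pw: "f i (pw k) = zw (int i * k)" for i k
  proof -
    have "int n dvd int i * lg (pw k) - int i * k"
      using n_dvd[OF lg_pw[of k]] by (simp flip: right_diff_distrib)
    thus ?thesis by (simp add: f_def z_order)
  qed
  have "bij_betw f {..<n} (dual A G)"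
  proof (rule bij_betwI')
    fix i j assume ij: "i \<in> {..<n}" "j \<in> {..<n}"
    show "f i = f j \<longleftrightarrow> i = j"
    proof
      assume "f i = f j"
      hence "zw (int i * 1) = zw (int j * 1)" by (metis f_pw)
      hence "int n dvd int i - int j" by (simp add: z_order)
      thus "i = j" using eq_if_dvd_diff ij by simp
    qed simp
  next
    fix i assume "i \<in> {..<n}"
    have "f i \<in> hom G A"
    proof (rule homI)
      fix u v assume "u \<in> carrier G" "v \<in> carrier G"
      then obtain k l where kl: "u = pw k" "v = pw l" using g_generates by blast
      show "f i (u \<otimes>\<^bsub>G\<^esub> v) = f i u \<otimes>\<^bsub>A\<^esub> f i v"
        unfolding kl by (simp add: pw_add f_pw zw_add distrib_left)
    qed (simp add: f_def)
    thus "f i \<in> dual A G" by (simp add: dual_def f_def)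
  next
    fix \<phi> assume "\<phi> \<in> dual A G"
    hence hom: "\<phi> \<in> hom G A" and ext: "\<phi> \<in> extensional (carrier G)" by (auto simp: dual_def)
    interpret \<phi>: group_hom G A \<phi>
      by (simp add: group_hom_def group_hom_axioms_def G.group_axioms A.group_axioms hom)
    have "\<phi> g [^]\<^bsub>A\<^esub> q = \<phi> (g [^]\<^bsub>G\<^esub> q)" using g by (simp add: \<phi>.hom_nat_pow)
    also have "g [^]\<^bsub>G\<^esub> q = \<one>\<^bsub>G\<^esub>" using g_order[of "int q" 0] by (simp add: int_pow_int)
    finally have "\<phi> g [^]\<^bsub>A\<^esub> q = \<one>\<^bsub>A\<^esub>" by simp
    then obtain i where i: "\<phi> g = zw i" using z_generates[OF \<phi>.hom_closed[OF g]] by blast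
    define j where "j = nat (i mod int n)"
    have j: "j < n" "int n dvd i - int j" using n_pos by (simp_all add: j_def nat_less_iff)
    have "\<phi> = f j"
    proof (rule extensionalityI[OF ext])
      show "f j \<in> extensional (carrier G)" by (simp add: f_def)
      fix u assume "u \<in> carrier G"
      then obtain k where k: "u = pw k" using g_generates by blast
      have "\<phi> u = \<phi> g [^]\<^bsub>A\<^esub> k" unfolding k using g by (simp add: \<phi>.hom_int_pow)
      also have "\<dots> = zw (i * k)" unfolding i using z by (simp add: A.int_pow_pow)
      also have "\<dots> = zw (int j * k)"
        using j(2) by (simp add: z_order flip: left_diff_distrib)
      finally show "\<phi> u = f j u" unfolding k f_pw .
    qed
    thus "\<exists>i\<in>{..<n}. \<phi> = f i" using j(1) by blast
  qed
  thus ?thesis using bij_betw_same_card by fastforce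
qed

end


section \<open>The algebra in coordinates\<close>

lemma lookup_pm_scale [simp]: "Poly_Mapping.lookup (pm_scale c f) x = c * Poly_Mapping.lookup f x"
  by (simp add: Poly_Mapping.map.rep_eq when_def)

text \<open>Overlaps have order 1 or \<open>q\<close>, so the structure constants are built from the
  values of \<open>ell\<close> at these two numbers.\<close>

locale deformed_subchar_algebra = prime_order_subchars q n G A g z
  for q n :: nat and G :: "('g, 'n) monoid_scheme" and A :: "('a, 'm) monoid_scheme"
    and g :: 'g and z :: 'a +
  fixes ell :: "nat \<Rightarrow> 'k::field_char_0"
  assumes ell_1: "ell 1 = 1" and ell_q: "ell q \<noteq> 0"
begin

abbreviation alg :: "('k, ('g, 'a) subchar \<Rightarrow>\<^sub>0 'k) module" where
  "alg \<equiv> subchar_algebra ell A G"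

definition of_coeffs :: "(idx \<Rightarrow> 'k) \<Rightarrow> ('g, 'a) subchar \<Rightarrow>\<^sub>0 'k" where
  "of_coeffs c = (\<Sum>x\<in>Idx. Poly_Mapping.single (subchar x) (c x))"

abbreviation coeff :: "(('g, 'a) subchar \<Rightarrow>\<^sub>0 'k) \<Rightarrow> idx \<Rightarrow> 'k" where
  "coeff f x \<equiv> Poly_Mapping.lookup f (subchar x)"

text \<open>Linear extension of a function on the basis; every matrix entry of the representations
  below is such a functional.\<close>

definition lin :: "(idx \<Rightarrow> 'k) \<Rightarrow> (('g, 'a) subchar \<Rightarrow>\<^sub>0 'k) \<Rightarrow> 'k" where
  "lin \<rho> f = (\<Sum>x\<in>Idx. coeff f x * \<rho> x)"

lemma subchar_eq_iff: "x \<in> Idx \<Longrightarrow> y \<in> Idx \<Longrightarrow> subchar x = subchar y \<longleftrightarrow> x = y"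
  using inj_subchar by (auto simp: inj_on_def)

lemma alg_simps:
  "carrier alg = {f. Poly_Mapping.keys f \<subseteq> subchar ` Idx}"
  "\<one>\<^bsub>alg\<^esub> = Poly_Mapping.single (subchar (Graph 1 0)) 1"
  "\<zero>\<^bsub>alg\<^esub> = 0" "f \<oplus>\<^bsub>alg\<^esub> h = f + h" "c \<odot>\<^bsub>alg\<^esub> f = pm_scale c f"
  unfolding subchar_one by (simp_all add: subchar_algebra_def subchars_eq Let_def)

lemma lin_add: "lin \<rho> (f + h) = lin \<rho> f + lin \<rho> h"
  by (simp add: lin_def lookup_add distrib_right sum.distrib)

lemma lin_0: "lin \<rho> 0 = 0"
  by (simp add: lin_def)

lemma lin_sum: "lin \<rho> (\<Sum>x\<in>X. F x) = (\<Sum>x\<in>X. lin \<rho> (F x))"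
  by (induction X rule: infinite_finite_induct) (simp_all add: lin_0 lin_add)

lemma lin_scale: "lin \<rho> (pm_scale c f) = c * lin \<rho> f"
  by (simp add: lin_def sum_distrib_left mult.assoc)

lemma lin_single:
  assumes "x \<in> Idx"
  shows "lin \<rho> (Poly_Mapping.single (subchar x) c) = c * \<rho> x"
proof -
  have "lin \<rho> (Poly_Mapping.single (subchar x) c) = (\<Sum>y\<in>Idx. if y = x then c * \<rho> x else 0)"
    unfolding lin_def using assms
    by (intro sum.cong) (auto simp: lookup_single when_def subchar_eq_iff)
  thus ?thesis using assms finite_Idx by simp
qed

lemma lin_of_coeffs: "lin \<rho> (of_coeffs c) = (\<Sum>x\<in>Idx. c x * \<rho> x)"
  unfolding of_coeffs_def lin_sum by (rule sum.cong) (simp_all add: lin_single)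

lemma coeff_conv_lin: "x \<in> Idx \<Longrightarrow> coeff f x = lin (\<lambda>y. if y = x then 1 else 0) f"
  using finite_Idx by (simp add: lin_def if_distrib[of "\<lambda>u. _ * u"] cong: if_cong)

lemma coeff_of_coeffs: "x \<in> Idx \<Longrightarrow> coeff (of_coeffs c) x = c x"
  using finite_Idx by (simp add: coeff_conv_lin lin_of_coeffs if_distrib[of "\<lambda>u. _ * u"] cong: if_cong)

lemma of_coeffs_in_alg: "of_coeffs c \<in> carrier alg"
  unfolding of_coeffs_def alg_simps mem_Collect_eq
  using keys_sum[of "\<lambda>x. Poly_Mapping.single (subchar x) (c x)" Idx]
  by (auto split: if_splits)

lemma alg_eqI:
  assumes "f \<in> carrier alg" "h \<in> carrier alg" "\<And>x. x \<in> Idx \<Longrightarrow> coeff f x = coeff h x"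
  shows "f = h"
proof (rule poly_mapping_eqI)
  fix v show "Poly_Mapping.lookup f v = Poly_Mapping.lookup h v"
  proof (cases "v \<in> subchar ` Idx")
    case False
    hence "v \<notin> Poly_Mapping.keys f" "v \<notin> Poly_Mapping.keys h" using assms by (auto simp: alg_simps)
    thus ?thesis by (simp add: in_keys_iff)
  qed (use assms in auto)
qed

text \<open>Summands outside the keys vanish, so both sums can run over the fixed set
  \<open>Idx\<close>, independent of the factors.\<close>

lemma mult_alg:
  assumes f: "f \<in> carrier alg" and h: "h \<in> carrier alg"
  shows "f \<otimes>\<^bsub>alg\<^esub> h = (\<Sum>x\<in>Idx. \<Sum>y\<in>Idx.
           Poly_Mapping.single (subchar (mul x y)) (coeff f x * coeff h y * coef ell x y))"
proof -
  have fin: "finite (subchar ` Idx)" using finite_Idx by simp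
  let ?t = "\<lambda>u v. pm_scale (Poly_Mapping.lookup f u * Poly_Mapping.lookup h v) (basis_mult ell A G u v)"
  have t0: "?t u v = 0" if "Poly_Mapping.lookup f u = 0 \<or> Poly_Mapping.lookup h v = 0" for u v
    by (rule poly_mapping_eqI) (use that in auto)
  have "f \<otimes>\<^bsub>alg\<^esub> h = (\<Sum>u\<in>Poly_Mapping.keys f. \<Sum>v\<in>Poly_Mapping.keys h. ?t u v)"
    by (simp add: subchar_algebra_def)
  also have "\<dots> = (\<Sum>u\<in>Poly_Mapping.keys f. \<Sum>v\<in>subchar ` Idx. ?t u v)"
  proof (rule sum.cong[OF refl])
    fix u
    show "(\<Sum>v\<in>Poly_Mapping.keys h. ?t u v) = (\<Sum>v\<in>subchar ` Idx. ?t u v)"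
    proof (rule sum.mono_neutral_left[OF fin])
      show "Poly_Mapping.keys h \<subseteq> subchar ` Idx" using h by (simp add: alg_simps)
      show "\<forall>v\<in>subchar ` Idx - Poly_Mapping.keys h. ?t u v = 0"
        by (intro ballI t0 disjI2) (simp add: in_keys_iff)
    qed
  qed
  also have "\<dots> = (\<Sum>u\<in>subchar ` Idx. \<Sum>v\<in>subchar ` Idx. ?t u v)"
  proof (rule sum.mono_neutral_left[OF fin])
    show "Poly_Mapping.keys f \<subseteq> subchar ` Idx" using f by (simp add: alg_simps)
    show "\<forall>u\<in>subchar ` Idx - Poly_Mapping.keys f. (\<Sum>v\<in>subchar ` Idx. ?t u v) = 0"
      by (intro ballI sum.neutral t0 disjI1) (simp add: in_keys_iff)
  qed
  also have "\<dots> = (\<Sum>x\<in>Idx. \<Sum>y\<in>Idx. ?t (subchar x) (subchar y))"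
    by (simp add: sum.reindex[OF inj_subchar])
  also have "\<dots> = (\<Sum>x\<in>Idx. \<Sum>y\<in>Idx.
      Poly_Mapping.single (subchar (mul x y)) (coeff f x * coeff h y * coef ell x y))"
  proof (intro sum.cong refl)
    fix x y assume xy: "x \<in> Idx" "y \<in> Idx"
    show "?t (subchar x) (subchar y)
        = Poly_Mapping.single (subchar (mul x y)) (coeff f x * coeff h y * coef ell x y)"
      unfolding basis_mult_subchar[OF xy] by (intro poly_mapping_eqI) (simp add: lookup_single when_def)
  qed
  finally show ?thesis .
qed

lemma lin_mult:
  assumes "f \<in> carrier alg" "h \<in> carrier alg"
  shows "lin \<rho> (f \<otimes>\<^bsub>alg\<^esub> h)
       = (\<Sum>x\<in>Idx. \<Sum>y\<in>Idx. coeff f x * coeff h y * (coef ell x y * \<rho> (mul x y)))"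
  unfolding mult_alg[OF assms] lin_sum
  by (intro sum.cong refl) (simp add: lin_single mul_closed mult.assoc)

text \<open>By bilinearity a matrix product formula need only be checked on basis elements, up to
  the structure constant \<open>coef\<close>. Here \<rho> is a row of the left factor, \<sigma> a
  column of the right factor and \<tau> the entry of the product.\<close>

lemma lin_mult_matrix_entry:
  assumes f: "f \<in> carrier alg" and h: "h \<in> carrier alg"
    and rep: "\<And>x y. x \<in> Idx \<Longrightarrow> y \<in> Idx \<Longrightarrow> (\<Sum>k\<in>K. \<rho> x k * \<sigma> y k) = coef ell x y * \<tau> (mul x y)"
  shows "lin \<tau> (f \<otimes>\<^bsub>alg\<^esub> h) = (\<Sum>k\<in>K. lin (\<lambda>x. \<rho> x k) f * lin (\<lambda>y. \<sigma> y k) h)"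
proof -
  have "(\<Sum>k\<in>K. lin (\<lambda>x. \<rho> x k) f * lin (\<lambda>y. \<sigma> y k) h)
      = (\<Sum>k\<in>K. \<Sum>x\<in>Idx. \<Sum>y\<in>Idx. coeff f x * coeff h y * (\<rho> x k * \<sigma> y k))"
    by (simp add: lin_def sum_product mult_ac)
  also have "\<dots> = (\<Sum>x\<in>Idx. \<Sum>k\<in>K. \<Sum>y\<in>Idx. coeff f x * coeff h y * (\<rho> x k * \<sigma> y k))"
    by (rule sum.swap)
  also have "\<dots> = (\<Sum>x\<in>Idx. \<Sum>y\<in>Idx. \<Sum>k\<in>K. coeff f x * coeff h y * (\<rho> x k * \<sigma> y k))"
    by (intro sum.cong refl sum.swap)
  also have "\<dots> = (\<Sum>x\<in>Idx. \<Sum>y\<in>Idx. coeff f x * coeff h y * (coef ell x y * \<tau> (mul x y)))"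
    by (intro sum.cong refl) (simp add: rep flip: sum_distrib_left)
  finally show ?thesis using lin_mult[OF f h] by simp
qed

lemma one_in_alg: "\<one>\<^bsub>alg\<^esub> \<in> carrier alg"
  using q_gt_1 n_pos by (auto simp: alg_simps)

lemma zero_in_alg: "\<zero>\<^bsub>alg\<^esub> \<in> carrier alg"
  by (simp add: alg_simps)

lemma add_in_alg: "f \<in> carrier alg \<Longrightarrow> h \<in> carrier alg \<Longrightarrow> f \<oplus>\<^bsub>alg\<^esub> h \<in> carrier alg"
  using keys_add[of f h] by (auto simp: alg_simps)

lemma mult_in_alg:
  assumes "f \<in> carrier alg" "h \<in> carrier alg"
  shows "f \<otimes>\<^bsub>alg\<^esub> h \<in> carrier alg"
proof -
  have sum: "(\<Sum>x\<in>X. F x) \<in> carrier alg" if "\<And>x. x \<in> X \<Longrightarrow> F x \<in> carrier alg"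
    for X :: "idx set" and F
    using that
    by (induction X rule: infinite_finite_induct)
      (auto intro: add_in_alg[unfolded alg_simps(4)] zero_in_alg[unfolded alg_simps(3)])
  show ?thesis unfolding mult_alg[OF assms]
    by (intro sum) (auto simp: alg_simps mul_closed)
qed


section \<open>Irreducible representations\<close>

text \<open>The indices \<open>Rect x y\<close> span a two-sided ideal, a Munn algebra with sandwich matrix
  \<open>sandwich\<close>. That matrix has determinant \<open>\<plusminus> ell q ^ (n - 1) * (ell q - n)\<close>.\<close>

definition sandwich :: "nat \<Rightarrow> nat \<Rightarrow> 'k" where
  "sandwich y s = (if y = n \<or> s = n then 1 else if n dvd y + s then ell q else 0)"

lemma coef_simps:
  "y \<le> n \<Longrightarrow> u \<le> n \<Longrightarrow> coef ell (Rect x y) (Rect u v) = sandwich y u"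
  "coef ell (Graph a i) t = 1" "coef ell t (Graph a i) = 1"
  using ell_1 by (auto simp: coef_def sandwich_def)

text \<open>Left multiplication on the span of the elements \<open>Rect s w\<close> with
  \<open>w\<close> fixed: a rectangle becomes a matrix unit times the sandwich matrix, a graph the
  permutation matrix of \<open>act\<close>.\<close>

primrec munn_rep :: "idx \<Rightarrow> nat \<Rightarrow> nat \<Rightarrow> 'k" where
  "munn_rep (Rect x y) r s = (if r = x then sandwich y s else 0)"
| "munn_rep (Graph a i) r s = (if r = act a i s then 1 else 0)"

lemma sum_atMost_delta:
  fixes h :: "nat \<Rightarrow> 'k"
  assumes "x \<le> m"
  shows "(\<Sum>k\<le>m. h k * (if k = x then c else 0)) = h x * c"
proof -
  have "(\<Sum>k\<le>m. h k * (if k = x then c else 0)) = (\<Sum>k\<le>m. if k = x then h x * c else 0)"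
    by (rule sum.cong) auto
  thus ?thesis using assms by simp
qed

text \<open>Both divisibility conditions say that \<open>n\<close> divides
  \<open>y * a + i + s\<close>, because \<open>act a i s * a\<close> is congruent to
  \<open>i + s\<close> and \<open>a\<close> is a unit. This is what associativity of rectangle,
  graph, rectangle requires.\<close>

lemma sandwich_act:
  assumes a: "a \<in> {1..<q}" and "y \<le> n" "s \<le> n"
  shows "sandwich y (act a i s) = sandwich (if y = n then n else (y * a + i) mod n) s"
proof (cases "y = n \<or> s = n")
  case True
  thus ?thesis by (auto simp: sandwich_def)
next
  case False
  hence y: "y < n" and s: "s < n" using assms by auto
  have act: "act a i s < n" using act_less_iff s by simp
  define m where "m = (y * a + i) mod n"
  have m: "m < n" using n_pos by (simp add: m_def)
  have "int n dvd int y + int (act a i s) \<longleftrightarrow> int n dvd int m + int s"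
  proof -
    have 1: "int n dvd int m - (int y * int a + int i)"
      using dvd_mod_diff[of "y * a + i"] by (simp add: m_def)
    have 2: "int n dvd (int y * int a + int i + int s) - (int y + int (act a i s)) * int a"
      by (rule dvd_lincomb[OF act_dvd[OF a s, of i] dvd_0_right, where u = "-1" and v = 0])
        (simp add: algebra_simps)
    show ?thesis
    proof
      assume 3: "int n dvd int y + int (act a i s)"
      have "int n dvd int y * int a + int i + int s"
        by (rule dvd_lincomb[OF 2 3, where u = 1 and v = "int a"]) (simp add: algebra_simps)
      from this 1 show "int n dvd int m + int s"
        by (rule dvd_lincomb[where u = 1 and v = 1]) simp
    next
      assume 3: "int n dvd int m + int s"
      have "int n dvd int y * int a + int i + int s"
        by (rule dvd_lincomb[OF 3 1, where u = 1 and v = "-1"]) simp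
      from this 2 have "int n dvd (int y + int (act a i s)) * int a"
        by (rule dvd_lincomb[where u = 1 and v = "-1"]) simp
      thus "int n dvd int y + int (act a i s)" by (rule unit_cancel_n[OF a])
    qed
  qed
  hence "n dvd y + act a i s \<longleftrightarrow> n dvd m + s" by (metis of_nat_add of_nat_dvd_iff)
  thus ?thesis using y s act m by (simp add: sandwich_def flip: m_def)
qed

text \<open>Multiplied by \<open>a * b\<close>, both sides become congruent to
  \<open>i * b + j + s\<close> modulo \<open>n\<close>.\<close>

lemma act_act:
  assumes a: "a \<in> {1..<q}" and b: "b \<in> {1..<q}" and "s \<le> n"
  shows "act (a * b mod q) ((i * b + j) mod n) s = act a i (act b j s)"
proof (cases "s = n")
  case False
  hence s: "s < n" using assms by simp
  have t: "act b j s < n" using act_less_iff[of s] s by simp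
  have u: "act a i (act b j s) < n" using act_less_iff[of "act b j s"] t by simp
  have ab: "int n dvd int (a * b mod q) - int a * int b"
    by (rule n_dvd) (metis dvd_minus_mod minus_diff_eq dvd_minus_iff zmod_int of_nat_mult)
  show ?thesis
  proof (rule act_eqI[OF mult_unit_closed[OF a b] s u])
    have 1: "int n dvd int (act a i (act b j s)) * int (a * b mod q)
        - int (act a i (act b j s)) * int a * int b"
      by (rule dvd_lincomb[OF ab dvd_0_right, where u = "int (act a i (act b j s))" and v = 0])
        (simp add: algebra_simps)
    have 2: "int n dvd int (act a i (act b j s)) * int a * int b - (int i * int b + int j + int s)"
      by (rule dvd_lincomb[OF act_dvd[OF a t, of i] act_dvd[OF b s, of j],
          where u = "int b" and v = 1]) (simp add: algebra_simps)
    have 3: "int n dvd int (act a i (act b j s)) * int (a * b mod q) - (int i * int b + int j + int s)"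
      by (rule dvd_lincomb[OF 1 2, where u = 1 and v = 1]) simp
    show "int n dvd int (act a i (act b j s)) * int (a * b mod q) - (int ((i * b + j) mod n) + int s)"
      by (rule dvd_lincomb[OF 3 dvd_mod_diff[of "i * b + j"], where u = 1 and v = "-1"]) simp
  qed
qed simp

lemma munn_rep_mult:
  assumes "x \<in> Idx" "y \<in> Idx" "s \<le> n"
  shows "(\<Sum>k\<le>n. munn_rep x r k * munn_rep y k s) = coef ell x y * munn_rep (mul x y) r s"
  using assms(1)
proof (cases rule: IdxE)
  case x: (1 u v)
  from assms(2) show ?thesis
  proof (cases rule: IdxE)
    case y: (1 u' v')
    show ?thesis unfolding x(1) y(1) munn_rep.simps
      using x y sum_atMost_delta[OF y(2)] by (simp add: coef_simps)
  next
    case y: (2 a i)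
    show ?thesis unfolding x(1) y(1) munn_rep.simps
      using x sum_atMost_delta[OF act_le[of a i s]] sandwich_act[OF y(2) x(3) assms(3)]
      by (simp add: coef_simps)
  qed
next
  case x: (2 a i)
  from assms(2) show ?thesis
  proof (cases rule: IdxE)
    case y: (1 u' v')
    show ?thesis unfolding x(1) y(1) munn_rep.simps
      using y sum_atMost_delta[OF y(2)] by (simp add: coef_simps)
  next
    case y: (2 b j)
    show ?thesis unfolding x(1) y(1) munn_rep.simps mul_simps
      using sum_atMost_delta[OF act_le[of b j s]] act_act[OF x(2) y(2) assms(3)]
      by (simp add: coef_simps)
  qed
qed

text \<open>Modulo that ideal, the algebra is the group algebra of \<open>\<int>/n \<rtimes> (\<int>/q)\<^sup>\<times>\<close>, which for
  \<open>n = q\<close> has besides the one-dimensional representations only the one induced from a nontrivial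
  character of \<open>\<int>/q\<close>. Its matrix indices are shifted by one, from \<open>1, ..., q - 1\<close>.\<close>

primrec induced_rep :: "'k \<Rightarrow> idx \<Rightarrow> nat \<Rightarrow> nat \<Rightarrow> 'k" where
  "induced_rep \<epsilon> (Rect x y) r s = 0"
| "induced_rep \<epsilon> (Graph a i) r s = (if Suc r = a * Suc s mod q then \<epsilon> ^ (i * Suc s) else 0)"

primrec linear_rep :: "(nat \<Rightarrow> 'k) \<Rightarrow> idx \<Rightarrow> nat \<Rightarrow> 'k" where
  "linear_rep \<chi> (Rect x y) t = 0"
| "linear_rep \<chi> (Graph a i) t = \<chi> a ^ t"

text \<open>The bound on \<open>s\<close> excludes \<open>n = 1\<close>. A single \<open>k\<close>
  contributes for two graphs, namely the predecessor of \<open>b * Suc s mod q\<close>, and the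
  resulting powers of \<epsilon> have exponents congruent modulo \<open>q\<close>. If a rectangle
  occurs, both sides vanish.\<close>

lemma induced_rep_mult:
  assumes \<epsilon>: "primitive_root_of_unity q \<epsilon>" and "x \<in> Idx" "y \<in> Idx" and s: "s < n - 1"
  shows "(\<Sum>k<n - 1. induced_rep \<epsilon> x r k * induced_rep \<epsilon> y k s)
       = coef ell x y * induced_rep \<epsilon> (mul x y) r s"
proof (cases "\<exists>a i b j. x = Graph a i \<and> y = Graph b j")
  case True
  then obtain a i b j where x: "x = Graph a i" and y: "y = Graph b j" by blast
  have ab: "a \<in> {1..<q}" "b \<in> {1..<q}" using assms x y by auto
  have n: "n = q" using s n_cases by auto
  have "b * Suc s mod q \<in> {1..<q}" using mult_unit_closed[OF ab(2), of "Suc s"] s n by auto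
  then obtain k where k: "b * Suc s mod q = Suc k" "k < n - 1"
    using n by (cases "b * Suc s mod q") auto
  have "(\<Sum>k<n - 1. induced_rep \<epsilon> x r k * induced_rep \<epsilon> y k s)
      = (\<Sum>k'<n - 1. if k' = k then induced_rep \<epsilon> x r k * \<epsilon> ^ (j * Suc s) else 0)"
    unfolding y induced_rep.simps k(1) by (rule sum.cong) auto
  also have "\<dots> = induced_rep \<epsilon> x r k * \<epsilon> ^ (j * Suc s)" using k(2) by simp
  also have "\<dots> = induced_rep \<epsilon> (mul x y) r s"
  proof -
    have 1: "a * Suc k mod q = (a * b mod q) * Suc s mod q"
      unfolding k(1)[symmetric] by (metis mod_mult_left_eq mod_mult_right_eq mult.assoc)
    have "[i * Suc k + j * Suc s = ((i * b + j) mod n) * Suc s] (mod q)"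
    proof -
      have "[i * Suc k + j * Suc s = i * (b * Suc s) + j * Suc s] (mod q)"
        unfolding k(1)[symmetric] by (intro cong_add cong_mult cong_refl) (simp add: cong_def)
      also have "i * (b * Suc s) + j * Suc s = (i * b + j) * Suc s" by (simp only: algebra_simps)
      also have "[(i * b + j) * Suc s = ((i * b + j) mod n) * Suc s] (mod q)"
        unfolding n by (intro cong_mult cong_refl) (simp add: cong_def)
      finally show ?thesis .
    qed
    from primitive_root_of_unity_cong[OF \<epsilon> this] 1 show ?thesis
      unfolding x y mul_simps induced_rep.simps by (simp only: power_add split: if_split) simp
  qed
  finally show ?thesis by (simp add: x y coef_simps)
next
  case False
  hence "(\<exists>u v. x = Rect u v) \<or> (\<exists>u v. y = Rect u v)" by (metis idx.exhaust)
  moreover from this have "\<exists>u v. mul x y = Rect u v" by (cases x; cases y) auto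
  ultimately show ?thesis by auto
qed

lemma linear_rep_mult:
  assumes \<chi>: "\<And>a b. a \<in> {1..<q} \<Longrightarrow> b \<in> {1..<q} \<Longrightarrow> \<chi> (a * b mod q) = \<chi> a * \<chi> b"
    and "x \<in> Idx" "y \<in> Idx"
  shows "linear_rep \<chi> x t * linear_rep \<chi> y t = coef ell x y * linear_rep \<chi> (mul x y) t"
  using assms(2,3)
  by (elim IdxE) (auto simp: coef_simps \<chi> power_mult_distrib)

section \<open>Invertibility of the sandwich matrix and joint faithfulness\<close>

text \<open>Column \<open>n\<close> consists of ones. Any other column has two nonzero entries: 1 in
  row \<open>n\<close>, and \<open>ell q\<close> in row \<open>(n - s) mod n\<close>, the residue of
  \<open>- s\<close>.\<close>

lemma sum_sandwich:
  fixes f :: "nat \<Rightarrow> 'k"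
  shows "(\<Sum>y\<le>n. f y * sandwich y n) = f n + (\<Sum>y<n. f y)"
    and "s < n \<Longrightarrow> (\<Sum>y\<le>n. f y * sandwich y s) = f n + ell q * f ((n - s) mod n)"
proof -
  have split: "(\<Sum>y\<le>n. h y) = h n + (\<Sum>y<n. h y)" for h :: "nat \<Rightarrow> 'k"
    by (simp flip: lessThan_Suc_atMost)
  show "(\<Sum>y\<le>n. f y * sandwich y n) = f n + (\<Sum>y<n. f y)"
    unfolding split by (simp add: sandwich_def)
  assume s: "s < n"
  have "(\<Sum>y<n. f y * sandwich y s) = (\<Sum>y<n. if y = (n - s) mod n then ell q * f ((n - s) mod n) else 0)"
  proof (rule sum.cong)
    fix y assume y: "y \<in> {..<n}"
    have "n dvd y + s \<longleftrightarrow> y = (n - s) mod n"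
    proof
      assume "n dvd y + s"
      then obtain c where c: "y + s = n * c" by (rule dvdE)
      moreover have "y + s < n * 2" using y s by auto
      ultimately have "n * c < n * 2" by simp
      hence "c = 0 \<or> c = 1" by auto
      thus "y = (n - s) mod n" using c y s by auto
    next
      assume "y = (n - s) mod n"
      thus "n dvd y + s" using s by (cases "s = 0") auto
    qed
    thus "f y * sandwich y s = (if y = (n - s) mod n then ell q * f ((n - s) mod n) else 0)"
      using y s by (auto simp: sandwich_def)
  qed simp
  also have "\<dots> = ell q * f ((n - s) mod n)" using n_pos by simp
  finally show "(\<Sum>y\<le>n. f y * sandwich y s) = f n + ell q * f ((n - s) mod n)"
    unfolding split by (simp add: sandwich_def)
qed

text \<open>The columns below \<open>n\<close> give \<open>f n + ell q * f y = 0\<close> for all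
  \<open>y < n\<close>. Substituting this into \<open>ell q\<close> times the equation of column
  \<open>n\<close> leaves \<open>(ell q - n) * f n = 0\<close>.\<close>

lemma sandwich_nonsingular:
  assumes ne: "ell q \<noteq> of_nat n" and 0: "\<And>s. s \<le> n \<Longrightarrow> (\<Sum>y\<le>n. f y * sandwich y s) = 0"
    and y: "y \<le> n"
  shows "f y = 0"
proof -
  have 1: "f n + ell q * f y = 0" if "y < n" for y
  proof -
    define s where "s = (n - y) mod n"
    have s: "s < n" using n_pos by (simp add: s_def)
    have "(n - s) mod n = y" using that by (cases "y = 0") (auto simp: s_def)
    thus ?thesis using 0[of s] sum_sandwich(2)[OF s, of f] s by simp
  qed
  have "ell q * f n + (\<Sum>y<n. ell q * f y) = 0"
    using 0[of n] sum_sandwich(1)[of f] by (simp flip: sum_distrib_left distrib_left)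
  also have "(\<Sum>y<n. ell q * f y) = (\<Sum>y<n. - f n)"
    using 1 by (intro sum.cong) (auto simp: add_eq_0_iff)
  finally have "(ell q - of_nat n) * f n = 0" by (simp add: algebra_simps)
  hence n0: "f n = 0" using ne by simp
  show ?thesis using 1[of y] n0 y ell_q by (cases "y = n") auto
qed

text \<open>The entries of all three families, put under one tagged index so that they form a single
  linear system; a linear character uses 0 as its third component.\<close>

definition rep_entry :: "'k \<Rightarrow> (nat \<Rightarrow> 'k) \<Rightarrow> idx \<Rightarrow> nat \<times> nat \<times> nat \<Rightarrow> 'k" where
  "rep_entry \<epsilon> \<chi> x = (\<lambda>(m, r, s).
     if m = 0 then munn_rep x r s else if m = 1 then induced_rep \<epsilon> x r s else linear_rep \<chi> x r)"

definition rep_index :: "(nat \<times> nat \<times> nat) set" where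
  "rep_index = {0} \<times> {..n} \<times> {..n} \<union> {1} \<times> {..<n - 1} \<times> {..<n - 1} \<union> {2} \<times> {..<q - 1} \<times> {0}"

lemma finite_rep_index: "finite rep_index"
  by (simp add: rep_index_def)

text \<open>The two counts differ by \<open>(n - 1) * (n - q)\<close>, which vanishes in exactly the
  two possible cases.\<close>

lemma card_rep_index: "card rep_index = card Idx"
proof -
  have "card rep_index = (n + 1) * (n + 1) + (n - 1) * (n - 1) + (q - 1)"
    unfolding rep_index_def
    by (subst card_Un_disjoint; (subst card_Un_disjoint)?) (auto simp: card_cartesian_product)
  moreover have "(n - 1) * (n - 1) + (q - 1) = (q - 1) * n"
    using n_cases
  proof
    assume "n = q"
    moreover obtain m where "q = Suc m" using q_gt_1 by (cases q) auto
    ultimately show ?thesis by simp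
  qed simp
  ultimately show ?thesis by (simp add: card_Idx power2_eq_square)
qed

lemma rep_entry_independent:
  assumes \<epsilon>: "primitive_root_of_unity q \<epsilon>" and \<chi>: "inj_on \<chi> {1..<q}" and ne: "ell q \<noteq> of_nat n"
    and 0: "\<And>t. t \<in> rep_index \<Longrightarrow> (\<Sum>x\<in>Idx. c x * rep_entry \<epsilon> \<chi> x t) = 0"
  shows "\<forall>x\<in>Idx. c x = 0"
proof -
  \<comment> \<open>The linear characters see only the sum over the graphs of each slope
    \<open>a\<close>, and the Vandermonde system in the values of \<chi> separates the
    slopes.\<close>
  have lin: "(\<Sum>i<n. c (Graph a i)) = 0" if a: "a \<in> {1..<q}" for a
  proof (rule vandermonde_independent[OF _ \<chi> _ a])
    fix t assume t: "t < card {1..<q}"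
    hence "(2, t, 0) \<in> rep_index" by (simp add: rep_index_def)
    from 0[OF this] show "(\<Sum>a\<in>{1..<q}. (\<Sum>i<n. c (Graph a i)) * \<chi> a ^ t) = 0"
      by (simp add: sum_Idx rep_entry_def sum_distrib_right)
  qed simp
  \<comment> \<open>For given \<open>s\<close> and \<open>a\<close>, the row \<open>r\<close> with
    \<open>Suc r = a * Suc s mod q\<close> receives contributions from slope \<open>a\<close> alone,
    since \<open>Suc s\<close> is a unit modulo \<open>q\<close>.\<close>
  have ind: "(\<Sum>i<n. c (Graph a i) * \<epsilon> ^ (i * Suc s)) = 0" if a: "a \<in> {1..<q}" and s: "s < n - 1" for a s
  proof -
    have n: "n = q" using s n_cases by auto
    have sq: "Suc s \<in> {1..<q}" using s n by auto
    obtain r where r: "a * Suc s mod q = Suc r"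
      using mult_unit_closed[OF a sq] by (cases "a * Suc s mod q") auto
    have r': "r < n - 1" using r mult_unit_closed[OF a sq] n by auto
    have uniq: "Suc r = b * Suc s mod q \<longleftrightarrow> b = a" if b: "b \<in> {1..<q}" for b
    proof
      assume "Suc r = b * Suc s mod q"
      hence "[b * Suc s = a * Suc s] (mod q)" using r by (simp add: cong_def)
      moreover have "coprime (Suc s) q"
        using coprime_unit[OF sq] by (metis coprime_commute coprime_int_iff)
      ultimately have "[b = a] (mod q)" by (metis cong_mult_rcancel_nat coprime_commute)
      thus "b = a" using a b by (simp add: cong_def)
    next
      assume "b = a"
      thus "Suc r = b * Suc s mod q" using r by (simp only:)
    qed
    have "(1, r, s) \<in> rep_index" using r' s by (simp add: rep_index_def)
    from 0[OF this] have "0 = (\<Sum>b\<in>{1..<q}. \<Sum>i<n. c (Graph b i) * induced_rep \<epsilon> (Graph b i) r s)"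
      by (simp add: sum_Idx rep_entry_def del: induced_rep.simps(2))
    also have "\<dots> = (\<Sum>b\<in>{1..<q}. if b = a then \<Sum>i<n. c (Graph a i) * \<epsilon> ^ (i * Suc s) else 0)"
      using uniq by (intro sum.cong) auto
    also have "\<dots> = (\<Sum>i<n. c (Graph a i) * \<epsilon> ^ (i * Suc s))" using a by simp
    finally show ?thesis by simp
  qed
  \<comment> \<open>For fixed slope, \<open>lin\<close> supplies the power 0 and \<open>ind\<close>
    the powers \<open>1, ..., n - 1\<close>. Together they are a full Vandermonde system in the
    powers of \<epsilon>.\<close>
  have Graph: "c (Graph a i) = 0" if a: "a \<in> {1..<q}" and i: "i < n" for a i
  proof (rule vandermonde_independent[of "{..<n}" "\<lambda>i. \<epsilon> ^ i" "\<lambda>i. c (Graph a i)"])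
    have "n \<le> q" using n_cases q_gt_1 by auto
    thus "inj_on (\<lambda>i. \<epsilon> ^ i) {..<n}"
      using primitive_root_of_unity_inj[OF \<epsilon>] by (auto intro: inj_on_subset)
    fix t assume "t < card {..<n}"
    thus "(\<Sum>i<n. c (Graph a i) * (\<epsilon> ^ i) ^ t) = 0"
      unfolding power_mult[symmetric] using lin[OF a] ind[OF a, of "t - 1"] by (cases t) simp_all
  qed (use i in auto)
  \<comment> \<open>With the graphs gone, row \<open>x\<close> of the Munn representation is row
    \<open>x\<close> of the coefficients times the sandwich matrix.\<close>
  have Rect: "c (Rect x y) = 0" if x: "x \<le> n" and y: "y \<le> n" for x y
  proof (rule sandwich_nonsingular[OF ne _ y])
    fix s assume s: "s \<le> n"
    have "(0, x, s) \<in> rep_index" using x s by (simp add: rep_index_def)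
    from 0[OF this] have "0 = (\<Sum>x'\<le>n. \<Sum>y\<le>n. c (Rect x' y) * munn_rep (Rect x' y) x s)"
      by (simp add: sum_Idx rep_entry_def Graph del: munn_rep.simps(1))
    also have "\<dots> = (\<Sum>x'\<le>n. if x' = x then \<Sum>y\<le>n. c (Rect x y) * sandwich y s else 0)"
      by (intro sum.cong) auto
    also have "\<dots> = (\<Sum>y\<le>n. c (Rect x y) * sandwich y s)" using x by simp
    finally show "(\<Sum>y\<le>n. c (Rect x y) * sandwich y s) = 0" by simp
  qed
  show ?thesis using Graph Rect by (auto elim!: IdxE)
qed


section \<open>The isomorphism and the degenerate case\<close>

abbreviation target :: "('k, 'k mat \<times> 'k mat \<times> (nat \<Rightarrow> 'k)) module" where
  "target \<equiv> mat_alg TYPE('k) (n + 1) \<oplus>\<^sub>a mat_alg TYPE('k) (n - 1) \<oplus>\<^sub>a power_alg TYPE('k) (q - 1)"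

definition rep :: "'k \<Rightarrow> (nat \<Rightarrow> 'k) \<Rightarrow> (('g, 'a) subchar \<Rightarrow>\<^sub>0 'k) \<Rightarrow> 'k mat \<times> 'k mat \<times> (nat \<Rightarrow> 'k)"
  where "rep \<epsilon> \<chi> f =
    (mat (n + 1) (n + 1) (\<lambda>(r, s). lin (\<lambda>x. munn_rep x r s) f),
     mat (n - 1) (n - 1) (\<lambda>(r, s). lin (\<lambda>x. induced_rep \<epsilon> x r s) f),
     \<lambda>t\<in>{..<q - 1}. lin (\<lambda>x. linear_rep \<chi> x t) f)"

lemma rep_ring_hom:
  assumes \<epsilon>: "primitive_root_of_unity q \<epsilon>" and \<chi>1: "\<chi> 1 = 1"
    and \<chi>: "\<And>a b. a \<in> {1..<q} \<Longrightarrow> b \<in> {1..<q} \<Longrightarrow> \<chi> (a * b mod q) = \<chi> a * \<chi> b"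
  shows "rep \<epsilon> \<chi> \<in> Ring.ring_hom alg target"
proof (rule ring_hom_memI)
  fix f assume f: "f \<in> carrier alg"
  show "rep \<epsilon> \<chi> f \<in> carrier target" by (simp add: rep_def module_mat_simps power_alg_simps)
  fix h assume h: "h \<in> carrier alg"
  show "rep \<epsilon> \<chi> (f \<oplus>\<^bsub>alg\<^esub> h) = rep \<epsilon> \<chi> f \<oplus>\<^bsub>target\<^esub> rep \<epsilon> \<chi> h"
    by (auto simp: rep_def module_mat_simps power_alg_simps alg_simps lin_add intro!: eq_matI)
  show "rep \<epsilon> \<chi> (f \<otimes>\<^bsub>alg\<^esub> h) = rep \<epsilon> \<chi> f \<otimes>\<^bsub>target\<^esub> rep \<epsilon> \<chi> h"
  proof -
    have 1: "lin (\<lambda>x. munn_rep x r s) (f \<otimes>\<^bsub>alg\<^esub> h)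
        = (\<Sum>k<n + 1. lin (\<lambda>x. munn_rep x r k) f * lin (\<lambda>x. munn_rep x k s) h)" if "s < n + 1" for r s
      by (rule lin_mult_matrix_entry[OF f h])
        (use munn_rep_mult[of _ _ s r] that in \<open>simp add: lessThan_Suc_atMost\<close>)
    have 2: "lin (\<lambda>x. induced_rep \<epsilon> x r s) (f \<otimes>\<^bsub>alg\<^esub> h)
        = (\<Sum>k<n - 1. lin (\<lambda>x. induced_rep \<epsilon> x r k) f * lin (\<lambda>x. induced_rep \<epsilon> x k s) h)"
      if "s < n - 1" for r s
      by (rule lin_mult_matrix_entry[OF f h]) (rule induced_rep_mult[OF \<epsilon> _ _ that])
    \<comment> \<open>A linear character is a representation of degree one, hence the one-point
      summation range.\<close>
    have 3: "lin (\<lambda>x. linear_rep \<chi> x t) (f \<otimes>\<^bsub>alg\<^esub> h)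
        = lin (\<lambda>x. linear_rep \<chi> x t) f * lin (\<lambda>x. linear_rep \<chi> x t) h" for t
      using lin_mult_matrix_entry[OF f h, where K = "{()}" and \<rho> = "\<lambda>x _. linear_rep \<chi> x t"
          and \<sigma> = "\<lambda>x _. linear_rep \<chi> x t" and \<tau> = "\<lambda>x. linear_rep \<chi> x t"] linear_rep_mult[of \<chi>] \<chi> by simp
    show ?thesis
      unfolding rep_def alg_prod_simps module_mat_simps power_alg_simps prod.inject
      by (intro conjI eq_matI)
        (auto simp: scalar_prod_def 1 2 3 atLeast0LessThan simp del: sum.lessThan_Suc)
  qed
next
  have Graph: "Graph 1 0 \<in> Idx" using q_gt_1 n_pos by simp
  have "act 1 0 s = s" if "s \<le> n" for s using that by (auto simp: act_def)
  thus "rep \<epsilon> \<chi> \<one>\<^bsub>alg\<^esub> = \<one>\<^bsub>target\<^esub>"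
    unfolding rep_def alg_prod_simps module_mat_simps power_alg_simps prod.inject alg_simps lin_single[OF Graph]
    using n_cases \<chi>1 by (intro conjI eq_matI) (auto simp: fun_eq_iff)
qed

lemma rep_bij:
  assumes \<epsilon>: "primitive_root_of_unity q \<epsilon>" and \<chi>: "inj_on \<chi> {1..<q}" and ne: "ell q \<noteq> of_nat n"
  shows "bij_betw (rep \<epsilon> \<chi>) (carrier alg) (carrier target)"
proof -
  have entry: "lin (\<lambda>x. rep_entry \<epsilon> \<chi> x t) f = (case t of (m, r, s) \<Rightarrow>
      if m = 0 then fst (rep \<epsilon> \<chi> f) $$ (r, s) else if m = 1 then fst (snd (rep \<epsilon> \<chi> f)) $$ (r, s)
      else snd (snd (rep \<epsilon> \<chi> f)) r)"
    if "t \<in> rep_index" for t f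
    using that by (auto simp: rep_index_def rep_def rep_entry_def)
  have inj: "inj_on (rep \<epsilon> \<chi>) (carrier alg)"
  proof (rule inj_onI)
    fix f h assume f: "f \<in> carrier alg" and h: "h \<in> carrier alg" and eq: "rep \<epsilon> \<chi> f = rep \<epsilon> \<chi> h"
    have "\<forall>x\<in>Idx. coeff f x - coeff h x = 0"
    proof (rule rep_entry_independent[OF \<epsilon> \<chi> ne])
      fix t assume t: "t \<in> rep_index"
      have "lin (\<lambda>x. rep_entry \<epsilon> \<chi> x t) f = lin (\<lambda>x. rep_entry \<epsilon> \<chi> x t) h"
        by (simp only: entry[OF t] eq)
      thus "(\<Sum>x\<in>Idx. (coeff f x - coeff h x) * rep_entry \<epsilon> \<chi> x t) = 0"
        by (simp add: lin_def left_diff_distrib sum_subtractf)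
    qed
    thus "f = h" using f h by (intro alg_eqI) auto
  qed
  have "\<exists>f\<in>carrier alg. rep \<epsilon> \<chi> f = T" if T: "T \<in> carrier target" for T
  proof -
    obtain X Y p where XYp: "T = (X, Y, p)" by (metis prod_cases3)
    have car: "X \<in> carrier_mat (n + 1) (n + 1)" "Y \<in> carrier_mat (n - 1) (n - 1)"
      "p \<in> extensional {..<q - 1}"
      using T unfolding XYp by (auto simp: module_mat_simps power_alg_simps PiE_def)
    obtain c where c: "\<forall>t\<in>rep_index. (\<Sum>x\<in>Idx. c x * rep_entry \<epsilon> \<chi> x t)
        = (case t of (m, r, s) \<Rightarrow> if m = 0 then X $$ (r, s) else if m = 1 then Y $$ (r, s) else p r)"
      using square_system_surjective[OF finite_Idx finite_rep_index card_rep_index[symmetric]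
          rep_entry_independent[OF \<epsilon> \<chi> ne], where d = "\<lambda>(m, r, s).
            if m = 0 then X $$ (r, s) else if m = 1 then Y $$ (r, s) else p r"] by blast
    have "rep \<epsilon> \<chi> (of_coeffs c) = (X, Y, p)"
      unfolding rep_def prod.inject
    proof (intro conjI eq_matI)
      fix r s assume "r < dim_row X" "s < dim_col X"
      hence rs: "r < n + 1" "s < n + 1" using car by auto
      hence "(0, r, s) \<in> rep_index" by (auto simp: rep_index_def)
      from bspec[OF c this] rs
      show "mat (n + 1) (n + 1) (\<lambda>(r, s). lin (\<lambda>x. munn_rep x r s) (of_coeffs c)) $$ (r, s) = X $$ (r, s)"
        by (simp add: lin_of_coeffs rep_entry_def)
    next
      fix r s assume "r < dim_row Y" "s < dim_col Y"
      hence rs: "r < n - 1" "s < n - 1" using car by auto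
      hence "(1, r, s) \<in> rep_index" by (auto simp: rep_index_def)
      from bspec[OF c this] rs
      show "mat (n - 1) (n - 1) (\<lambda>(r, s). lin (\<lambda>x. induced_rep \<epsilon> x r s) (of_coeffs c)) $$ (r, s) = Y $$ (r, s)"
        by (simp add: lin_of_coeffs rep_entry_def)
    next
      show "(\<lambda>t\<in>{..<q - 1}. lin (\<lambda>x. linear_rep \<chi> x t) (of_coeffs c)) = p"
      proof (rule extensionalityI[OF restrict_extensional car(3)])
        fix t assume t: "t \<in> {..<q - 1}"
        hence "(2, t, 0) \<in> rep_index" by (auto simp: rep_index_def)
        from bspec[OF c this] t
        show "(\<lambda>t\<in>{..<q - 1}. lin (\<lambda>x. linear_rep \<chi> x t) (of_coeffs c)) t = p t"
          by (simp add: lin_of_coeffs rep_entry_def)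
      qed
    qed (use car in auto)
    thus ?thesis using of_coeffs_in_alg XYp by blast
  qed
  moreover have "rep \<epsilon> \<chi> f \<in> carrier target" for f
    by (simp add: rep_def module_mat_simps power_alg_simps)
  ultimately show ?thesis using inj unfolding bij_betw_def by blast
qed

lemma rep_scale: "rep \<epsilon> \<chi> (c \<odot>\<^bsub>alg\<^esub> f) = c \<odot>\<^bsub>target\<^esub> rep \<epsilon> \<chi> f"
  unfolding rep_def alg_prod_simps module_mat_simps power_alg_simps prod.inject alg_simps lin_scale
  by (intro conjI eq_matI) auto

text \<open>The case \<open>ell q = n\<close>: the row of coefficients \<open>1\<close> and \<open>- n\<close> is in the left kernel of the
  sandwich matrix.\<close>

primrec kernel_coeffs :: "idx \<Rightarrow> 'k" where
  "kernel_coeffs (Rect x y) = (if x = n then if y = n then - of_nat n else 1 else 0)"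
| "kernel_coeffs (Graph a i) = 0"

lemma sum_kernel_coeffs:
  "(\<Sum>x\<in>Idx. kernel_coeffs x * h x) = (\<Sum>y<n. h (Rect n y)) - of_nat n * h (Rect n n)"
proof -
  have split: "(\<Sum>y\<le>n. h y) = h n + (\<Sum>y<n. h y)" for h :: "nat \<Rightarrow> 'k"
    by (simp flip: lessThan_Suc_atMost)
  have 0: "(\<Sum>x<n. \<Sum>y\<le>n. kernel_coeffs (Rect x y) * h (Rect x y)) = 0" by (intro sum.neutral) auto
  show ?thesis unfolding sum_Idx split[of "\<lambda>x. \<Sum>y\<le>n. _ x y"] 0 unfolding split by simp
qed

text \<open>As \<open>f\<close> is supported on elements \<open>Rect n y\<close> and its
  coefficients lie in the left kernel, \<open>f r\<close> is a combination of such elements with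
  coefficient sum 0. On the other hand \<open>Rect n w\<close> times \<open>f\<close> equals
  \<open>f\<close> for every \<open>w\<close>, so \<open>f r f\<close> is 0 times
  \<open>f\<close>.\<close>

lemma not_semisimple:
  assumes eq: "ell q = of_nat n"
  shows "\<not> semisimple_ring alg"
proof
  assume ss: "semisimple_ring alg"
  define f where "f = of_coeffs kernel_coeffs"
  have f: "f \<in> carrier alg" unfolding f_def by (rule of_coeffs_in_alg)
  have cf: "coeff f x = kernel_coeffs x" if "x \<in> Idx" for x
    unfolding f_def using that by (rule coeff_of_coeffs)
  have kernel: "(\<Sum>x\<in>Idx. kernel_coeffs x * coef ell x y) = 0" if y: "y \<in> Idx" for y
    using y
  proof (cases rule: IdxE)
    case (1 u v)
    have "(\<Sum>y<n. coef ell (Rect n y) (Rect u v)) - of_nat n * coef ell (Rect n n) (Rect u v)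
        = (\<Sum>y\<le>n. (if y = n then - of_nat n else 1) * sandwich y u)"
      using 1(2) by (simp add: coef_simps flip: lessThan_Suc_atMost)
    also have "\<dots> = 0"
    proof (cases "u = n")
      case True
      thus ?thesis
        using sum_sandwich(1)[where f = "\<lambda>y. if y = n then - of_nat n else 1"] by simp
    next
      case False
      hence "u < n" using 1(2) by simp
      moreover have "(n - u) mod n \<noteq> n" using mod_less_divisor[OF n_pos, of "n - u"] by linarith
      ultimately show ?thesis
        using sum_sandwich(2)[where f = "\<lambda>y. if y = n then - of_nat n else 1"] eq by simp
    qed
    finally show ?thesis using 1(1) by (simp add: sum_kernel_coeffs)
  next
    case (2 a i)
    thus ?thesis using sum_kernel_coeffs[of "\<lambda>_. 1"] by (simp add: coef_simps)
  qed
  \<comment> \<open>Testing with functionals constant on the elements \<open>Rect n y\<close> states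
    both facts about \<open>f r\<close>: no other basis element occurs, and the coefficients sum to
    0.\<close>
  have left: "lin \<tau> (f \<otimes>\<^bsub>alg\<^esub> r) = 0"
    if r: "r \<in> carrier alg" and \<tau>: "\<And>y. \<tau> (Rect n y) = C" for r \<tau> C
  proof -
    have \<tau>': "kernel_coeffs x * \<tau> (mul x y) = kernel_coeffs x * C" for x y
      using \<tau> by (cases x; cases y) auto
    have "lin \<tau> (f \<otimes>\<^bsub>alg\<^esub> r)
        = (\<Sum>x\<in>Idx. \<Sum>y\<in>Idx. coeff r y * C * (kernel_coeffs x * coef ell x y))"
      unfolding lin_mult[OF f r]
    proof (intro sum.cong refl)
      fix x y assume x: "x \<in> Idx"
      have "coeff f x * coeff r y * (coef ell x y * \<tau> (mul x y))
          = coeff r y * coef ell x y * (kernel_coeffs x * \<tau> (mul x y))"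
        by (simp add: cf[OF x] mult_ac)
      thus "coeff f x * coeff r y * (coef ell x y * \<tau> (mul x y))
          = coeff r y * C * (kernel_coeffs x * coef ell x y)"
        unfolding \<tau>' by (simp add: mult_ac)
    qed
    also have "\<dots> = (\<Sum>y\<in>Idx. \<Sum>x\<in>Idx. coeff r y * C * (kernel_coeffs x * coef ell x y))"
      by (rule sum.swap)
    also have "\<dots> = 0"
      by (rule sum.neutral, rule ballI) (simp only: kernel mult_zero_right flip: sum_distrib_left)
    finally show ?thesis .
  qed
  have "f = \<zero>\<^bsub>alg\<^esub>"
  proof (rule semisimple_ring_no_nilpotent[OF ss f])
    fix r assume r: "r \<in> carrier alg"
    define h where "h = f \<otimes>\<^bsub>alg\<^esub> r"
    have h: "h \<in> carrier alg" unfolding h_def by (rule mult_in_alg[OF f r])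
    have "lin T (h \<otimes>\<^bsub>alg\<^esub> f) = 0" for T
    proof -
      \<comment> \<open>The value of \<open>T\<close> at \<open>x\<close> times
        \<open>Rect n w\<close>. The structure constant is 1, and a graph fixes the index
        \<open>n\<close>; the value is the same for all \<open>x = Rect n v\<close>, so
        \<open>left\<close> applies.\<close>
      define \<tau> where "\<tau> w x = (case x of Rect u v \<Rightarrow> T (Rect u w) | Graph a i \<Rightarrow> T (Rect n w))" for w x
      have \<tau>: "lin (\<tau> w) h = 0" for w
        unfolding h_def by (rule left[OF r]) (simp add: \<tau>_def)
      have mc: "coef ell x (Rect n w) * T (mul x (Rect n w)) = \<tau> w x" if "x \<in> Idx" "w \<le> n" for x w
        using that by (auto elim!: IdxE simp: coef_simps sandwich_def \<tau>_def)
      have "lin T (h \<otimes>\<^bsub>alg\<^esub> f)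
          = (\<Sum>x\<in>Idx. coeff h x * (\<Sum>y\<in>Idx. kernel_coeffs y * (coef ell x y * T (mul x y))))"
        unfolding lin_mult[OF h f] sum_distrib_left by (intro sum.cong refl) (simp add: cf mult_ac)
      also have "\<dots> = (\<Sum>x\<in>Idx. coeff h x * ((\<Sum>w<n. \<tau> w x) - of_nat n * \<tau> n x))"
        unfolding sum_kernel_coeffs by (intro sum.cong refl) (simp add: mc)
      also have "\<dots> = (\<Sum>w<n. lin (\<tau> w) h) - of_nat n * lin (\<tau> n) h"
      proof -
        have "(\<Sum>w<n. lin (\<tau> w) h) = (\<Sum>x\<in>Idx. coeff h x * (\<Sum>w<n. \<tau> w x))"
          unfolding lin_def sum_distrib_left by (rule sum.swap)
        moreover have "of_nat n * lin (\<tau> n) h = (\<Sum>x\<in>Idx. coeff h x * (of_nat n * \<tau> n x))"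
          unfolding lin_def sum_distrib_left by (simp only: mult.left_commute)
        ultimately show ?thesis by (simp only: right_diff_distrib sum_subtractf)
      qed
      finally show ?thesis by (simp add: \<tau>)
    qed
    thus "f \<otimes>\<^bsub>alg\<^esub> r \<otimes>\<^bsub>alg\<^esub> f = \<zero>\<^bsub>alg\<^esub>"
      using mult_in_alg[OF h f] zero_in_alg
      by (intro alg_eqI) (auto simp: coeff_conv_lin h_def alg_simps(3) lin_0)
  qed
  moreover have "coeff f (Rect n 0) = 1" using cf[of "Rect n 0"] n_pos by simp
  ultimately show False by (simp add: alg_simps)
qed

end

text \<open>There is exactly one 0 by 0 matrix, so the middle factor is the zero ring and the
  projection that forgets it is bijective. This is the case \<open>n = 1\<close> of the
  decomposition.\<close>

lemma ring_iso_drop_mat_0: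
  assumes h: "h \<in> ring_iso R (X \<oplus>\<^sub>a mat_alg TYPE('k::field) 0 \<oplus>\<^sub>a Y)"
  shows "(\<lambda>r. (fst (h r), snd (snd (h r)))) \<in> ring_iso R (X \<oplus>\<^sub>a Y)"
proof -
  let ?T = "X \<oplus>\<^sub>a mat_alg TYPE('k) 0 \<oplus>\<^sub>a Y"
  let ?p = "\<lambda>(x, m, y). (x, y)"
  have m0: "m = 0\<^sub>m 0 0" if "m \<in> carrier_mat 0 0" for m :: "'k mat"
    using that by (intro eq_matI) auto
  have "?p \<in> ring_iso ?T (X \<oplus>\<^sub>a Y)"
    unfolding ring_iso_def mem_Collect_eq
  proof
    show "?p \<in> Ring.ring_hom ?T (X \<oplus>\<^sub>a Y)" by (rule ring_hom_memI) auto
    have "inj_on ?p (carrier ?T)" by (rule inj_onI) (auto simp: module_mat_simps dest!: m0)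
    moreover have "?p ` carrier ?T = carrier (X \<oplus>\<^sub>a Y)"
    proof (intro equalityI subsetI)
      fix u assume "u \<in> carrier (X \<oplus>\<^sub>a Y)"
      thus "u \<in> ?p ` carrier ?T"
        by (intro image_eqI[of _ _ "(fst u, 0\<^sub>m 0 0, snd u)"]) (auto simp: module_mat_simps)
    qed auto
    ultimately show "bij_betw ?p (carrier ?T) (carrier (X \<oplus>\<^sub>a Y))" by (simp add: bij_betw_def)
  qed
  from ring_iso_set_trans[OF h this] show ?thesis by (simp add: comp_def case_prod_unfold)
qed

theorem theorem1p2:
  fixes ell :: "nat \<Rightarrow> 'k::field_char_0"
    and A :: "('a, 'm) monoid_scheme"
    and G :: "('g, 'n) monoid_scheme"
    and q :: nat
  assumes roots: "\<And>n::nat. n > 0 \<Longrightarrow> \<exists>z::'k. primitive_root_of_unity n z"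
    and q: "prime q"
    and G: "group G" "cyclic_group G" "order G = q"
    and A: "comm_group A" "\<exists>\<pi>. (\<forall>p \<in> \<pi>. prime p) \<and> cyclic_pi_torsion A \<pi>"
    and ell_hom: "pos_monoid_hom ell"
  shows "(semisimple_ring (subchar_algebra ell A G) \<longleftrightarrow> ell q \<noteq> of_nat (card (dual A G)))
    \<and> (semisimple_ring (subchar_algebra ell A G) \<longrightarrow>
        (if card (dual A G) = 1
         then subchar_algebra ell A G \<cong>\<^sub>a
                mat_alg TYPE('k) (card (dual A G) + 1) \<oplus>\<^sub>a power_alg TYPE('k) (q - 1)
         else subchar_algebra ell A G \<cong>\<^sub>a
                mat_alg TYPE('k) (card (dual A G) + 1) \<oplus>\<^sub>a
                mat_alg TYPE('k) (card (dual A G) - 1) \<oplus>\<^sub>a power_alg TYPE('k) (q - 1)))"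
proof -
  interpret G: group G by (rule G)
  interpret A: comm_group A by (rule A)
  have q1: "q > 1" by (rule prime_gt_1_nat[OF q])
  obtain g where g: "g \<in> carrier G" and carG: "carrier G = range (\<lambda>k::int. g [^]\<^bsub>G\<^esub> k)"
    using G(2) G.cyclic_group by auto
  have "generate G {g} = carrier G" using carG G.generate_pow[OF g] by auto
  hence ord_g: "G.ord g = q" using G.generate_pow_card[OF g] G(3) by (simp add: Coset.order_def)
  obtain \<pi> where \<pi>: "cyclic_pi_torsion A \<pi>" using A(2) by blast
  define n where "n = card (torsion A q)"
  let ?T = "A\<lparr>carrier := torsion A q\<rparr>"
  have tors: "cyclic_group ?T" "n = pi_part \<pi> q"
    using \<pi> q1 by (auto simp: cyclic_pi_torsion_def n_def)
  \<comment> \<open>The \<pi>-part of the prime \<open>q\<close> is \<open>q\<close> or 1, according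
    to whether \<open>q \<in> \<pi>\<close>.\<close>
  have n_cases: "n = 1 \<or> n = q"
  proof -
    have "prime_factors q = {q}" using q by (simp add: prime_factorization_prime)
    thus ?thesis using tors(2) q by (cases "q \<in> \<pi>") (auto simp: pi_part_def)
  qed
  have subT: "subgroup (torsion A q) A"
    by (rule A.subgroupI)
      (auto simp: torsion_def A.nat_pow_distrib A.nat_pow_inv intro!: exI[of _ "\<one>\<^bsub>A\<^esub>"])
  interpret T: group ?T by (rule A.subgroup_imp_group[OF subT])
  obtain z where zT: "z \<in> torsion A q" and T: "torsion A q = range (\<lambda>k::int. z [^]\<^bsub>?T\<^esub> k)"
    using tors(1) T.cyclic_group by auto
  have z: "z \<in> carrier A" using zT by (simp add: torsion_def)
  have T: "torsion A q = range (\<lambda>k::int. z [^]\<^bsub>A\<^esub> k)"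
    using T by (simp add: A.int_pow_consistent[OF subT zT])
  hence "generate A {z} = torsion A q" using A.generate_pow[OF z] by auto
  hence ord_z: "A.ord z = n" using A.generate_pow_card[OF z] by (simp add: n_def)
  interpret deformed_subchar_algebra q n G A g z ell
  proof unfold_locales
    show "ell 1 = 1" "ell q \<noteq> 0" using ell_hom q1 by (auto simp: pos_monoid_hom_def)
    show "\<exists>k::int. u = g [^]\<^bsub>G\<^esub> k" if "u \<in> carrier G" for u using that carG by auto
    show "\<exists>i::int. a = z [^]\<^bsub>A\<^esub> i" if "a \<in> carrier A" "a [^]\<^bsub>A\<^esub> q = \<one>\<^bsub>A\<^esub>" for a
    proof -
      have "a \<in> torsion A q" using that by (simp add: torsion_def)
      thus ?thesis using T by auto
    qed
    show "g [^]\<^bsub>G\<^esub> k = g [^]\<^bsub>G\<^esub> l \<longleftrightarrow> int q dvd k - l" for k l :: int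
      using G.int_pow_eq[OF g] ord_g by (simp add: dvd_diff_commute)
    show "z [^]\<^bsub>A\<^esub> k = z [^]\<^bsub>A\<^esub> l \<longleftrightarrow> int n dvd k - l" for k l :: int
      using A.int_pow_eq[OF z] ord_z by (simp add: dvd_diff_commute)
  qed (use q n_cases g z in auto)
  have ss_iso: "semisimple_ring alg \<and> (\<exists>h \<in> ring_iso alg target.
      \<forall>c. \<forall>f \<in> carrier alg. h (c \<odot>\<^bsub>alg\<^esub> f) = c \<odot>\<^bsub>target\<^esub> h f)"
    if ne: "ell q \<noteq> of_nat n"
  proof -
    \<comment> \<open>The root of order \<open>q\<close> defines the induced representation, the
      root of order \<open>q - 1\<close> the linear characters.\<close>
    obtain \<epsilon> :: 'k where \<epsilon>: "primitive_root_of_unity q \<epsilon>" using roots q1 by force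
    obtain w :: 'k where w: "primitive_root_of_unity (q - 1) w" using roots q1 by force
    obtain \<chi> where \<chi>: "inj_on \<chi> {1..<q}"
      "\<And>a b. a \<in> {1..<q} \<Longrightarrow> b \<in> {1..<q} \<Longrightarrow> \<chi> (a * b mod q) = \<chi> a * \<chi> b" "\<chi> 1 = (1 :: 'k)"
      using faithful_multiplicative_character[OF q w] by metis
    have iso: "rep \<epsilon> \<chi> \<in> ring_iso alg target"
      using rep_ring_hom[OF \<epsilon> \<chi>(3,2)] rep_bij[OF \<epsilon> \<chi>(1) ne] by (simp add: ring_iso_def)
    have target: "ring target"
      by (intro ring_alg_prod ring_mat_alg ring_power_alg)
    have "rep \<epsilon> \<chi> \<zero>\<^bsub>alg\<^esub> = \<zero>\<^bsub>target\<^esub>"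
      unfolding rep_def alg_prod_simps module_mat_simps power_alg_simps prod.inject alg_simps lin_0
      by (intro conjI eq_matI) auto
    note pullback = ring_iso_pullback[OF target iso mult_in_alg add_in_alg one_in_alg zero_in_alg this]
    \<comment> \<open>The idempotents are explicit only in the matrix algebras, so they are carried
      back along the inverse isomorphism.\<close>
    have "primitive_idempotent_system (inv_into (carrier alg) (rep \<epsilon> \<chi>) ` E) alg"
      if "primitive_idempotent_system E target" for E
      by (rule primitive_idempotent_system_iso[OF target pullback that])
    hence "semisimple_ring alg"
      using semisimple_ring_if_primitive_idempotent_system[OF pullback(1)]
        primitive_idempotent_system_alg_prod[OF ring_mat_alg ring_alg_prod[OF ring_mat_alg ring_power_alg]
          primitive_idempotent_system_mat_alg primitive_idempotent_system_alg_prod[OF ring_mat_alg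
          ring_power_alg primitive_idempotent_system_mat_alg primitive_idempotent_system_power_alg]]
      by blast
    thus ?thesis using iso rep_scale by blast
  qed
  have ss: "semisimple_ring alg \<longleftrightarrow> ell q \<noteq> of_nat n" using ss_iso not_semisimple by blast
  moreover have "alg \<cong>\<^sub>a target" if "ell q \<noteq> of_nat n"
    using ss_iso[OF that] unfolding alg_isomorphic_def by blast
  moreover have "alg \<cong>\<^sub>a mat_alg TYPE('k) (n + 1) \<oplus>\<^sub>a power_alg TYPE('k) (q - 1)"
    if ne: "ell q \<noteq> of_nat n" and n: "n = 1"
  proof -
    obtain h where h: "h \<in> ring_iso alg target"
      and sc: "\<And>c f. f \<in> carrier alg \<Longrightarrow> h (c \<odot>\<^bsub>alg\<^esub> f) = c \<odot>\<^bsub>target\<^esub> h f"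
      using ss_iso[OF ne] by blast
    have "(\<lambda>f. (fst (h f), snd (snd (h f))))
        \<in> ring_iso alg (mat_alg TYPE('k) (n + 1) \<oplus>\<^sub>a power_alg TYPE('k) (q - 1))"
      by (rule ring_iso_drop_mat_0) (use h n in simp)
    moreover have "(fst (h (c \<odot>\<^bsub>alg\<^esub> f)), snd (snd (h (c \<odot>\<^bsub>alg\<^esub> f))))
        = c \<odot>\<^bsub>mat_alg TYPE('k) (n + 1) \<oplus>\<^sub>a power_alg TYPE('k) (q - 1)\<^esub> (fst (h f), snd (snd (h f)))"
      if "f \<in> carrier alg" for c f
      unfolding sc[OF that] by (cases "h f") simp
    ultimately show ?thesis
      unfolding alg_isomorphic_def by (intro bexI[of _ "\<lambda>f. (fst (h f), snd (snd (h f)))"] allI ballI)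
  qed
  ultimately show ?thesis unfolding card_dual by auto
qed

end
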